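(* Let $K$ be a compact Hausdorff space. Then the additive group of $M_c(K)$ and its subgroups $L(K)$ and $A(K)$ (the free locally convex space and the free Abelian topological group on $K$) are unitarily representable.
   Context: A topological group is called unitarily representable if it is topologically isomorphic to a subgroup of the unitary group $\mathcal{U}(\mathbb{H})$ of some Hilbert space $\mathbb{H}$ (of arbitrary dimension), where $\mathcal{U}(\mathbb{H})$ carries the strong operator topology. $M_c(K)$ denotes the dual space $C(K,\mathbb{R})^\ast$ of the Banach space $C(K,\mathbb{R})$ (sup norm), equipped with the topology of uniform convergence on norm-compact subsets of $C(K,\mathbb{R})$. For a completely regular space $X$, the free locally convex space $L(X)$ (resp. the free Abelian topological group $A(X)$) is the free real vector space (resp. free Abelian group) on the set $X$ with the locally convex vector space topology (resp. topological group topology), inducing the original topology on $X$, such that every continuous function $f\colon X\to E$ into a locally convex space (resp. Abelian topological group) $E$ extends to a continuous linear map $L(X)\to E$ (resp. continuous homomorphism $A(X)\to E$). $C(X,\mathbb{R})$ is the space of continuous linear functionals on $L(X)$, and the topology of $L(X)$ is that of uniform convergence on equicontinuous pointwise bounded subsets of $C(X,\mathbb{R})$; $C(X,\mathbb{T})$ is the group of continuous characters of $A(X)$, and the topology of $A(X)$ is that of uniform convergence on equicontinuous subsets of $C(X,\mathbb{T})$. For $K$ compact, $L(K)$ is viewed as a topological subgroup of $M_c(K)$ by sending each $x\in K$ to the evaluation functional $f\mapsto f(x)$, and $A(K)$ is a topological subgroup of $L(K)$ (the subgroup generated by $K$). *)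

theory Defs
  imports
    "HOL-Analysis.Analysis"
    "HOL-Algebra.Module"
    "HOL-Algebra.Bij"
    "HOL-Algebra.Free_Abelian_Groups"
begin

section \<open>Vector spaces and topological groups on carrier sets\<close>

definition scalars :: "'a::field ring" where
  "scalars = \<lparr>carrier = UNIV, mult = (*), one = 1, ring.zero = 0, ring.add = (+)\<rparr>"

text \<open>The ring multiplication and unit of the record type \<^type>\<open>module\<close> play no role; vector spaces
  are modules over \<^const>\<open>scalars\<close>.\<close>

definition linear_between ::
  "('c::field, 'a, 'm) module_scheme \<Rightarrow> ('c, 'b, 'n) module_scheme \<Rightarrow> ('a \<Rightarrow> 'b) \<Rightarrow> bool" where
  "linear_between M N h \<longleftrightarrow>
     h \<in> carrier M \<rightarrow> carrier N \<and>
     (\<forall>x\<in>carrier M. \<forall>y\<in>carrier M. h (x \<oplus>\<^bsub>M\<^esub> y) = h x \<oplus>\<^bsub>N\<^esub> h y) \<and>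
     (\<forall>c. \<forall>x\<in>carrier M. h (c \<odot>\<^bsub>M\<^esub> x) = c \<odot>\<^bsub>N\<^esub> h x)"

definition topological_abelian_group :: "('a, 'm) monoid_scheme \<Rightarrow> 'a topology \<Rightarrow> bool" where
  "topological_abelian_group G T \<longleftrightarrow>
     comm_group G \<and> topspace T = carrier G \<and> Hausdorff_space T \<and>
     continuous_map (prod_topology T T) T (\<lambda>(x, y). x \<otimes>\<^bsub>G\<^esub> y) \<and>
     continuous_map T T (\<lambda>x. inv\<^bsub>G\<^esub> x)"

definition locally_convex_space :: "(real, 'a, 'm) module_scheme \<Rightarrow> 'a topology \<Rightarrow> bool" where
  "locally_convex_space E T \<longleftrightarrow>
     Module.module (scalars :: real ring) E \<and>
     topological_abelian_group (add_monoid E) T \<and>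
     continuous_map (prod_topology euclideanreal T) T (\<lambda>(c, x). c \<odot>\<^bsub>E\<^esub> x) \<and>
     (\<forall>U. openin T U \<and> \<zero>\<^bsub>E\<^esub> \<in> U \<longrightarrow>
        (\<exists>W. openin T W \<and> \<zero>\<^bsub>E\<^esub> \<in> W \<and> W \<subseteq> U \<and>
          (\<forall>x\<in>W. \<forall>y\<in>W. \<forall>t\<in>{0..1}. ((1 - t) \<odot>\<^bsub>E\<^esub> x) \<oplus>\<^bsub>E\<^esub> (t \<odot>\<^bsub>E\<^esub> y) \<in> W)))"

definition topological_group_embedding ::
  "('a, 'm) monoid_scheme \<Rightarrow> 'a topology \<Rightarrow> ('b, 'n) monoid_scheme \<Rightarrow> 'b topology \<Rightarrow> ('a \<Rightarrow> 'b) \<Rightarrow> bool"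
  where
  "topological_group_embedding G S H T h \<longleftrightarrow>
     topspace S = carrier G \<and> topspace T = carrier H \<and> h \<in> hom G H \<and> embedding_map S T h"


section \<open>Hilbert spaces and their unitary groups\<close>

record 'h inner_space = "(complex, 'h) module" +
  cinner :: "'h \<Rightarrow> 'h \<Rightarrow> complex"

text \<open>The value off the carrier is immaterial; \<open>0\<close> is chosen because the locale
  \<^locale>\<open>Metric_space\<close> requires nonnegativity and symmetry of the distance everywhere.\<close>

definition inner_dist :: "'h inner_space \<Rightarrow> 'h \<Rightarrow> 'h \<Rightarrow> real" where
  "inner_dist H x y =
     (if x \<in> carrier H \<and> y \<in> carrier H
      then sqrt (Re (cinner H (x \<ominus>\<^bsub>H\<^esub> y) (x \<ominus>\<^bsub>H\<^esub> y))) else 0)"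

definition hilbert_space :: "'h inner_space \<Rightarrow> bool" where
  "hilbert_space H \<longleftrightarrow>
     Module.module (scalars :: complex ring) H \<and>
     (\<forall>x\<in>carrier H. \<forall>y\<in>carrier H. \<forall>z\<in>carrier H.
        cinner H (x \<oplus>\<^bsub>H\<^esub> y) z = cinner H x z + cinner H y z) \<and>
     (\<forall>c. \<forall>x\<in>carrier H. \<forall>y\<in>carrier H. cinner H (c \<odot>\<^bsub>H\<^esub> x) y = c * cinner H x y) \<and>
     (\<forall>x\<in>carrier H. \<forall>y\<in>carrier H. cinner H y x = cnj (cinner H x y)) \<and>
     (\<forall>x\<in>carrier H. x \<noteq> \<zero>\<^bsub>H\<^esub> \<longrightarrow> Re (cinner H x x) > 0) \<and>
     Metric_space.mcomplete (carrier H) (inner_dist H)"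

text \<open>Operators are extensional functions (value \<^const>\<open>undefined\<close> outside the carrier), as in
  \<^const>\<open>BijGroup\<close>, so that equality of operators is equality on the carrier.\<close>

definition unitary_group :: "'h inner_space \<Rightarrow> ('h \<Rightarrow> 'h) monoid" where
  "unitary_group H = BijGroup (carrier H)
     \<lparr>carrier := {u \<in> Bij (carrier H). linear_between H H u \<and>
        (\<forall>x\<in>carrier H. \<forall>y\<in>carrier H. cinner H (u x) (u y) = cinner H x y)}\<rparr>"

text \<open>The product topology is that of pointwise convergence, here with respect to the norm.\<close>

definition strong_operator_topology :: "'h inner_space \<Rightarrow> ('h \<Rightarrow> 'h) topology" where
  "strong_operator_topology H =
     subtopology
       (product_topology (\<lambda>_. Metric_space.mtopology (carrier H) (inner_dist H)) (carrier H))
       (carrier (unitary_group H))"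

text \<open>Higher-order logic cannot quantify over types inside a formula, so the underlying set of the
  Hilbert space has to be taken from one fixed type.  The type below is large enough for this to be
  no restriction. Suppose \<open>G\<close> is a topological subgroup of the unitary group of an arbitrary Hilbert
  space.  For each of the at most \<open>2\<^bsup>|G|\<^esup>\<close> identity neighbourhoods in \<open>G\<close>, finitely many vectors
  determine a smaller neighbourhood; the closed invariant subspace generated by all these vectors
  still carries a topologically faithful representation and has dimension at most \<open>2\<^bsup>|G|\<^esup>\<close> if
  \<open>G\<close> is infinite (and can be chosen finite-dimensional if \<open>G\<close> is finite).  Hence it is isomorphic
  to some \<open>\<ell>\<^sup>2(I)\<close> with \<open>I\<close> a set of pairs as below.\<close>

definition unitarily_representable :: "('g, 'm) monoid_scheme \<Rightarrow> 'g topology \<Rightarrow> bool" where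
  "unitarily_representable G T \<longleftrightarrow>
     (\<exists>(H :: ('g set \<times> 'g \<Rightarrow> complex) inner_space) \<pi>.
        hilbert_space H \<and>
        topological_group_embedding G T (unitary_group H) (strong_operator_topology H) \<pi>)"


section \<open>The dual of C(K) with the topology of compact convergence\<close>

text \<open>For compact \<open>K\<close> all continuous real functions are bounded, so \<open>cfunspace\<close> is the space of all
  of them (as functions extensional on the underlying set), with the supremum metric.\<close>

definition C_space :: "'k topology \<Rightarrow> ('k \<Rightarrow> real) metric" where
  "C_space K = cfunspace K euclidean_metric"

definition C_dual :: "'k topology \<Rightarrow> (('k \<Rightarrow> real) \<Rightarrow> real) set" where
  "C_dual K = {\<phi> \<in> extensional (mspace (C_space K)).
     continuous_map (mtopology_of (C_space K)) euclideanreal \<phi> \<and>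
     (\<forall>f\<in>mspace (C_space K). \<forall>g\<in>mspace (C_space K). \<forall>a b.
        \<phi> (\<lambda>x\<in>topspace K. a * f x + b * g x) = a * \<phi> f + b * \<phi> g)}"

definition Mc_group :: "'k topology \<Rightarrow> (('k \<Rightarrow> real) \<Rightarrow> real) monoid" where
  "Mc_group K =
     \<lparr>carrier = C_dual K,
      mult = (\<lambda>\<phi> \<psi>. \<lambda>f\<in>mspace (C_space K). \<phi> f + \<psi> f),
      one = (\<lambda>f\<in>mspace (C_space K). 0)\<rparr>"

text \<open>Each generating set is open for uniform convergence on \<open>A\<close>, because the supremum of
  \<open>\<bar>\<psi> f - \<phi> f\<bar>\<close> over the compact set \<open>A\<close> is attained.\<close>

definition Mc_topology :: "'k topology \<Rightarrow> (('k \<Rightarrow> real) \<Rightarrow> real) topology" where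
  "Mc_topology K = topology_generated_by
     {{\<psi> \<in> C_dual K. \<forall>f\<in>A. \<bar>\<psi> f - \<phi> f\<bar> < e} | \<phi> A e.
        \<phi> \<in> C_dual K \<and> compactin (mtopology_of (C_space K)) A \<and> e > 0}"


section \<open>Free locally convex spaces and free Abelian topological groups\<close>

definition free_vector_space :: "'k set \<Rightarrow> (real, 'k \<Rightarrow>\<^sub>0 real) module" where
  "free_vector_space S =
     \<lparr>carrier = {a. Poly_Mapping.keys a \<subseteq> S}, mult = undefined, one = undefined,
      ring.zero = 0, ring.add = (+), smult = (\<lambda>c. Poly_Mapping.map ((*) c))\<rparr>"

text \<open>In the universal property of \<open>L(X)\<close>, the test spaces \<open>E\<close> may be taken with carrier in the type
  \<open>'k \<Rightarrow>\<^sub>0 real\<close>: a map from \<open>X\<close> to an arbitrary locally convex space has values in the span of its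
  image, which is a linear image of the free vector space on \<open>X\<close> and so has a copy on a set of
  representatives in that type. The same remark applies to \<open>A(X)\<close> and \<open>'k \<Rightarrow>\<^sub>0 int\<close>.\<close>

definition free_lcs_topology :: "'k topology \<Rightarrow> ('k \<Rightarrow>\<^sub>0 real) topology \<Rightarrow> bool" where
  "free_lcs_topology X \<tau> \<longleftrightarrow>
     locally_convex_space (free_vector_space (topspace X)) \<tau> \<and>
     embedding_map X \<tau> (\<lambda>x. Poly_Mapping.single x 1) \<and>
     (\<forall>(E :: (real, 'k \<Rightarrow>\<^sub>0 real) module) T f.
        locally_convex_space E T \<and> continuous_map X T f \<longrightarrow>
        (\<exists>h. linear_between (free_vector_space (topspace X)) E h \<and> continuous_map \<tau> T h \<and>
          (\<forall>x\<in>topspace X. h (Poly_Mapping.single x 1) = f x)))"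

definition free_abelian_group_topology :: "'k topology \<Rightarrow> ('k \<Rightarrow>\<^sub>0 int) topology \<Rightarrow> bool" where
  "free_abelian_group_topology X \<tau> \<longleftrightarrow>
     topological_abelian_group (free_Abelian_group (topspace X)) \<tau> \<and>
     embedding_map X \<tau> frag_of \<and>
     (\<forall>(E :: ('k \<Rightarrow>\<^sub>0 int) monoid) T f.
        topological_abelian_group E T \<and> continuous_map X T f \<longrightarrow>
        (\<exists>h. h \<in> hom (free_Abelian_group (topspace X)) E \<and> continuous_map \<tau> T h \<and>
          (\<forall>x\<in>topspace X. h (frag_of x) = f x)))"

text \<open>The linear extension to \<open>L(K)\<close> of the map sending each point to its evaluation functional.\<close>

definition evaluation :: "'k topology \<Rightarrow> ('k \<Rightarrow>\<^sub>0 real) \<Rightarrow> ('k \<Rightarrow> real) \<Rightarrow> real" where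
  "evaluation K a =
     (\<lambda>f\<in>mspace (C_space K). \<Sum>x\<in>Poly_Mapping.keys a. Poly_Mapping.lookup a x * f x)"

end

theory Submission
  imports Defs "HOL-Library.Function_Algebras" "HOL-Combinatorics.Cycles"
begin

text \<open>A topological Abelian group is unitarily representable as soon as its topology is given by
  continuous positive definite functions: each such function \<open>p\<close> yields the kernel
  \<open>p (x y\<^sup>-\<^sup>1)\<close>, whose reproducing kernel Hilbert space carries a unitary representation by
  translations, and \<open>p\<close> measures how far the translates of a kernel function move.  This is
  \<open>pd_separated_imp_unitarily_representable\<close>; the hypothesis passes to topological subgroups
  (\<open>pd_separated_embedding\<close>), so that the two free objects follow from \<open>M\<^sub>c(K)\<close> once they are
  known to be embedded in it.

  On the dual of \<open>C(K)\<close> the positive definite functions are \<open>exp (- N)\<close>, where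
  \<open>N \<phi> = (\<Sum>j. \<bar>\<phi> h\<^sub>j\<bar>)\<close> for a sequence of functions \<open>h\<^sub>j\<close>.  The absolute value on the line is
  conditionally negative definite, hence so is the \<open>\<ell>\<^sup>1\<close> sum \<open>N\<close>.  A norm of this shape is
  continuous for uniform convergence on compact sets if the \<open>h\<^sub>j\<close> come in finite blocks with
  geometrically decreasing \<open>sup (\<Sum>\<bar>h\<^sub>j\<bar>)\<close>: the signed sums of the blocks, suitably rescaled,
  form a null sequence of finite sets.

  Such norms suffice because of partitions of unity.  Let \<open>d\<close> be a continuous pseudometric on \<open>K\<close>
  and let the functions \<open>g m y\<close>, for \<open>y\<close> in a finite set \<open>I m\<close>, form a partition of unity subordinate
  to the \<open>d\<close>-balls of radius \<open>1 / 4 ^ m\<close> around the points \<open>y\<close>.  A map \<open>v\<close> on \<open>K\<close> that is 1-Lipschitz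
  from \<open>d\<close> to a seminorm \<open>q\<close> is integrated against \<open>\<phi>\<close> by the Riemann sums
  \<open>P m = (\<Sum>y\<in>I m. \<phi> (g m y) v y)\<close>, and
  \<open>P (m + 1) - P m = (\<Sum>y\<in>I (m + 1). \<Sum>z\<in>I m. \<phi> (g (m + 1) y * g m z) (v y - v z))\<close>, in which only pairs
  of close centres contribute.  Telescoping bounds \<open>q\<close> of the limit by the norm \<open>N\<close> attached to the
  products \<open>g (m + 1) y * g m z\<close> with weights of order \<open>1 / 4 ^ m\<close>; see \<open>dominated\<close>.  With \<open>v = f\<close> scalar
  this bounds \<open>\<bar>\<phi> f\<bar>\<close> uniformly for \<open>f\<close> in an equicontinuous bounded set, which is the assertion about
  \<open>M\<^sub>c(K)\<close>.  With \<open>v\<close> the canonical map into \<open>L(K)\<close> and \<open>q\<close> a continuous seminorm it bounds \<open>q\<close> by a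
  function continuous for compact convergence, so the topology of \<open>L(K)\<close> is not finer than the
  induced one; the converse is the universal property.

  For \<open>A(K)\<close> integrality matters.  A neighbourhood of zero contains the open unit ball of a pseudonorm
  \<open>q\<close> (\<open>free_Abelian_group_pseudonorm\<close>), and with \<open>d x y = q (x - y)\<close> an element
  \<open>x\<^sub>1 + \<dots> + x\<^sub>n - y\<^sub>1 - \<dots> - y\<^sub>n\<close> has \<open>q\<close> at most the cost of the cheapest matching of the \<open>x\<^sub>i\<close> with
  the \<open>y\<^sub>j\<close>.  By duality for the assignment problem (\<open>assignment_duality\<close>) that cost is attained by
  the difference of the sums of a single 1-Lipschitz function, to which the scalar bound applies.
  Elements with nonzero coefficient sum are kept away by the constant function 1.\<close>

section \<open>Positive semidefinite kernels\<close>

definition psd_kernel :: "('x \<Rightarrow> 'x \<Rightarrow> real) \<Rightarrow> bool" where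
  "psd_kernel k \<longleftrightarrow> (\<forall>x y. k x y = k y x) \<and>
     (\<forall>S c. finite S \<longrightarrow> 0 \<le> (\<Sum>x\<in>S. \<Sum>y\<in>S. c x * c y * k x y))"

definition fin_supp :: "('x \<Rightarrow> complex) set" where
  "fin_supp = {c. finite {x. c x \<noteq> 0}}"

definition unit_at :: "'x \<Rightarrow> 'x \<Rightarrow> complex" where
  "unit_at y = (\<lambda>x. if x = y then 1 else 0)"

definition cscale :: "complex \<Rightarrow> ('x \<Rightarrow> complex) \<Rightarrow> 'x \<Rightarrow> complex" where
  "cscale a c = (\<lambda>x. a * c x)"

lemma cscale_apply [simp]: "cscale a c x = a * c x"
  by (simp add: cscale_def)

lemma fin_supp_add [intro]:
  assumes "c \<in> fin_supp" "d \<in> fin_supp"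
  shows "c + d \<in> fin_supp" "c - d \<in> fin_supp"
proof -
  have "finite ({x. c x \<noteq> 0} \<union> {x. d x \<noteq> 0})"
    using assms by (simp add: fin_supp_def)
  moreover have "{x. (c + d) x \<noteq> 0} \<subseteq> {x. c x \<noteq> 0} \<union> {x. d x \<noteq> 0}"
    "{x. (c - d) x \<noteq> 0} \<subseteq> {x. c x \<noteq> 0} \<union> {x. d x \<noteq> 0}" by auto
  ultimately show "c + d \<in> fin_supp" "c - d \<in> fin_supp"
    unfolding fin_supp_def by (blast intro: finite_subset)+
qed

lemmas fin_supp_diff = fin_supp_add(2)

lemma fin_supp_cscale [intro]: "c \<in> fin_supp \<Longrightarrow> cscale a c \<in> fin_supp"
  unfolding fin_supp_def by (auto elim!: finite_subset[rotated])

lemma fin_supp_zero [intro, simp]: "0 \<in> fin_supp"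
  unfolding fin_supp_def by auto

lemma fin_supp_unit_at [intro, simp]: "unit_at y \<in> fin_supp"
  unfolding fin_supp_def unit_at_def by auto

lemma fin_supp_induct [consumes 1, case_names zero add]:
  assumes "c \<in> fin_supp" and "P 0"
    and step: "\<And>a y c. c \<in> fin_supp \<Longrightarrow> P c \<Longrightarrow> P (cscale a (unit_at y) + c)"
  shows "P c"
proof -
  have "\<forall>c. {x. c x \<noteq> 0} \<subseteq> S \<longrightarrow> P c" if "finite S" for S
    using that
  proof (induction S rule: finite_induct)
    case empty
    have "c = 0" if "{x. c x \<noteq> 0} \<subseteq> {}" for c :: "'a \<Rightarrow> complex"
      using that by auto
    then show ?case using assms(2) by blast
  next
    case (insert y S)
    show ?case
    proof (intro allI impI)
      fix c :: "'a \<Rightarrow> complex" assume c: "{x. c x \<noteq> 0} \<subseteq> insert y S"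
      define c' where "c' = c(y := 0)"
      have sub: "{x. c' x \<noteq> 0} \<subseteq> S" using c by (auto simp: c'_def)
      then have "c' \<in> fin_supp" using insert.hyps(1) finite_subset by (auto simp: fin_supp_def)
      moreover have "P c'" using insert.IH sub by blast
      moreover have "c = cscale (c y) (unit_at y) + c'"
        by (auto simp: fun_eq_iff unit_at_def c'_def)
      ultimately show "P c" using step by metis
    qed
  qed
  then show ?thesis using assms(1) by (auto simp: fin_supp_def)
qed

locale kernel =
  fixes k :: "'x \<Rightarrow> 'x \<Rightarrow> real"
  assumes psd: "psd_kernel k"
begin

definition form :: "('x \<Rightarrow> complex) \<Rightarrow> ('x \<Rightarrow> complex) \<Rightarrow> complex" where
  "form c d = (\<Sum>x | c x \<noteq> 0. \<Sum>y | d y \<noteq> 0. c x * cnj (d y) * of_real (k x y))"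

lemma k_sym: "k x y = k y x"
  using psd by (auto simp: psd_kernel_def)

lemma psd_sum: "finite S \<Longrightarrow> 0 \<le> (\<Sum>x\<in>S. \<Sum>y\<in>S. c x * c y * k x y)"
  using psd by (auto simp: psd_kernel_def)

lemma form_eq:
  assumes "finite S" "finite T" "{x. c x \<noteq> 0} \<subseteq> S" "{x. d x \<noteq> 0} \<subseteq> T"
  shows "form c d = (\<Sum>x\<in>S. \<Sum>y\<in>T. c x * cnj (d y) * of_real (k x y))"
proof -
  have "form c d = (\<Sum>x\<in>S. \<Sum>y | d y \<noteq> 0. c x * cnj (d y) * of_real (k x y))"
    unfolding form_def using assms by (intro sum.mono_neutral_left) auto
  also have "\<dots> = (\<Sum>x\<in>S. \<Sum>y\<in>T. c x * cnj (d y) * of_real (k x y))"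
    using assms by (intro sum.cong sum.mono_neutral_left refl) auto
  finally show ?thesis .
qed

lemma form_cnj: "form d c = cnj (form c d)"
  unfolding form_def cnj_sum
  by (subst sum.swap) (simp add: k_sym mult_ac)

lemma form_add_left:
  assumes "c \<in> fin_supp" "c' \<in> fin_supp" "d \<in> fin_supp"
  shows "form (c + c') d = form c d + form c' d"
proof -
  let ?S = "{x. c x \<noteq> 0} \<union> {x. c' x \<noteq> 0}" and ?T = "{x. d x \<noteq> 0}"
  have f: "finite ?S" "finite ?T" using assms by (auto simp: fin_supp_def)
  have "form (c + c') d = (\<Sum>x\<in>?S. \<Sum>y\<in>?T. (c + c') x * cnj (d y) * of_real (k x y))"
    by (intro form_eq f) auto
  also have "\<dots> = (\<Sum>x\<in>?S. \<Sum>y\<in>?T. c x * cnj (d y) * of_real (k x y))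
      + (\<Sum>x\<in>?S. \<Sum>y\<in>?T. c' x * cnj (d y) * of_real (k x y))"
    by (simp add: algebra_simps sum.distrib)
  also have "\<dots> = form c d + form c' d"
    using f by (intro arg_cong2[of _ _ _ _ "(+)"] form_eq[symmetric]) auto
  finally show ?thesis .
qed

lemma form_cscale_left:
  assumes "c \<in> fin_supp" "d \<in> fin_supp"
  shows "form (cscale a c) d = a * form c d"
proof -
  let ?S = "{x. c x \<noteq> 0}" and ?T = "{x. d x \<noteq> 0}"
  have f: "finite ?S" "finite ?T" using assms by (auto simp: fin_supp_def)
  have "form (cscale a c) d = (\<Sum>x\<in>?S. \<Sum>y\<in>?T. cscale a c x * cnj (d y) * of_real (k x y))"
    by (intro form_eq f) auto
  also have "\<dots> = a * form c d"
    by (simp add: form_def sum_distrib_left mult_ac)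
  finally show ?thesis .
qed

lemma form_diff_left:
  assumes "c \<in> fin_supp" "c' \<in> fin_supp" "d \<in> fin_supp"
  shows "form (c - c') d = form c d - form c' d"
  using form_add_left[of "c - c'" c' d] assms by (simp add: fin_supp_diff)

lemma form_add_right:
  assumes "c \<in> fin_supp" "d \<in> fin_supp" "d' \<in> fin_supp"
  shows "form c (d + d') = form c d + form c d'"
  by (subst (1 2 3) form_cnj) (simp add: form_add_left assms)

lemma form_diff_right:
  assumes "c \<in> fin_supp" "d \<in> fin_supp" "d' \<in> fin_supp"
  shows "form c (d - d') = form c d - form c d'"
  by (subst (1 2 3) form_cnj) (simp add: form_diff_left assms)

lemma form_cscale_right:
  assumes "c \<in> fin_supp" "d \<in> fin_supp"
  shows "form c (cscale a d) = cnj a * form c d"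
  by (subst (1 2) form_cnj) (simp add: form_cscale_left assms)

lemma form_zero [simp]: "form 0 d = 0" "form c 0 = 0"
  by (auto simp: form_def)

lemma form_unit_at: "form (unit_at x) (unit_at y) = of_real (k x y)"
proof -
  have "{z. unit_at x z \<noteq> 0} = {x}" for x :: 'x by (auto simp: unit_at_def)
  then show ?thesis by (simp add: form_def) (simp add: unit_at_def)
qed

lemma form_self_nonneg:
  assumes "c \<in> fin_supp"
  shows "0 \<le> Re (form c c)" and "Im (form c c) = 0"
proof -
  let ?S = "{x. c x \<noteq> 0}"
  have f: "finite ?S" using assms by (auto simp: fin_supp_def)
  have "Re (form c c) = (\<Sum>x\<in>?S. \<Sum>y\<in>?S. Re (c x) * Re (c y) * k x y)
      + (\<Sum>x\<in>?S. \<Sum>y\<in>?S. Im (c x) * Im (c y) * k x y)"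
    by (simp add: form_def sum.distrib algebra_simps)
  also have "\<dots> \<ge> 0"
    by (intro add_nonneg_nonneg psd_sum f)
  finally show "0 \<le> Re (form c c)" .
  show "Im (form c c) = 0"
    using form_cnj[of c c] by (metis cnj.simps(2) equal_neg_zero)
qed

definition nrm :: "('x \<Rightarrow> complex) \<Rightarrow> real" where
  "nrm c = sqrt (Re (form c c))"

lemma nrm_nonneg [simp]: "c \<in> fin_supp \<Longrightarrow> 0 \<le> nrm c"
  by (simp add: nrm_def form_self_nonneg)

lemma nrm_sq: "c \<in> fin_supp \<Longrightarrow> (nrm c)\<^sup>2 = Re (form c c)"
  by (simp add: nrm_def form_self_nonneg)

text \<open>The Cauchy-Schwarz inequality for a form that may be degenerate: the quadratic polynomial
  \<open>\<parallel>s c - t d\<parallel>\<^sup>2\<close> in \<open>s, t\<close> is nonnegative, and the case of a null vector is treated apart because it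
  leaves no pair \<open>s, t\<close> to optimize.\<close>
lemma Re_form_le:
  assumes "c \<in> fin_supp" "d \<in> fin_supp"
  shows "Re (form c d) \<le> nrm c * nrm d"
proof -
  have ex: "0 \<le> s\<^sup>2 * (nrm c)\<^sup>2 - 2 * s * t * Re (form c d) + t\<^sup>2 * (nrm d)\<^sup>2" for s t :: real
  proof -
    let ?e = "cscale (of_real s) c - cscale (of_real t) d"
    have "0 \<le> Re (form ?e ?e)" using assms by (intro form_self_nonneg) auto
    also have "form ?e ?e = s\<^sup>2 * form c c - s * t * (form c d + form d c) + t\<^sup>2 * form d d"
      using assms by (simp add: form_diff_left form_diff_right form_cscale_left form_cscale_right
          fin_supp_cscale fin_supp_diff algebra_simps power2_eq_square)
    also have "form d c = cnj (form c d)" by (rule form_cnj)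
    finally show ?thesis
      unfolding nrm_sq[OF assms(1)] nrm_sq[OF assms(2)]
      by (simp add: algebra_simps power2_eq_square)
  qed
  show ?thesis
  proof (cases "nrm c = 0 \<or> nrm d = 0")
    case False
    then have pos: "nrm c > 0" "nrm d > 0" using assms by (auto simp: less_le)
    have "0 \<le> 2 * (nrm c * nrm d) * (nrm c * nrm d - Re (form c d))"
      using ex[of "nrm d" "nrm c"] by (simp add: algebra_simps power2_eq_square)
    moreover have "0 < 2 * (nrm c * nrm d)" using pos by simp
    ultimately show ?thesis by (metis diff_ge_0_iff_ge zero_le_mult_iff not_less)
  next
    case True
    then show ?thesis
    proof
      assume c: "nrm c = 0"
      show ?thesis
      proof (rule ccontr)
        assume "\<not> ?thesis"
        then have r: "Re (form c d) > 0" using c by simp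
        \<comment> \<open>the quadratic term in c vanishes, so a large multiple of c makes the polynomial negative\<close>
        define s where "s = ((nrm d)\<^sup>2 + 1) / (2 * Re (form c d))"
        have "2 * s * Re (form c d) = (nrm d)\<^sup>2 + 1" using r by (simp add: s_def)
        moreover have "0 \<le> - (2 * s * Re (form c d)) + (nrm d)\<^sup>2"
          using ex[of s 1] c by simp
        ultimately show False by simp
      qed
    next
      assume d: "nrm d = 0"
      show ?thesis
      proof (rule ccontr)
        assume "\<not> ?thesis"
        then have r: "Re (form c d) > 0" using d by simp
        define s where "s = ((nrm c)\<^sup>2 + 1) / (2 * Re (form c d))"
        have "2 * s * Re (form c d) = (nrm c)\<^sup>2 + 1" using r by (simp add: s_def)
        moreover have "0 \<le> - (2 * s * Re (form c d)) + (nrm c)\<^sup>2"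
          using ex[of 1 s] d by simp
        ultimately show False by simp
      qed
    qed
  qed
qed

lemma nrm_cscale: "c \<in> fin_supp \<Longrightarrow> nrm (cscale a c) = norm a * nrm c"
proof -
  assume c: "c \<in> fin_supp"
  have "form (cscale a c) (cscale a c) = (a * cnj a) * form c c"
    using c by (simp add: form_cscale_left form_cscale_right fin_supp_cscale mult_ac)
  also have "a * cnj a = of_real ((norm a)\<^sup>2)"
    by (simp only: complex_norm_square[symmetric])
  finally have eq: "form (cscale a c) (cscale a c) = of_real ((norm a)\<^sup>2) * form c c" .
  have "Re (form (cscale a c) (cscale a c)) = (norm a)\<^sup>2 * Re (form c c)"
    unfolding eq by (simp del: of_real_power)
  then show ?thesis unfolding nrm_def by (simp only: real_sqrt_mult) simp
qed

text \<open>Multiplying \<open>c\<close> by a unimodular scalar makes the value of the form real and nonnegative.\<close>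
lemma norm_form_le:
  assumes "c \<in> fin_supp" "d \<in> fin_supp"
  shows "norm (form c d) \<le> nrm c * nrm d"
proof (cases "form c d = 0")
  case True
  then show ?thesis using assms by simp
next
  case False
  define a where "a = cnj (sgn (form c d))"
  have "norm a = 1" using False by (simp add: a_def norm_sgn)
  have "form (cscale a c) d = of_real (norm (form c d))"
    using False assms complex_norm_square[of "form c d"]
    by (simp add: form_cscale_left a_def sgn_eq field_simps power2_eq_square)
  then have "norm (form c d) = Re (form (cscale a c) d)" by simp
  also have "\<dots> \<le> nrm (cscale a c) * nrm d" using assms by (intro Re_form_le) auto
  finally show ?thesis using assms \<open>norm a = 1\<close> by (simp add: nrm_cscale)
qed

lemma nrm_triangle:
  assumes "c \<in> fin_supp" "d \<in> fin_supp"
  shows "nrm (c + d) \<le> nrm c + nrm d"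
proof (rule power2_le_imp_le)
  have "Re (form d c) = Re (form c d)" by (subst form_cnj) simp
  then have "(nrm (c + d))\<^sup>2 = (nrm c)\<^sup>2 + 2 * Re (form c d) + (nrm d)\<^sup>2"
    using assms by (simp add: nrm_sq fin_supp_add form_add_left form_add_right)
  then show "(nrm (c + d))\<^sup>2 \<le> (nrm c + nrm d)\<^sup>2"
    using Re_form_le[OF assms] by (simp add: power2_eq_square algebra_simps)
qed (use assms in auto)

end

section \<open>The Hilbert space of a kernel\<close>

lemma cring_scalars: "cring (scalars :: 'c::field ring)"
proof (rule cringI)
  show "abelian_group (scalars :: 'c ring)"
  proof (rule abelian_groupI)
    fix x :: 'c
    show "\<exists>y\<in>carrier scalars. y \<oplus>\<^bsub>scalars\<^esub> x = \<zero>\<^bsub>scalars\<^esub>"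
      by (rule bexI[of _ "- x"]) (auto simp: scalars_def)
  qed (auto simp: scalars_def)
  show "Group.comm_monoid (scalars :: 'c ring)"
    by unfold_locales (auto simp: scalars_def)
qed (auto simp: scalars_def algebra_simps)

text \<open>Both the function space below and the free vector space inherit their additive structure from
  a type class; this reduces the module axioms over \<^const>\<open>scalars\<close> to closure properties.\<close>
lemma module_scalarsI:
  fixes M :: "('c::field, 'a::ab_group_add, 'm) module_scheme"
  assumes add: "ring.add M = (+)" and zero: "ring.zero M = 0"
    and cl: "\<And>x y. x \<in> carrier M \<Longrightarrow> y \<in> carrier M \<Longrightarrow> x + y \<in> carrier M"
      "0 \<in> carrier M" "\<And>x. x \<in> carrier M \<Longrightarrow> - x \<in> carrier M"
      "\<And>c x. x \<in> carrier M \<Longrightarrow> c \<odot>\<^bsub>M\<^esub> x \<in> carrier M"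
    and s: "\<And>c d x. x \<in> carrier M \<Longrightarrow> (c + d) \<odot>\<^bsub>M\<^esub> x = c \<odot>\<^bsub>M\<^esub> x + d \<odot>\<^bsub>M\<^esub> x"
      "\<And>c x y. x \<in> carrier M \<Longrightarrow> y \<in> carrier M \<Longrightarrow> c \<odot>\<^bsub>M\<^esub> (x + y) = c \<odot>\<^bsub>M\<^esub> x + c \<odot>\<^bsub>M\<^esub> y"
      "\<And>c d x. x \<in> carrier M \<Longrightarrow> (c * d) \<odot>\<^bsub>M\<^esub> x = c \<odot>\<^bsub>M\<^esub> (d \<odot>\<^bsub>M\<^esub> x)"
      "\<And>x. x \<in> carrier M \<Longrightarrow> 1 \<odot>\<^bsub>M\<^esub> x = x"
  shows "Module.module (scalars :: 'c ring) M"
    and "x \<in> carrier M \<Longrightarrow> y \<in> carrier M \<Longrightarrow> x \<ominus>\<^bsub>M\<^esub> y = x - y"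
proof -
  have ab: "abelian_group M"
  proof (rule abelian_groupI)
    fix x assume "x \<in> carrier M"
    then show "\<exists>y\<in>carrier M. y \<oplus>\<^bsub>M\<^esub> x = \<zero>\<^bsub>M\<^esub>"
      by (intro bexI[of _ "- x"]) (auto simp: add zero cl)
  qed (auto simp: add zero cl algebra_simps)
  show "Module.module (scalars :: 'c ring) M"
    using ab cring_scalars unfolding Module.module_def module_axioms_def
    by (auto simp: add cl s scalars_def)
  interpret abelian_group M by (rule ab)
  show "x \<in> carrier M \<Longrightarrow> y \<in> carrier M \<Longrightarrow> x \<ominus>\<^bsub>M\<^esub> y = x - y"
    using minus_equality[of "- y" y] by (simp add: a_minus_def add zero cl)
qed

context kernel
begin

text \<open>The completion of the finite combinations of kernel functions is realized by functions rather
  than by classes of Cauchy sequences: a Cauchy sequence of coefficients is identified with the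
  pointwise limit of the functions that it represents.\<close>
definition represents :: "(nat \<Rightarrow> 'x \<Rightarrow> complex) \<Rightarrow> ('x \<Rightarrow> complex) \<Rightarrow> bool" where
  "represents c F \<longleftrightarrow> (\<forall>n. c n \<in> fin_supp) \<and>
     (\<forall>e>0. \<exists>N. \<forall>m\<ge>N. \<forall>n\<ge>N. nrm (c m - c n) < e) \<and>
     (\<forall>y. (\<lambda>n. form (c n) (unit_at y)) \<longlonglongrightarrow> F y)"

definition rkhs :: "('x \<Rightarrow> complex) set" where
  "rkhs = {F. \<exists>c. represents c F}"

definition rep :: "('x \<Rightarrow> complex) \<Rightarrow> nat \<Rightarrow> 'x \<Rightarrow> complex" where
  "rep F = (SOME c. represents c F)"

text \<open>The choice of representatives is harmless by \<open>ip_tendsto\<close>.\<close>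
definition ip :: "('x \<Rightarrow> complex) \<Rightarrow> ('x \<Rightarrow> complex) \<Rightarrow> complex" where
  "ip F G = lim (\<lambda>n. form (rep F n) (rep G n))"

definition hnorm :: "('x \<Rightarrow> complex) \<Rightarrow> real" where
  "hnorm F = sqrt (Re (ip F F))"

definition potential :: "('x \<Rightarrow> complex) \<Rightarrow> 'x \<Rightarrow> complex" where
  "potential c y = form c (unit_at y)"

lemma representsD:
  assumes "represents c F"
  shows "c n \<in> fin_supp" "e > 0 \<Longrightarrow> \<exists>N. \<forall>m\<ge>N. \<forall>n\<ge>N. nrm (c m - c n) < e"
    "(\<lambda>n. form (c n) (unit_at y)) \<longlonglongrightarrow> F y"
  using assms by (auto simp: represents_def)

lemma represents_rep: "F \<in> rkhs \<Longrightarrow> represents (rep F) F"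
  unfolding rkhs_def rep_def mem_Collect_eq by (erule someI_ex)

lemma represents_in_rkhs: "represents c F \<Longrightarrow> F \<in> rkhs"
  by (auto simp: rkhs_def)

lemma represents_add:
  assumes "represents c F" "represents d G"
  shows "represents (\<lambda>n. c n + d n) (F + G)"
  unfolding represents_def
proof (intro conjI allI impI)
  note fs [simp] = representsD(1)[OF assms(1)] representsD(1)[OF assms(2)]
  show "c n + d n \<in> fin_supp" for n by auto
  fix e :: real assume "e > 0"
  then have e2: "e / 2 > 0" by simp
  obtain M where M: "\<And>m n. m \<ge> M \<Longrightarrow> n \<ge> M \<Longrightarrow> nrm (c m - c n) < e / 2"
    using representsD(2)[OF assms(1) e2] by blast
  obtain N where N: "\<And>m n. m \<ge> N \<Longrightarrow> n \<ge> N \<Longrightarrow> nrm (d m - d n) < e / 2"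
    using representsD(2)[OF assms(2) e2] by blast
  have "nrm (c m + d m - (c n + d n)) < e" if "m \<ge> max M N" "n \<ge> max M N" for m n
  proof -
    have eq: "c m + d m - (c n + d n) = (c m - c n) + (d m - d n)" by simp
    show ?thesis unfolding eq
      using nrm_triangle[of "c m - c n" "d m - d n"] M[of m n] N[of m n] that
      by (simp add: fin_supp_diff del: add_diff_eq diff_add_eq)
  qed
  then show "\<exists>N. \<forall>m\<ge>N. \<forall>n\<ge>N. nrm (c m + d m - (c n + d n)) < e" by blast
next
  fix y
  note fs [simp] = representsD(1)[OF assms(1)] representsD(1)[OF assms(2)]
  show "(\<lambda>n. form (c n + d n) (unit_at y)) \<longlonglongrightarrow> (F + G) y"
    using tendsto_add[OF representsD(3)[OF assms(1)] representsD(3)[OF assms(2)]]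
    by (simp add: form_add_left)
qed

lemma represents_cscale:
  assumes "represents c F"
  shows "represents (\<lambda>n. cscale a (c n)) (cscale a F)"
  unfolding represents_def
proof (intro conjI allI impI)
  note fs [simp] = representsD(1)[OF assms]
  show "cscale a (c n) \<in> fin_supp" for n by auto
  fix e :: real assume "e > 0"
  then obtain N where N: "\<And>m n. m \<ge> N \<Longrightarrow> n \<ge> N \<Longrightarrow> nrm (c m - c n) < e / (norm a + 1)"
    using representsD(2)[OF assms, of "e / (norm a + 1)"] by (auto simp: add_nonneg_pos)
  have "nrm (cscale a (c m) - cscale a (c n)) < e" if "m \<ge> N" "n \<ge> N" for m n
  proof -
    have "cscale a (c m) - cscale a (c n) = cscale a (c m - c n)"
      by (simp add: fun_eq_iff algebra_simps)
    then have "nrm (cscale a (c m) - cscale a (c n)) = norm a * nrm (c m - c n)"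
      using nrm_cscale[OF fin_supp_diff[OF fs fs], of a] by simp
    also have "\<dots> \<le> (norm a + 1) * nrm (c m - c n)"
      by (intro mult_right_mono) (auto intro!: nrm_nonneg fin_supp_diff)
    also have "\<dots> < e" using N[OF that] pos_less_divide_eq[of "norm a + 1" _ e]
      by (simp add: add_nonneg_pos mult.commute)
    finally show ?thesis .
  qed
  then show "\<exists>N. \<forall>m\<ge>N. \<forall>n\<ge>N. nrm (cscale a (c m) - cscale a (c n)) < e" by blast
next
  fix y
  show "(\<lambda>n. form (cscale a (c n)) (unit_at y)) \<longlonglongrightarrow> cscale a F y"
    using tendsto_mult_left[OF representsD(3)[OF assms], of a] representsD(1)[OF assms]
    by (simp add: form_cscale_left)
qed

lemma represents_diff:
  assumes "represents c F" "represents d G"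
  shows "represents (\<lambda>n. c n - d n) (F - G)"
proof -
  have eq: "c - d = c + cscale (-1) d" for c d :: "'x \<Rightarrow> complex" by (simp add: fun_eq_iff)
  show ?thesis unfolding eq by (intro represents_add represents_cscale assms)
qed

lemma represents_const: "c \<in> fin_supp \<Longrightarrow> represents (\<lambda>n. c) (potential c)"
  unfolding represents_def potential_def by (simp add: nrm_def)

lemma represents_bounded:
  assumes "represents c F"
  obtains B where "B > 0" "\<And>n. nrm (c n) \<le> B"
proof -
  note fs [simp] = representsD(1)[OF assms]
  obtain N where N: "\<And>m n. m \<ge> N \<Longrightarrow> n \<ge> N \<Longrightarrow> nrm (c m - c n) < 1"
    using representsD(2)[OF assms, of 1] by auto
  define B where "B = (\<Sum>n\<le>N. nrm (c n)) + 1"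
  have le: "nrm (c n) \<le> B - 1" if "n \<le> N" for n
    unfolding B_def
    using that member_le_sum[of n "{..N}" "\<lambda>n. nrm (c n)"] by simp
  have "nrm (c n) \<le> B" for n
  proof (cases "n \<le> N")
    case False
    then have "nrm (c n) \<le> nrm (c n - c N) + nrm (c N)"
      using nrm_triangle[of "c n - c N" "c N"] by (simp add: fin_supp_diff)
    with N[of n N] le[of N] False show ?thesis by simp
  qed (use le in force)
  moreover have "B > 0" unfolding B_def by (intro add_nonneg_pos sum_nonneg) auto
  ultimately show ?thesis using that by blast
qed

text \<open>The point on which the function model rests: a Cauchy sequence whose functions tend to zero
  pointwise tends to zero in norm, because
  \<open>\<parallel>c\<^sub>n\<parallel>\<^sup>2 = \<langle>c\<^sub>n, c\<^sub>n - c\<^sub>N\<rangle> + \<langle>c\<^sub>n, c\<^sub>N\<rangle>\<close>, where the first term is small by the Cauchy property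
  and the second by pointwise convergence.\<close>
lemma represents_zero:
  assumes "represents c 0"
  shows "(\<lambda>n. nrm (c n)) \<longlonglongrightarrow> 0"
proof -
  note fs [simp] = representsD(1)[OF assms]
  have lim: "(\<lambda>n. form (c n) d) \<longlonglongrightarrow> 0" if "d \<in> fin_supp" for d
    using that
  proof (induction rule: fin_supp_induct)
    case (add a y d)
    have lim: "(\<lambda>n. cnj a * form (c n) (unit_at y) + form (c n) d) \<longlonglongrightarrow> cnj a * 0 + 0"
      using representsD(3)[OF assms, of y] add by (intro tendsto_intros) auto
    have eq: "form (c n) (cscale a (unit_at y) + d) = cnj a * form (c n) (unit_at y) + form (c n) d" for n
      using add by (simp add: form_add_right form_cscale_right fin_supp_cscale)
    show ?case unfolding eq using lim by simp
  qed (simp only: form_zero tendsto_const)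
  obtain B where B: "B > 0" "\<And>n. nrm (c n) \<le> B" using represents_bounded[OF assms] by blast
  show ?thesis
  proof (rule LIMSEQ_I)
    fix e :: real assume e: "e > 0"
    then have e2: "e\<^sup>2 / (2 * B) > 0" using B by simp
    obtain N where N: "\<And>m n. m \<ge> N \<Longrightarrow> n \<ge> N \<Longrightarrow> nrm (c m - c n) < e\<^sup>2 / (2 * B)"
      using representsD(2)[OF assms e2] by auto
    have "\<exists>M. \<forall>n\<ge>M. norm (form (c n) (c N) - 0) < e\<^sup>2 / 2"
      by (rule LIMSEQ_D[OF lim]) (use e in auto)
    then obtain M where M: "\<And>n. n \<ge> M \<Longrightarrow> norm (form (c n) (c N)) < e\<^sup>2 / 2" by auto
    have "nrm (c n) < e" if n: "n \<ge> max M N" for n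
    proof (rule power2_less_imp_less)
      have "(nrm (c n))\<^sup>2 = Re (form (c n) (c n - c N)) + Re (form (c n) (c N))"
        by (simp add: nrm_sq form_diff_right)
      also have "\<dots> \<le> nrm (c n) * nrm (c n - c N) + norm (form (c n) (c N))"
        by (intro add_mono Re_form_le complex_Re_le_cmod) (auto intro!: nrm_nonneg fin_supp_diff)
      also have "\<dots> \<le> B * nrm (c n - c N) + norm (form (c n) (c N))"
        by (intro add_mono mult_right_mono B) (auto intro!: nrm_nonneg fin_supp_diff)
      also have "\<dots> < B * (e\<^sup>2 / (2 * B)) + e\<^sup>2 / 2"
        using n N[of n N] M[of n] B by (intro add_strict_mono mult_strict_left_mono) auto
      also have "\<dots> = e\<^sup>2" using B by simp
      finally show "(nrm (c n))\<^sup>2 < e\<^sup>2" .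
    qed (use e in auto)
    then show "\<exists>M. \<forall>n\<ge>M. norm (nrm (c n) - 0) < e"
      by (intro exI[of _ "max M N"]) simp
  qed
qed

lemma represents_unique:
  assumes "represents c F" "represents d F"
  shows "(\<lambda>n. nrm (c n - d n)) \<longlonglongrightarrow> 0"
  using represents_zero represents_diff[OF assms] by simp

text \<open>Representatives of the same function differ by a null sequence, and null sequences do not change
  the limit, by the Cauchy-Schwarz inequality.\<close>
lemma ip_tendsto:
  assumes c: "represents c F" and d: "represents d G"
  shows "(\<lambda>n. form (c n) (d n)) \<longlonglongrightarrow> ip F G"
proof -
  have FG: "F \<in> rkhs" "G \<in> rkhs" using assms represents_in_rkhs by auto
  define c' d' where "c' = rep F" and "d' = rep G"
  have c': "represents c' F" and d': "represents d' G"
    using FG represents_rep by (auto simp: c'_def d'_def)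
  have est: "norm (form u v - form u' v') \<le> nrm (u - u') * nrm v + nrm u' * nrm (v - v')"
    if "u \<in> fin_supp" "v \<in> fin_supp" "u' \<in> fin_supp" "v' \<in> fin_supp" for u v u' v'
  proof -
    have "form u v - form u' v' = form (u - u') v + form u' (v - v')"
      using that by (simp add: form_diff_left form_diff_right)
    also have "norm \<dots> \<le> norm (form (u - u') v) + norm (form u' (v - v'))"
      by (rule norm_triangle_ineq)
    also have "\<dots> \<le> nrm (u - u') * nrm v + nrm u' * nrm (v - v')"
      using that by (intro add_mono norm_form_le) (auto intro!: nrm_nonneg fin_supp_diff)
    finally show ?thesis .
  qed
  obtain B where B: "B > 0" "\<And>n. nrm (c' n) \<le> B" using represents_bounded[OF c'] by blast
  obtain B' where B': "B' > 0" "\<And>n. nrm (d' n) \<le> B'" using represents_bounded[OF d'] by blast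
  obtain C where C: "C > 0" "\<And>n. nrm (d n) \<le> C" using represents_bounded[OF d] by blast
  note fs [simp] = representsD(1)[OF c] representsD(1)[OF d] representsD(1)[OF c'] representsD(1)[OF d']
  have "Cauchy (\<lambda>n. form (c' n) (d' n))"
  proof (rule CauchyI)
    fix e :: real assume e: "e > 0"
    obtain M where M: "\<And>m n. m \<ge> M \<Longrightarrow> n \<ge> M \<Longrightarrow> nrm (c' m - c' n) < e / (2 * B')"
      using representsD(2)[OF c', of "e / (2 * B')"] B' e by auto
    obtain N where N: "\<And>m n. m \<ge> N \<Longrightarrow> n \<ge> N \<Longrightarrow> nrm (d' m - d' n) < e / (2 * B)"
      using representsD(2)[OF d', of "e / (2 * B)"] B e by auto
    have "norm (form (c' m) (d' m) - form (c' n) (d' n)) < e"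
      if "m \<ge> max M N" "n \<ge> max M N" for m n
    proof -
      have "norm (form (c' m) (d' m) - form (c' n) (d' n))
          \<le> nrm (c' m - c' n) * nrm (d' m) + nrm (c' n) * nrm (d' m - d' n)"
        by (rule est) auto
      also have "\<dots> \<le> nrm (c' m - c' n) * B' + B * nrm (d' m - d' n)"
        using B B' by (intro add_mono mult_mono) (auto intro!: nrm_nonneg fin_supp_diff)
      also have "\<dots> < e / (2 * B') * B' + B * (e / (2 * B))"
        using M[of m n] N[of m n] that B B'
        by (intro add_strict_mono mult_strict_right_mono mult_strict_left_mono) auto
      also have "\<dots> = e" using B B' by simp
      finally show ?thesis .
    qed
    then show "\<exists>M. \<forall>m\<ge>M. \<forall>n\<ge>M. norm (form (c' m) (d' m) - form (c' n) (d' n)) < e"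
      by blast
  qed
  then have l: "(\<lambda>n. form (c' n) (d' n)) \<longlonglongrightarrow> ip F G"
    unfolding ip_def c'_def d'_def using Cauchy_convergent convergent_LIMSEQ_iff by blast
  have "(\<lambda>n. nrm (c n - c' n) * C + B * nrm (d n - d' n)) \<longlonglongrightarrow> 0 * C + B * 0"
    by (intro tendsto_intros represents_unique[OF c c'] represents_unique[OF d d'])
  then have z: "(\<lambda>n. nrm (c n - c' n) * C + B * nrm (d n - d' n)) \<longlonglongrightarrow> 0" by simp
  have "(\<lambda>n. form (c n) (d n) - form (c' n) (d' n)) \<longlonglongrightarrow> 0"
  proof (rule Lim_null_comparison[OF always_eventually z], rule allI)
    fix n
    have "norm (form (c n) (d n) - form (c' n) (d' n))
        \<le> nrm (c n - c' n) * nrm (d n) + nrm (c' n) * nrm (d n - d' n)" by (rule est) auto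
    also have "\<dots> \<le> nrm (c n - c' n) * C + B * nrm (d n - d' n)"
      using B C by (intro add_mono mult_mono) (auto intro!: nrm_nonneg fin_supp_diff)
    finally show "norm (form (c n) (d n) - form (c' n) (d' n))
        \<le> nrm (c n - c' n) * C + B * nrm (d n - d' n)" .
  qed
  from tendsto_add[OF this l] show ?thesis by simp
qed

lemma rkhs_closed:
  "F \<in> rkhs \<Longrightarrow> G \<in> rkhs \<Longrightarrow> F + G \<in> rkhs"
  "F \<in> rkhs \<Longrightarrow> G \<in> rkhs \<Longrightarrow> F - G \<in> rkhs"
  "F \<in> rkhs \<Longrightarrow> cscale a F \<in> rkhs"
  "0 \<in> rkhs"
  "F \<in> rkhs \<Longrightarrow> - F \<in> rkhs"
proof -
  show "F \<in> rkhs \<Longrightarrow> G \<in> rkhs \<Longrightarrow> F + G \<in> rkhs"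
    "F \<in> rkhs \<Longrightarrow> G \<in> rkhs \<Longrightarrow> F - G \<in> rkhs"
    "F \<in> rkhs \<Longrightarrow> cscale a F \<in> rkhs"
    using represents_add represents_diff represents_cscale
    unfolding rkhs_def mem_Collect_eq by blast+
  have "potential 0 = 0" by (simp add: potential_def fun_eq_iff)
  then show zero: "0 \<in> rkhs" using represents_const[of 0] represents_in_rkhs by force
  assume "F \<in> rkhs"
  with zero have "0 - F \<in> rkhs"
    using represents_diff unfolding rkhs_def mem_Collect_eq by blast
  then show "- F \<in> rkhs" by simp
qed

lemma potential_in_rkhs [simp]: "c \<in> fin_supp \<Longrightarrow> potential c \<in> rkhs"
  using represents_const represents_in_rkhs by blast

lemma ip_add_left:
  assumes "F \<in> rkhs" "F' \<in> rkhs" "G \<in> rkhs"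
  shows "ip (F + F') G = ip F G + ip F' G"
proof -
  note r = assms[THEN represents_rep]
  have "(\<lambda>n. form (rep F n) (rep G n) + form (rep F' n) (rep G n)) \<longlonglongrightarrow> ip F G + ip F' G"
    by (intro tendsto_add ip_tendsto r)
  moreover have "(\<lambda>n. form (rep F n + rep F' n) (rep G n)) \<longlonglongrightarrow> ip (F + F') G"
    by (intro ip_tendsto represents_add r)
  ultimately show ?thesis
    using r[THEN representsD(1)] by (simp add: form_add_left LIMSEQ_unique)
qed

lemma ip_cscale_left:
  assumes "F \<in> rkhs" "G \<in> rkhs"
  shows "ip (cscale a F) G = a * ip F G"
proof -
  note r = assms[THEN represents_rep]
  have "(\<lambda>n. a * form (rep F n) (rep G n)) \<longlonglongrightarrow> a * ip F G"
    by (intro tendsto_mult_left ip_tendsto r)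
  moreover have "(\<lambda>n. form (cscale a (rep F n)) (rep G n)) \<longlonglongrightarrow> ip (cscale a F) G"
    by (intro ip_tendsto represents_cscale r)
  ultimately show ?thesis
    using r[THEN representsD(1)] by (simp add: form_cscale_left LIMSEQ_unique)
qed

lemma ip_cnj:
  assumes "F \<in> rkhs" "G \<in> rkhs"
  shows "ip G F = cnj (ip F G)"
proof -
  note r = assms[THEN represents_rep]
  have "(\<lambda>n. cnj (form (rep F n) (rep G n))) \<longlonglongrightarrow> cnj (ip F G)"
    by (intro tendsto_cnj ip_tendsto r)
  then have "(\<lambda>n. form (rep G n) (rep F n)) \<longlonglongrightarrow> cnj (ip F G)"
    by (simp flip: form_cnj)
  moreover have "(\<lambda>n. form (rep G n) (rep F n)) \<longlonglongrightarrow> ip G F"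
    by (intro ip_tendsto r)
  ultimately show ?thesis by (rule LIMSEQ_unique[symmetric])
qed

lemma hnorm_tendsto:
  assumes "represents c F"
  shows "(\<lambda>n. nrm (c n)) \<longlonglongrightarrow> hnorm F"
  unfolding nrm_def hnorm_def
  by (intro tendsto_intros ip_tendsto assms)

lemma hnorm_nonneg: "F \<in> rkhs \<Longrightarrow> 0 \<le> hnorm F"
  by (rule LIMSEQ_le_const[OF hnorm_tendsto[OF represents_rep]])
    (simp_all add: representsD(1)[OF represents_rep])

lemma Re_ip_self: 
  assumes "F \<in> rkhs" shows "Re (ip F F) = (hnorm F)\<^sup>2"
  using hnorm_nonneg[OF assms] unfolding hnorm_def by simp

lemma hnorm_triangle:
  assumes "F \<in> rkhs" "G \<in> rkhs"
  shows "hnorm (F + G) \<le> hnorm F + hnorm G"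
proof (rule LIMSEQ_le)
  note r = assms[THEN represents_rep]
  show "(\<lambda>n. nrm (rep F n + rep G n)) \<longlonglongrightarrow> hnorm (F + G)"
    by (intro hnorm_tendsto represents_add r)
  show "(\<lambda>n. nrm (rep F n) + nrm (rep G n)) \<longlonglongrightarrow> hnorm F + hnorm G"
    by (intro tendsto_add hnorm_tendsto r)
  show "\<exists>N. \<forall>n\<ge>N. nrm (rep F n + rep G n) \<le> nrm (rep F n) + nrm (rep G n)"
    using r[THEN representsD(1)] nrm_triangle by blast
qed

lemma hnorm_cscale:
  assumes "F \<in> rkhs"
  shows "hnorm (cscale a F) = norm a * hnorm F"
proof -
  note r = assms[THEN represents_rep]
  have "(\<lambda>n. norm a * nrm (rep F n)) \<longlonglongrightarrow> norm a * hnorm F"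
    by (intro tendsto_mult_left hnorm_tendsto r)
  moreover have "(\<lambda>n. nrm (cscale a (rep F n))) \<longlonglongrightarrow> hnorm (cscale a F)"
    by (intro hnorm_tendsto represents_cscale r)
  ultimately show ?thesis
    using r[THEN representsD(1)] by (simp add: nrm_cscale LIMSEQ_unique)
qed

lemma hnorm_minus_commute:
  assumes "F \<in> rkhs" "G \<in> rkhs"
  shows "hnorm (F - G) = hnorm (G - F)"
proof -
  have "cscale (-1) (G - F) = F - G" by (auto simp: fun_eq_iff)
  then show ?thesis using hnorm_cscale[of "G - F" "-1"] assms by (auto simp: rkhs_closed)
qed

lemma hnorm_triangle_diff:
  assumes "F \<in> rkhs" "G \<in> rkhs" "E \<in> rkhs"
  shows "hnorm (F - E) \<le> hnorm (F - G) + hnorm (G - E)"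
  using hnorm_triangle[of "F - G" "G - E"] assms by (simp add: rkhs_closed)

text \<open>Point evaluations are bounded, so that a function of norm zero vanishes.\<close>
lemma norm_apply_le:
  assumes "F \<in> rkhs"
  shows "norm (F y) \<le> hnorm F * nrm (unit_at y)"
proof (rule LIMSEQ_le)
  note r = assms[THEN represents_rep]
  show "(\<lambda>n. norm (form (rep F n) (unit_at y))) \<longlonglongrightarrow> norm (F y)"
    by (intro tendsto_norm representsD r)
  show "(\<lambda>n. nrm (rep F n) * nrm (unit_at y)) \<longlonglongrightarrow> hnorm F * nrm (unit_at y)"
    by (intro tendsto_intros hnorm_tendsto r)
  show "\<exists>N. \<forall>n\<ge>N. norm (form (rep F n) (unit_at y)) \<le> nrm (rep F n) * nrm (unit_at y)"
    using r[THEN representsD(1)] norm_form_le by auto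
qed

lemma hnorm_eq_0: "F \<in> rkhs \<Longrightarrow> hnorm F = 0 \<longleftrightarrow> F = 0"
proof -
  assume F: "F \<in> rkhs"
  have "ip 0 0 = 0" using ip_add_left[of 0 0 0] rkhs_closed(4) by simp
  moreover have "F = 0" if "hnorm F = 0"
    using norm_apply_le[OF F] that by (auto simp: fun_eq_iff)
  ultimately show ?thesis by (auto simp: hnorm_def)
qed

lemma hnorm_potential: "c \<in> fin_supp \<Longrightarrow> hnorm (potential c) = nrm c"
  by (rule LIMSEQ_unique[OF hnorm_tendsto[OF represents_const] tendsto_const])

text \<open>In the completion the constant sequences converge to the function that they approximate.\<close>
lemma potential_approx:
  assumes F: "F \<in> rkhs" and e: "e > 0"
  obtains c where "c \<in> fin_supp" "hnorm (F - potential c) < e"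
proof -
  note r = F[THEN represents_rep]
  obtain N where N: "\<And>m n. m \<ge> N \<Longrightarrow> n \<ge> N \<Longrightarrow> nrm (rep F m - rep F n) < e / 2"
    using representsD(2)[OF r, of "e / 2"] e by auto
  have "(\<lambda>n. nrm (rep F n - rep F N)) \<longlonglongrightarrow> hnorm (F - potential (rep F N))"
    by (intro hnorm_tendsto represents_diff r represents_const representsD(1)[OF r])
  moreover have "\<exists>M. \<forall>n\<ge>M. nrm (rep F n - rep F N) \<le> e / 2" 
    using N by (meson order_refl less_imp_le)
  ultimately have "hnorm (F - potential (rep F N)) \<le> e / 2" by (rule LIMSEQ_le_const2)
  then have "hnorm (F - potential (rep F N)) < e" using e by linarith
  then show ?thesis by (rule that[OF representsD(1)[OF r]])
qed

definition rk_space :: "('x \<Rightarrow> complex) inner_space" where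
  "rk_space = \<lparr>carrier = rkhs, mult = undefined, one = undefined, ring.zero = 0, ring.add = (+),
     smult = cscale, cinner = ip\<rparr>"

lemma rk_space_simps [simp]:
  "carrier rk_space = rkhs" "ring.zero rk_space = 0" "ring.add rk_space = (+)"
  "smult rk_space = cscale" "cinner rk_space = ip"
  by (simp_all add: rk_space_def)

lemma module_rk_space: "Module.module (scalars :: complex ring) rk_space"
  by (rule module_scalarsI) (auto simp: rkhs_closed fun_eq_iff algebra_simps)

lemma minus_rk_space: "F \<in> rkhs \<Longrightarrow> G \<in> rkhs \<Longrightarrow> F \<ominus>\<^bsub>rk_space\<^esub> G = F - G"
  by (rule module_scalarsI(2)) (auto simp: rkhs_closed fun_eq_iff algebra_simps)

lemma inner_dist_rk_space:
  "F \<in> rkhs \<Longrightarrow> G \<in> rkhs \<Longrightarrow> inner_dist rk_space F G = hnorm (F - G)"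
  by (simp add: inner_dist_def minus_rk_space hnorm_def)

lemma Metric_space_rk_space: "Metric_space rkhs (inner_dist rk_space)"
proof
  fix F G E
  show "0 \<le> inner_dist rk_space F G"
    by (cases "F \<in> rkhs \<and> G \<in> rkhs")
      (auto simp: inner_dist_rk_space hnorm_nonneg rkhs_closed, auto simp: inner_dist_def)
  show "inner_dist rk_space F G = inner_dist rk_space G F"
    by (cases "F \<in> rkhs \<and> G \<in> rkhs")
      (auto simp: inner_dist_rk_space hnorm_minus_commute[of F G], auto simp: inner_dist_def)
  show "inner_dist rk_space F G = 0 \<longleftrightarrow> F = G" if "F \<in> rkhs" "G \<in> rkhs"
    using that by (simp add: inner_dist_rk_space hnorm_eq_0 rkhs_closed)
  show "inner_dist rk_space F E \<le> inner_dist rk_space F G + inner_dist rk_space G E"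
    if "F \<in> rkhs" "G \<in> rkhs" "E \<in> rkhs"
    using that by (simp add: inner_dist_rk_space hnorm_triangle_diff)
qed

text \<open>A Cauchy sequence in the completion is replaced by a sequence of finite combinations at distance
  less than \<open>1/(n+1)\<close>; this sequence is itself Cauchy, and the function represented by it is the
  limit.\<close>
lemma mcomplete_rk_space: "Metric_space.mcomplete rkhs (inner_dist rk_space)"
proof -
  interpret Metric_space rkhs "inner_dist rk_space" by (rule Metric_space_rk_space)
  show ?thesis unfolding mcomplete_def
  proof (intro allI impI)
    fix F assume "MCauchy F"
    then have F: "F n \<in> rkhs" for n by (auto simp: MCauchy_def)
    have CF: "\<exists>N. \<forall>m\<ge>N. \<forall>n\<ge>N. hnorm (F m - F n) < e" if "e > 0" for e
      using \<open>MCauchy F\<close> that F by (auto simp: MCauchy_def inner_dist_rk_space)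
    have "\<exists>c. c \<in> fin_supp \<and> hnorm (F n - potential c) < inverse (Suc n)" for n
      using potential_approx[OF F[of n], of "inverse (Suc n)"]
      by (metis inverse_positive_iff_positive of_nat_0_less_iff zero_less_Suc)
    then obtain c where c [simp]: "\<And>n. c n \<in> fin_supp"
      and Fc: "\<And>n. hnorm (F n - potential (c n)) < inverse (Suc n)" by metis
    have Fc0: "(\<lambda>n. hnorm (F n - potential (c n))) \<longlonglongrightarrow> 0"
    proof (rule tendsto_sandwich[OF _ _ tendsto_const LIMSEQ_inverse_real_of_nat])
      show "\<forall>\<^sub>F n in sequentially. 0 \<le> hnorm (F n - potential (c n))"
        using F by (simp add: hnorm_nonneg rkhs_closed)
      show "\<forall>\<^sub>F n in sequentially. hnorm (F n - potential (c n)) \<le> inverse (real (Suc n))"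
        using Fc less_imp_le by (intro always_eventually) blast
    qed
    have Cc: "\<exists>N. \<forall>m\<ge>N. \<forall>n\<ge>N. nrm (c m - c n) < e" if e: "e > 0" for e
    proof -
      obtain M where M: "\<And>n. n \<ge> M \<Longrightarrow> hnorm (F n - potential (c n)) < e / 3"
        using LIMSEQ_D[OF Fc0, of "e / 3"] e by (metis abs_less_iff diff_zero real_norm_def divide_pos_pos zero_less_numeral)
      obtain N where N: "\<And>m n. m \<ge> N \<Longrightarrow> n \<ge> N \<Longrightarrow> hnorm (F m - F n) < e / 3"
        using CF[of "e / 3"] e by auto
      have "nrm (c m - c n) < e" if "m \<ge> max M N" "n \<ge> max M N" for m n
      proof -
        let ?p = "\<lambda>n. potential (c n)"
        have "potential (c m - c n) = ?p m - ?p n"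
          by (auto simp: potential_def fun_eq_iff form_diff_left)
        then have "nrm (c m - c n) = hnorm (?p m - ?p n)"
          by (metis hnorm_potential c fin_supp_diff)
        also have "\<dots> \<le> hnorm (?p m - F m) + (hnorm (F m - F n) + hnorm (F n - ?p n))"
          using hnorm_triangle_diff[of "?p m" "F m" "?p n"] hnorm_triangle_diff[of "F m" "F n" "?p n"] F
          by simp
        also have "hnorm (?p m - F m) = hnorm (F m - ?p m)"
          by (simp add: hnorm_minus_commute F)
        finally have "nrm (c m - c n) \<le> hnorm (F m - ?p m) + (hnorm (F m - F n) + hnorm (F n - ?p n))" .
        moreover have "hnorm (F m - ?p m) < e / 3" "hnorm (F n - ?p n) < e / 3" "hnorm (F m - F n) < e / 3"
          using M[of m] M[of n] N[of m n] that by auto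
        ultimately show ?thesis by linarith
      qed
      then show ?thesis by blast
    qed
    have "Cauchy (\<lambda>n. form (c n) (unit_at y))" for y
    proof (rule CauchyI)
      fix e :: real assume e: "e > 0"
      let ?K = "nrm (unit_at y) + 1"
      have K: "?K > 0" by (simp add: add_nonneg_pos)
      obtain N where N: "\<And>m n. m \<ge> N \<Longrightarrow> n \<ge> N \<Longrightarrow> nrm (c m - c n) < e / ?K"
        using Cc[of "e / ?K"] e K by auto
      have "norm (form (c m) (unit_at y) - form (c n) (unit_at y)) < e" if "m \<ge> N" "n \<ge> N" for m n
      proof -
        have "norm (form (c m) (unit_at y) - form (c n) (unit_at y)) \<le> nrm (c m - c n) * nrm (unit_at y)"
          using norm_form_le[of "c m - c n" "unit_at y"] by (simp add: form_diff_left fin_supp_diff)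
        also have "\<dots> \<le> nrm (c m - c n) * ?K" by (intro mult_left_mono) (auto intro!: nrm_nonneg fin_supp_diff)
        also have "\<dots> < e" using N[OF that] K by (simp add: field_simps)
        finally show ?thesis .
      qed
      then show "\<exists>M. \<forall>m\<ge>M. \<forall>n\<ge>M. norm (form (c m) (unit_at y) - form (c n) (unit_at y)) < e"
        by blast
    qed
    then have "\<exists>l. (\<lambda>n. form (c n) (unit_at y)) \<longlonglongrightarrow> l" for y
      using Cauchy_convergent by (auto simp: convergent_def)
    then obtain L where L: "\<And>y. (\<lambda>n. form (c n) (unit_at y)) \<longlonglongrightarrow> L y" by metis
    have rL: "represents c L" unfolding represents_def using L Cc by auto
    then have Lr: "L \<in> rkhs" by (rule represents_in_rkhs)
    have cL0: "(\<lambda>n. hnorm (potential (c n) - L)) \<longlonglongrightarrow> 0"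
    proof (rule LIMSEQ_I)
      fix e :: real assume e: "e > 0"
      obtain N where N: "\<And>m n. m \<ge> N \<Longrightarrow> n \<ge> N \<Longrightarrow> nrm (c m - c n) < e / 2"
        using Cc[of "e / 2"] e by auto
      have "hnorm (potential (c n) - L) < e" if "n \<ge> N" for n
      proof -
        have "(\<lambda>m. nrm (c n - c m)) \<longlonglongrightarrow> hnorm (potential (c n) - L)"
          by (intro hnorm_tendsto represents_diff rL represents_const) auto
        moreover have "\<exists>M. \<forall>m\<ge>M. nrm (c n - c m) \<le> e / 2" 
          using N that by (meson less_imp_le)
        ultimately have "hnorm (potential (c n) - L) \<le> e / 2" by (rule LIMSEQ_le_const2)
        then show ?thesis using e by simp
      qed
      then show "\<exists>N. \<forall>n\<ge>N. norm (hnorm (potential (c n) - L) - 0) < e"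
        using Lr by (intro exI[of _ N]) (simp add: hnorm_nonneg rkhs_closed)
    qed
    have "limitin mtopology F L sequentially"
      unfolding limitin_metric_dist_null
    proof (intro conjI Lr)
      show "\<forall>\<^sub>F n in sequentially. F n \<in> rkhs" using F by simp
      have "(\<lambda>n. hnorm (F n - L)) \<longlonglongrightarrow> 0"
      proof (rule tendsto_sandwich[OF _ _ tendsto_const tendsto_add_zero[OF Fc0 cL0]])
        show "\<forall>\<^sub>F n in sequentially. 0 \<le> hnorm (F n - L)"
          using F Lr by (simp add: hnorm_nonneg rkhs_closed)
        show "\<forall>\<^sub>F n in sequentially. hnorm (F n - L)
            \<le> hnorm (F n - potential (c n)) + hnorm (potential (c n) - L)"
          using F Lr by (intro always_eventually allI hnorm_triangle_diff) auto
      qed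
      then show "((\<lambda>n. inner_dist rk_space (F n) L) \<longlongrightarrow> 0) sequentially"
        using F Lr by (simp add: inner_dist_rk_space)
    qed
    then show "\<exists>x. limitin mtopology F x sequentially" by (intro exI[where x = L])
  qed
qed

theorem hilbert_space_rk_space: "hilbert_space rk_space"
proof -
  have "Re (ip F F) > 0" if "F \<in> rkhs" "F \<noteq> 0" for F
    using that hnorm_eq_0[of F] hnorm_nonneg[of F] Re_ip_self[of F] by (simp add: less_le)
  then show ?thesis
    unfolding hilbert_space_def
    using module_rk_space mcomplete_rk_space
    by (intro conjI ballI allI impI) (simp_all add: ip_add_left ip_cscale_left ip_cnj[symmetric])
qed

end

section \<open>Unitary representations from positive definite functions\<close>

lemma unit_at_eq_comp: "inj t \<Longrightarrow> unit_at y = unit_at (t y) \<circ> t"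
  by (auto simp: unit_at_def fun_eq_iff inj_eq)

context kernel
begin

context
  fixes t :: "'x \<Rightarrow> 'x"
  assumes t: "bij t" and k_t: "\<And>x y. k (t x) (t y) = k x y"
begin

lemma bij_betw_supp: "bij_betw t {x. (c \<circ> t) x \<noteq> 0} {x. c x \<noteq> 0}"
  using t by (force simp: bij_betw_def bij_def inj_on_def image_iff surj_def)

lemma fin_supp_comp: "c \<in> fin_supp \<Longrightarrow> c \<circ> t \<in> fin_supp"
  using bij_betw_finite[OF bij_betw_supp[of c]] by (simp add: fin_supp_def)

lemma form_comp: "form (c \<circ> t) (d \<circ> t) = form c d"
proof -
  have "form (c \<circ> t) (d \<circ> t) = (\<Sum>x | (c \<circ> t) x \<noteq> 0. \<Sum>y | (d \<circ> t) y \<noteq> 0.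
      c (t x) * cnj (d (t y)) * of_real (k (t x) (t y)))"
    by (simp add: form_def k_t)
  also have "\<dots> = (\<Sum>x | (c \<circ> t) x \<noteq> 0. \<Sum>y | d y \<noteq> 0. c (t x) * cnj (d y) * of_real (k (t x) y))"
    by (intro sum.cong refl sum.reindex_bij_betw[OF bij_betw_supp[of d]])
  also have "\<dots> = form c d"
    unfolding form_def by (rule sum.reindex_bij_betw[OF bij_betw_supp[of c]])
  finally show ?thesis .
qed

lemma nrm_comp: "nrm (c \<circ> t) = nrm c"
  by (simp add: nrm_def form_comp)

lemma potential_comp: "potential c \<circ> t = potential (c \<circ> t)"
proof
  fix y
  have "unit_at y = unit_at (t y) \<circ> t" using t by (intro unit_at_eq_comp) (simp add: bij_def)
  then show "(potential c \<circ> t) y = potential (c \<circ> t) y"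
    by (simp add: potential_def form_comp)
qed

lemma represents_comp:
  assumes "represents c F"
  shows "represents (\<lambda>n. c n \<circ> t) (F \<circ> t)"
  unfolding represents_def
proof (intro conjI allI impI)
  show "c n \<circ> t \<in> fin_supp" for n using fin_supp_comp representsD(1)[OF assms] by blast
  have eq: "(c m \<circ> t) - (c n \<circ> t) = (c m - c n) \<circ> t" for m n by (simp add: fun_eq_iff)
  show "\<exists>N. \<forall>m\<ge>N. \<forall>n\<ge>N. nrm ((c m \<circ> t) - (c n \<circ> t)) < e" if "e > 0" for e
    unfolding eq nrm_comp using representsD(2)[OF assms that] .
  show "(\<lambda>n. form (c n \<circ> t) (unit_at y)) \<longlonglongrightarrow> (F \<circ> t) y" for y
    using representsD(3)[OF assms, of "t y"] potential_comp
    by (simp add: potential_def fun_eq_iff)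
qed

lemma rkhs_comp: "F \<in> rkhs \<Longrightarrow> F \<circ> t \<in> rkhs"
  using represents_comp unfolding rkhs_def mem_Collect_eq by blast

lemma ip_comp:
  assumes "F \<in> rkhs" "G \<in> rkhs"
  shows "ip (F \<circ> t) (G \<circ> t) = ip F G"
proof (rule LIMSEQ_unique)
  note r = assms[THEN represents_rep]
  show "(\<lambda>n. form (rep F n \<circ> t) (rep G n \<circ> t)) \<longlonglongrightarrow> ip (F \<circ> t) (G \<circ> t)"
    by (intro ip_tendsto represents_comp r)
  show "(\<lambda>n. form (rep F n \<circ> t) (rep G n \<circ> t)) \<longlonglongrightarrow> ip F G"
    unfolding form_comp by (intro ip_tendsto r)
qed

lemma hnorm_comp: "F \<in> rkhs \<Longrightarrow> hnorm (F \<circ> t) = hnorm F"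
  by (simp add: hnorm_def ip_comp)

end

text \<open>A bijection that preserves the kernel permutes the kernel functions and preserves their inner
  products; the induced operator is composition with the bijection.\<close>
lemma composition_unitary:
  assumes t: "bij t" and k_t: "\<And>x y. k (t x) (t y) = k x y"
  shows "(\<lambda>F\<in>rkhs. F \<circ> t) \<in> carrier (unitary_group rk_space)"
proof -
  have s: "bij (inv_into UNIV t)" "k (inv_into UNIV t x) (inv_into UNIV t y) = k x y" for x y
    using t k_t[of "inv_into UNIV t x" "inv_into UNIV t y"] by (auto simp: bij_imp_bij_inv bij_is_surj surj_f_inv_f)
  have ts: "F \<circ> inv_into UNIV t \<circ> t = F" "F \<circ> t \<circ> inv_into UNIV t = F" for F :: "'x \<Rightarrow> complex"
    using t by (auto simp: fun_eq_iff bij_is_inj bij_is_surj surj_f_inv_f)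
  have "bij_betw (\<lambda>F\<in>rkhs. F \<circ> t) rkhs rkhs"
    by (rule bij_betw_byWitness[where f' = "\<lambda>F. F \<circ> inv_into UNIV t"])
      (auto simp: ts intro: rkhs_comp[OF t k_t] rkhs_comp[OF s])
  then have "(\<lambda>F\<in>rkhs. F \<circ> t) \<in> Bij rkhs" by (simp add: Bij_def)
  moreover have "linear_between rk_space rk_space (\<lambda>F\<in>rkhs. F \<circ> t)"
    unfolding linear_between_def
    using rkhs_comp[OF t k_t] by (auto simp: rkhs_closed fun_eq_iff)
  ultimately show ?thesis
    using ip_comp[OF t k_t] by (simp add: unitary_group_def)
qed

lemma topspace_SOT: "topspace (strong_operator_topology rk_space) = carrier (unitary_group rk_space)"
proof -
  interpret Metric_space rkhs "inner_dist rk_space" by (rule Metric_space_rk_space)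
  have "carrier (unitary_group rk_space) \<subseteq> rkhs \<rightarrow>\<^sub>E rkhs"
  proof
    fix u assume "u \<in> carrier (unitary_group rk_space)"
    then have "u \<in> Bij rkhs" by (simp add: unitary_group_def)
    then show "u \<in> rkhs \<rightarrow>\<^sub>E rkhs"
      by (simp add: PiE_def Bij_imp_funcset Bij_imp_extensional)
  qed
  then show ?thesis
    by (auto simp: strong_operator_topology_def)
qed

end

text \<open>Openness onto the image, tested at one point at a time.\<close>
lemma embedding_map_pointwiseI:
  assumes cont: "continuous_map S T h" and inj: "inj_on h (topspace S)"
    and nbhd: "\<And>U a. openin S U \<Longrightarrow> a \<in> U \<Longrightarrow>
      \<exists>W. openin T W \<and> h a \<in> W \<and> (\<forall>b\<in>topspace S. h b \<in> W \<longrightarrow> b \<in> U)"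
  shows "embedding_map S T h"
  unfolding embedding_map_def
proof (rule bijective_open_imp_homeomorphic_map)
  show "continuous_map S (subtopology T (h ` topspace S)) h"
    using cont by (simp add: continuous_map_in_subtopology)
  show "h ` topspace S = topspace (subtopology T (h ` topspace S))"
    using continuous_map_image_subset_topspace[OF cont] by auto
  show "open_map S (subtopology T (h ` topspace S)) h"
    unfolding open_map_def
  proof (intro allI impI)
    fix U assume U: "openin S U"
    show "openin (subtopology T (h ` topspace S)) (h ` U)"
    proof (subst openin_subopen, intro ballI)
      fix y assume "y \<in> h ` U"
      then obtain a where a: "a \<in> U" "y = h a" by blast
      obtain W where W: "openin T W" "h a \<in> W" "\<forall>b\<in>topspace S. h b \<in> W \<longrightarrow> b \<in> U"
        using nbhd[OF U a(1)] by blast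
      show "\<exists>V. openin (subtopology T (h ` topspace S)) V \<and> y \<in> V \<and> V \<subseteq> h ` U"
        using W a openin_subset[OF U]
        by (intro exI[of _ "W \<inter> h ` topspace S"]) (auto simp: openin_subtopology)
    qed
  qed
qed (rule inj)

definition pd_function :: "('g, 'm) monoid_scheme \<Rightarrow> ('g \<Rightarrow> real) \<Rightarrow> bool" where
  "pd_function G p \<longleftrightarrow> p \<one>\<^bsub>G\<^esub> = 1 \<and> (\<forall>x\<in>carrier G. p (inv\<^bsub>G\<^esub> x) = p x) \<and>
     (\<forall>S c. finite S \<longrightarrow> S \<subseteq> carrier G \<longrightarrow>
        0 \<le> (\<Sum>x\<in>S. \<Sum>y\<in>S. c x * c y * p (x \<otimes>\<^bsub>G\<^esub> inv\<^bsub>G\<^esub> y)))"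

text \<open>A positive definite function is continuous once it is continuous at the unit.  Phrasing the
  condition at each point \<open>a\<close> avoids assuming that translations are continuous.\<close>
definition continuous_at_shifts :: "('g, 'm) monoid_scheme \<Rightarrow> 'g topology \<Rightarrow> ('g \<Rightarrow> real) \<Rightarrow> bool" where
  "continuous_at_shifts G T p \<longleftrightarrow> (\<forall>a\<in>carrier G. \<forall>e>0. \<exists>V. openin T V \<and> a \<in> V \<and>
      (\<forall>h\<in>V. p (h \<otimes>\<^bsub>G\<^esub> inv\<^bsub>G\<^esub> a) > 1 - e))"

definition pd_separated :: "('g, 'm) monoid_scheme \<Rightarrow> 'g topology \<Rightarrow> bool" where
  "pd_separated G T \<longleftrightarrow> (\<forall>W g. openin T W \<and> g \<in> W \<longrightarrow>
     (\<exists>p. pd_function G p \<and> continuous_at_shifts G T p \<and>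
       (\<exists>e>0. \<forall>h\<in>carrier G. p (h \<otimes>\<^bsub>G\<^esub> inv\<^bsub>G\<^esub> g) > 1 - e \<longrightarrow> h \<in> W)))"

lemma pd_separatedE:
  assumes "pd_separated G T" "openin T W" "g \<in> W"
  obtains p e where "pd_function G p" "continuous_at_shifts G T p" "e > 0"
    "\<And>h. h \<in> carrier G \<Longrightarrow> p (h \<otimes>\<^bsub>G\<^esub> inv\<^bsub>G\<^esub> g) > 1 - e \<Longrightarrow> h \<in> W"
proof -
  have "\<exists>p. pd_function G p \<and> continuous_at_shifts G T p \<and>
       (\<exists>e>0. \<forall>h\<in>carrier G. p (h \<otimes>\<^bsub>G\<^esub> inv\<^bsub>G\<^esub> g) > 1 - e \<longrightarrow> h \<in> W)"
    by (rule assms(1)[unfolded pd_separated_def, rule_format]) (intro conjI assms)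
  then show ?thesis using that by (elim exE conjE) auto
qed

lemma pd_function_sum:
  assumes "pd_function G p" "finite S" "S \<subseteq> carrier G"
  shows "0 \<le> (\<Sum>x\<in>S. \<Sum>y\<in>S. c x * c y * p (x \<otimes>\<^bsub>G\<^esub> inv\<^bsub>G\<^esub> y))"
  using assms(1)[unfolded pd_function_def, THEN conjunct2, THEN conjunct2, rule_format, OF assms(2,3)] .

text \<open>The index set of the family consists of the subsets of the group, because the underlying type of
  the Hilbert space in \<^const>\<open>unitarily_representable\<close> offers exactly these indices.\<close>
locale pd_family = comm_group G for G (structure) +
  fixes T :: "'a topology" and P :: "'a set \<Rightarrow> 'a \<Rightarrow> real"
  assumes topspace_T: "topspace T = carrier G"
    and Hausdorff_T: "Hausdorff_space T"
    and pd: "pd_function G (P U)"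
    and shifts: "continuous_at_shifts G T (P U)"
    and separates: "openin T W \<Longrightarrow> g \<in> W \<Longrightarrow>
      \<exists>U. \<exists>e>0. \<forall>h\<in>carrier G. P U (h \<otimes> inv g) > 1 - e \<longrightarrow> h \<in> W"
begin

text \<open>The orthogonal sum of the kernels of all members of the family, extended by zero.\<close>
definition k :: "'a set \<times> 'a \<Rightarrow> 'a set \<times> 'a \<Rightarrow> real" where
  "k a b = (if fst a = fst b \<and> snd a \<in> carrier G \<and> snd b \<in> carrier G
     then P (fst a) (snd a \<otimes> inv (snd b)) else 0)"

lemma k_sym: "k a b = k b a"
proof -
  have "P U (x \<otimes> inv y) = P U (y \<otimes> inv x)" if "x \<in> carrier G" "y \<in> carrier G" for U x y
  proof -
    have "y \<otimes> inv x = inv (x \<otimes> inv y)" using that by (simp add: inv_mult_group)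
    then show ?thesis using pd[of U] that by (simp add: pd_function_def)
  qed
  then show ?thesis by (auto simp: k_def)
qed

text \<open>Kernels with different indices are orthogonal, so the quadratic form splits into one form for
  each index, and these are nonnegative by positive definiteness.\<close>
lemma psd_k: "psd_kernel k"
  unfolding psd_kernel_def
proof (intro conjI allI impI)
  show "k a b = k b a" for a b by (rule k_sym)
  fix S :: "('a set \<times> 'a) set" and c assume S: "finite S"
  define X where "X U = {x \<in> carrier G. (U, x) \<in> S}" for U
  have fX: "finite (X U)" for U
    by (rule finite_subset[OF _ finite_imageI[OF S, of snd]]) (force simp: X_def)
  have inner: "(\<Sum>b\<in>S. c a * c b * k a b) =
      (if snd a \<in> carrier G then \<Sum>y\<in>X (fst a). c a * c (fst a, y) * P (fst a) (snd a \<otimes> inv y) else 0)" for a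
  proof (cases "snd a \<in> carrier G")
    case True
    have "(\<Sum>b\<in>S. c a * c b * k a b) = (\<Sum>b\<in>Pair (fst a) ` X (fst a). c a * c b * k a b)"
      by (rule sum.mono_neutral_right) (auto simp: S X_def k_def image_iff)
    also have "\<dots> = (\<Sum>y\<in>X (fst a). c a * c (fst a, y) * k a (fst a, y))"
      by (subst sum.reindex) (auto simp: inj_on_def)
    also have "\<dots> = (\<Sum>y\<in>X (fst a). c a * c (fst a, y) * P (fst a) (snd a \<otimes> inv y))"
      using True by (intro sum.cong) (auto simp: k_def X_def)
    finally show ?thesis using True by simp
  qed (simp add: k_def)
  have "(\<Sum>a\<in>S. \<Sum>b\<in>S. c a * c b * k a b)
      = (\<Sum>U\<in>fst ` S. \<Sum>a\<in>{a\<in>S. fst a = U}. \<Sum>b\<in>S. c a * c b * k a b)"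
    by (rule sum.group[symmetric]) (auto simp: S)
  also have "\<dots> = (\<Sum>U\<in>fst ` S. \<Sum>x\<in>X U. \<Sum>y\<in>X U. c (U, x) * c (U, y) * P U (x \<otimes> inv y))"
  proof (rule sum.cong[OF refl])
    fix U
    let ?f = "\<lambda>a. if snd a \<in> carrier G then \<Sum>y\<in>X (fst a). c a * c (fst a, y) * P (fst a) (snd a \<otimes> inv y) else 0"
    have "(\<Sum>a\<in>{a\<in>S. fst a = U}. \<Sum>b\<in>S. c a * c b * k a b) = (\<Sum>a\<in>{a\<in>S. fst a = U}. ?f a)"
      by (simp only: inner)
    also have "\<dots> = (\<Sum>a\<in>Pair U ` X U. ?f a)"
      by (rule sum.mono_neutral_right) (auto simp: S X_def image_iff)
    also have "\<dots> = (\<Sum>x\<in>X U. ?f (U, x))"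
      by (subst sum.reindex) (auto simp: inj_on_def)
    also have "\<dots> = (\<Sum>x\<in>X U. \<Sum>y\<in>X U. c (U, x) * c (U, y) * P U (x \<otimes> inv y))"
      by (intro sum.cong) (auto simp: X_def)
    finally show "(\<Sum>a\<in>{a\<in>S. fst a = U}. \<Sum>b\<in>S. c a * c b * k a b) = \<dots>" .
  qed
  also have "\<dots> \<ge> 0"
  proof (rule sum_nonneg)
    fix U
    have "X U \<subseteq> carrier G" by (auto simp: X_def)
    then show "0 \<le> (\<Sum>x\<in>X U. \<Sum>y\<in>X U. c (U, x) * c (U, y) * P U (x \<otimes> inv y))"
      by (rule pd_function_sum[OF pd fX])
  qed
  finally show "0 \<le> (\<Sum>a\<in>S. \<Sum>b\<in>S. c a * c b * k a b)" .
qed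

sublocale K: kernel k
  by (rule kernel.intro[OF psd_k])

text \<open>Points outside the group are left alone in order to have a bijection of the whole type; the
  functions in the Hilbert space vanish there.\<close>
definition shift :: "'a \<Rightarrow> 'a set \<times> 'a \<Rightarrow> 'a set \<times> 'a" where
  "shift g a = (fst a, if snd a \<in> carrier G then snd a \<otimes> g else snd a)"

lemma shift_shift:
  "g \<in> carrier G \<Longrightarrow> h \<in> carrier G \<Longrightarrow> shift h (shift g a) = shift (g \<otimes> h) a"
  by (auto simp: shift_def m_assoc)

lemma bij_shift: "g \<in> carrier G \<Longrightarrow> bij (shift g)"
  by (rule o_bij[of "shift (inv g)"]) (auto simp: fun_eq_iff shift_shift, auto simp: shift_def)

lemma k_shift: "g \<in> carrier G \<Longrightarrow> k (shift g a) (shift g b) = k a b"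
proof -
  assume g: "g \<in> carrier G"
  have "x \<otimes> g \<otimes> inv (y \<otimes> g) = x \<otimes> inv y" if "x \<in> carrier G" "y \<in> carrier G" for x y
    using that g by (simp add: inv_mult_group m_assoc) (simp flip: m_assoc)
  with g show ?thesis by (auto simp: k_def shift_def)
qed

definition rho :: "'a \<Rightarrow> ('a set \<times> 'a \<Rightarrow> complex) \<Rightarrow> 'a set \<times> 'a \<Rightarrow> complex" where
  "rho g = (\<lambda>F\<in>K.rkhs. (F \<circ> shift g))"

lemma rho_unitary: "g \<in> carrier G \<Longrightarrow> rho g \<in> carrier (unitary_group K.rk_space)"
  unfolding rho_def by (intro K.composition_unitary bij_shift k_shift)

lemma comp_shift_rkhs: "g \<in> carrier G \<Longrightarrow> F \<in> K.rkhs \<Longrightarrow> (F \<circ> shift g) \<in> K.rkhs"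
  by (rule K.rkhs_comp[OF bij_shift k_shift])

lemma rho_hom: "rho \<in> hom G (unitary_group K.rk_space)"
proof (rule homI)
  fix g h assume gh: "g \<in> carrier G" "h \<in> carrier G"
  have "rho (g \<otimes> h) = compose K.rkhs (rho g) (rho h)"
  proof
    fix F
    show "rho (g \<otimes> h) F = compose K.rkhs (rho g) (rho h) F"
      using gh comp_shift_rkhs by (auto simp: rho_def compose_def fun_eq_iff shift_shift)
  qed
  then show "rho (g \<otimes> h) = rho g \<otimes>\<^bsub>unitary_group K.rk_space\<^esub> rho h"
    using rho_unitary[OF gh(1)] rho_unitary[OF gh(2)]
    by (simp add: unitary_group_def BijGroup_def)
qed (rule rho_unitary)

abbreviation "dirac U x \<equiv> K.potential (unit_at (U, x))"

lemma hnorm_dirac_diff: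
  assumes "x \<in> carrier G" "y \<in> carrier G"
  shows "(K.hnorm (dirac U x - dirac U y))\<^sup>2 = 2 - 2 * P U (x \<otimes> inv y)"
proof -
  have eq: "dirac U x - dirac U y = K.potential (unit_at (U, x) - unit_at (U, y))"
    by (simp add: K.potential_def fun_eq_iff K.form_diff_left)
  have "(K.hnorm (dirac U x - dirac U y))\<^sup>2 = k (U, x) (U, x) + k (U, y) (U, y) - 2 * k (U, x) (U, y)"
    unfolding eq
    by (simp add: K.hnorm_potential K.nrm_sq fin_supp_diff K.form_diff_left K.form_diff_right
        K.form_unit_at k_sym[of "(U, y)" "(U, x)"])
  also have "\<dots> = 2 - 2 * P U (x \<otimes> inv y)"
    using assms pd[of U] by (simp add: k_def pd_function_def)
  finally show ?thesis .
qed

lemma dirac_shift: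
  assumes "x \<in> carrier G" "g \<in> carrier G"
  shows "(dirac U x \<circ> shift g) = dirac U (x \<otimes> inv g)"
proof -
  have "shift g (U, x \<otimes> inv g) = (U, x)"
    using assms by (simp add: shift_def m_assoc)
  then have "unit_at (U, x \<otimes> inv g) = unit_at (U, x) \<circ> shift g"
    using unit_at_eq_comp[OF bij_is_inj[OF bij_shift[OF assms(2)]], of "(U, x \<otimes> inv g)"] by simp
  then show ?thesis
    using K.potential_comp[OF bij_shift k_shift, OF assms(2) assms(2)] by simp
qed

text \<open>The displacement of a kernel function under translation is governed by the value of the positive
  definite function alone.  Continuity of the representation and openness onto its image are both
  read off from this identity.\<close>
lemma hnorm_dirac_orbit:
  assumes "x \<in> carrier G" "g \<in> carrier G" "h \<in> carrier G"
  shows "(K.hnorm ((dirac U x \<circ> shift h) - (dirac U x \<circ> shift g)))\<^sup>2 = 2 - 2 * P U (h \<otimes> inv g)"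
proof -
  have "x \<otimes> inv h \<otimes> inv (x \<otimes> inv g) = inv (h \<otimes> inv g)"
  proof -
    have "x \<otimes> inv h \<otimes> inv (x \<otimes> inv g) = (x \<otimes> inv x) \<otimes> (g \<otimes> inv h)"
      using assms by (simp only: inv_mult_group inv_inv inv_closed m_ac m_closed)
    then show ?thesis using assms by (simp add: inv_mult_group m_comm)
  qed
  then have "P U (x \<otimes> inv h \<otimes> inv (x \<otimes> inv g)) = P U (h \<otimes> inv g)"
    using assms pd[of U] by (simp add: pd_function_def)
  then show ?thesis
    using assms by (simp add: dirac_shift hnorm_dirac_diff)
qed

definition orbit_continuous :: "('a set \<times> 'a \<Rightarrow> complex) \<Rightarrow> bool" where
  "orbit_continuous F \<longleftrightarrow> (\<forall>g\<in>carrier G. \<forall>e>0. \<exists>V. openin T V \<and> g \<in> V \<and>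
     (\<forall>h\<in>V. K.hnorm ((F \<circ> shift h) - (F \<circ> shift g)) < e))"

lemma orbit_continuousD:
  assumes "orbit_continuous F" "g \<in> carrier G" "e > 0"
  obtains V where "openin T V" "g \<in> V" "\<And>h. h \<in> V \<Longrightarrow> h \<in> carrier G"
    "\<And>h. h \<in> V \<Longrightarrow> K.hnorm ((F \<circ> shift h) - (F \<circ> shift g)) < e"
proof -
  obtain V where "openin T V" "g \<in> V" "\<forall>h\<in>V. K.hnorm ((F \<circ> shift h) - (F \<circ> shift g)) < e"
    using assms unfolding orbit_continuous_def by blast
  then show ?thesis using that[of V] openin_subset[of T V] topspace_T by blast
qed

lemma orbit_continuous_dirac: "orbit_continuous (dirac U x)"
  unfolding orbit_continuous_def
proof (intro ballI allI impI)
  fix g and e :: real assume g: "g \<in> carrier G" and e: "e > 0"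
  show "\<exists>V. openin T V \<and> g \<in> V \<and> (\<forall>h\<in>V. K.hnorm ((dirac U x \<circ> shift h) - (dirac U x \<circ> shift g)) < e)"
  proof (cases "x \<in> carrier G")
    case True
    have "e\<^sup>2 / 2 > 0" using e by simp
    then obtain V where V: "openin T V" "g \<in> V" "\<forall>h\<in>V. P U (h \<otimes> inv g) > 1 - e\<^sup>2 / 2"
      using shifts[of U] g unfolding continuous_at_shifts_def by blast
    have "K.hnorm ((dirac U x \<circ> shift h) - (dirac U x \<circ> shift g)) < e" if "h \<in> V" for h
    proof (rule power2_less_imp_less)
      have h: "h \<in> carrier G" using that openin_subset[OF V(1)] topspace_T by blast
      have "P U (h \<otimes> inv g) > 1 - e\<^sup>2 / 2" using V(3) that by blast
      then show "(K.hnorm ((dirac U x \<circ> shift h) - (dirac U x \<circ> shift g)))\<^sup>2 < e\<^sup>2"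
        unfolding hnorm_dirac_orbit[OF True g h] by (simp add: field_simps)
    qed (use e in auto)
    with V show ?thesis by blast
  next
    case False
    then have z: "dirac U x = 0"
      using K.hnorm_potential[of "unit_at (U, x)"]
      by (simp add: K.hnorm_eq_0[symmetric] K.nrm_def K.form_unit_at k_def)
    have "K.hnorm ((dirac U x \<circ> shift h) - (dirac U x \<circ> shift g)) < e" for h
    proof -
      have "(dirac U x \<circ> shift h) - (dirac U x \<circ> shift g) = 0" unfolding z by (simp add: fun_eq_iff)
      then show ?thesis using e K.hnorm_eq_0[OF K.rkhs_closed(4)] by simp
    qed
    then show ?thesis using g topspace_T openin_topspace by metis
  qed
qed

lemma orbit_continuous_combination:
  assumes "orbit_continuous F" "orbit_continuous F'" and FF: "F \<in> K.rkhs" "F' \<in> K.rkhs"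
  shows "orbit_continuous (cscale a F + F')"
  unfolding orbit_continuous_def
proof (intro ballI allI impI)
  fix g and e :: real assume g: "g \<in> carrier G" and e: "e > 0"
  have pos: "e / (2 * (norm a + 1)) > 0" "e / 2 > 0" using e by (auto simp: add_nonneg_pos)
  obtain V where V: "openin T V" "g \<in> V" "\<And>h. h \<in> V \<Longrightarrow> h \<in> carrier G"
    "\<And>h. h \<in> V \<Longrightarrow> K.hnorm ((F \<circ> shift h) - (F \<circ> shift g)) < e / (2 * (norm a + 1))"
    using orbit_continuousD[OF assms(1) g pos(1)] by blast
  obtain V' where V': "openin T V'" "g \<in> V'" "\<And>h. h \<in> V' \<Longrightarrow> h \<in> carrier G"
    "\<And>h. h \<in> V' \<Longrightarrow> K.hnorm ((F' \<circ> shift h) - (F' \<circ> shift g)) < e / 2"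
    using orbit_continuousD[OF assms(2) g pos(2)] by blast
  have "K.hnorm (((cscale a F + F') \<circ> shift h) - ((cscale a F + F') \<circ> shift g)) < e" if h: "h \<in> V" "h \<in> V'" for h
  proof -
    let ?D = "(F \<circ> shift h) - (F \<circ> shift g)" and ?D' = "(F' \<circ> shift h) - (F' \<circ> shift g)"
    have D: "?D \<in> K.rkhs" "?D' \<in> K.rkhs"
      using FF g V(3)[OF h(1)] by (auto intro!: K.rkhs_closed comp_shift_rkhs)
    have eq: "((cscale a F + F') \<circ> shift h) - ((cscale a F + F') \<circ> shift g) = cscale a ?D + ?D'"
      by (simp add: fun_eq_iff algebra_simps)
    have "K.hnorm (cscale a ?D + ?D') \<le> norm a * K.hnorm ?D + K.hnorm ?D'"
      using K.hnorm_triangle[OF K.rkhs_closed(3)[OF D(1)] D(2)] K.hnorm_cscale[OF D(1)] by metis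
    also have "norm a * K.hnorm ?D \<le> norm a * (e / (2 * (norm a + 1)))"
      using V(4)[OF h(1)] by (intro mult_left_mono) auto
    also have "\<dots> \<le> e / 2"
    proof -
      have "norm a * e \<le> (norm a + 1) * e" using e by (intro mult_right_mono) auto
      moreover have "norm a + 1 > 0" by (simp add: add_nonneg_pos)
      ultimately show ?thesis by (simp add: divide_le_eq algebra_simps)
    qed
    finally show ?thesis unfolding eq using V'(4)[OF h(2)] by linarith
  qed
  then show "\<exists>V. openin T V \<and> g \<in> V \<and>
      (\<forall>h\<in>V. K.hnorm (((cscale a F + F') \<circ> shift h) - ((cscale a F + F') \<circ> shift g)) < e)"
    using V V' by (intro exI[of _ "V \<inter> V'"]) (auto intro: openin_Int)
qed

lemma orbit_continuous_potential: "c \<in> fin_supp \<Longrightarrow> orbit_continuous (K.potential c)"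
proof (induction rule: fin_supp_induct)
  case zero
  have z: "K.potential 0 = cscale 0 (dirac {} \<one>) + cscale 0 (dirac {} \<one>)"
    by (simp add: K.potential_def fun_eq_iff)
  have "cscale 0 (dirac {} \<one>) = cscale (-1) (dirac {} \<one>) + dirac {} \<one>" by (simp add: fun_eq_iff)
  then have "orbit_continuous (cscale 0 (dirac {} \<one>))"
    using orbit_continuous_combination[OF orbit_continuous_dirac orbit_continuous_dirac, of "{}" \<one> "{}" \<one> "-1"]
    by simp
  then show ?case unfolding z
    by (intro orbit_continuous_combination orbit_continuous_dirac K.rkhs_closed) auto
next
  case (add a y c)
  have eq: "K.potential (cscale a (unit_at y) + c) = cscale a (dirac (fst y) (snd y)) + K.potential c"
    using add.hyps
    by (simp add: K.potential_def fun_eq_iff K.form_add_left K.form_cscale_left fin_supp_cscale)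
  show ?case unfolding eq
    by (rule orbit_continuous_combination[OF orbit_continuous_dirac add.IH]) (use add.hyps in auto)
qed

text \<open>Orbit maps of kernel functions are continuous, this property passes to finite combinations, and
  it passes to limits because translations are isometric.\<close>
lemma orbit_continuous:
  assumes F: "F \<in> K.rkhs"
  shows "orbit_continuous F"
  unfolding orbit_continuous_def
proof (intro ballI allI impI)
  fix g and e :: real assume g: "g \<in> carrier G" and e: "e > 0"
  have e3: "e / 3 > 0" using e by simp
  obtain c where c: "c \<in> fin_supp" "K.hnorm (F - K.potential c) < e / 3"
    using K.potential_approx[OF F e3] by blast
  let ?p = "K.potential c"
  have p: "?p \<in> K.rkhs" using c by simp
  obtain V where V: "openin T V" "g \<in> V" "\<And>h. h \<in> V \<Longrightarrow> h \<in> carrier G"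
    "\<And>h. h \<in> V \<Longrightarrow> K.hnorm ((?p \<circ> shift h) - (?p \<circ> shift g)) < e / 3"
    using orbit_continuousD[OF orbit_continuous_potential[OF c(1)] g e3] by blast
  have near: "K.hnorm ((F \<circ> shift h) - (?p \<circ> shift h)) < e / 3" if h: "h \<in> carrier G" for h
  proof -
    have "(F \<circ> shift h) - (?p \<circ> shift h) = ((F - ?p) \<circ> shift h)" by (simp add: fun_eq_iff)
    then show ?thesis
      using K.hnorm_comp[OF bij_shift[OF h] k_shift[OF h] K.rkhs_closed(2)[OF F p]] c(2) by metis
  qed
  have "K.hnorm ((F \<circ> shift h) - (F \<circ> shift g)) < e" if h: "h \<in> V" for h
  proof -
    note hG = V(3)[OF h]
    note R = comp_shift_rkhs[OF hG F] comp_shift_rkhs[OF g F] comp_shift_rkhs[OF hG p] comp_shift_rkhs[OF g p]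
    have "K.hnorm ((F \<circ> shift h) - (F \<circ> shift g))
      \<le> K.hnorm ((F \<circ> shift h) - (?p \<circ> shift h)) + K.hnorm ((?p \<circ> shift h) - (F \<circ> shift g))"
      by (rule K.hnorm_triangle_diff) (fact R)+
    moreover have "K.hnorm ((?p \<circ> shift h) - (F \<circ> shift g))
      \<le> K.hnorm ((?p \<circ> shift h) - (?p \<circ> shift g)) + K.hnorm ((?p \<circ> shift g) - (F \<circ> shift g))"
      by (rule K.hnorm_triangle_diff) (fact R)+
    moreover have "K.hnorm ((?p \<circ> shift g) - (F \<circ> shift g)) = K.hnorm ((F \<circ> shift g) - (?p \<circ> shift g))"
      by (rule K.hnorm_minus_commute) (fact R)+
    ultimately show ?thesis using near[OF hG] near[OF g] V(4)[OF h] by linarith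
  qed
  with V show "\<exists>V. openin T V \<and> g \<in> V \<and> (\<forall>h\<in>V. K.hnorm ((F \<circ> shift h) - (F \<circ> shift g)) < e)"
    by blast
qed

lemma rho_embedding: "embedding_map T (strong_operator_topology K.rk_space) rho"
proof -
  interpret M: Metric_space K.rkhs "inner_dist K.rk_space" by (rule K.Metric_space_rk_space)
  have ext: "rho g \<in> extensional K.rkhs" for g by (simp add: rho_def)
  have cont: "continuous_map T M.mtopology (\<lambda>g. rho g F)" if F: "F \<in> K.rkhs" for F
    unfolding M.continuous_map_to_metric
  proof (intro ballI allI impI)
    fix g and e :: real assume "g \<in> topspace T" and e: "e > 0"
    then have g: "g \<in> carrier G" using topspace_T by simp
    obtain V where V: "openin T V" "g \<in> V" "\<And>h. h \<in> V \<Longrightarrow> h \<in> carrier G"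
      "\<And>h. h \<in> V \<Longrightarrow> K.hnorm ((F \<circ> shift h) - (F \<circ> shift g)) < e"
      using orbit_continuousD[OF orbit_continuous[OF F] g e] by blast
    have "rho h F \<in> M.mball (rho g F) e" if "h \<in> V" for h
      using V(3,4)[OF that] F g comp_shift_rkhs
      by (simp add: rho_def K.inner_dist_rk_space K.hnorm_minus_commute[of "(F \<circ> shift g)"])
    with V show "\<exists>U. openin T U \<and> g \<in> U \<and> (\<forall>y\<in>U. rho y F \<in> M.mball (rho g F) e)" by blast
  qed
  have nbhd: "\<exists>W. openin (strong_operator_topology K.rk_space) W \<and> rho g \<in> W \<and>
      (\<forall>h\<in>topspace T. rho h \<in> W \<longrightarrow> h \<in> U)" if U: "openin T U" "g \<in> U" for U g
  proof -
    have g: "g \<in> carrier G" using U openin_subset topspace_T by blast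
    obtain V e where e: "e > 0" and V: "\<And>h. h \<in> carrier G \<Longrightarrow> P V (h \<otimes> inv g) > 1 - e \<Longrightarrow> h \<in> U"
      using separates[OF U] by blast
    define F where "F = dirac V \<one>"
    have F: "F \<in> K.rkhs" by (simp add: F_def)
    define B where "B = M.mball (rho g F) (sqrt (2 * e))"
    define W where "W = {u \<in> carrier (unitary_group K.rk_space). u F \<in> B}"
    have "W = carrier (unitary_group K.rk_space) \<inter>
        {u \<in> topspace (product_topology (\<lambda>_. M.mtopology) K.rkhs). u F \<in> B}"
      using K.topspace_SOT by (auto simp: W_def strong_operator_topology_def)
    moreover have "openin (product_topology (\<lambda>_. M.mtopology) K.rkhs)
        {u \<in> topspace (product_topology (\<lambda>_. M.mtopology) K.rkhs). u F \<in> B}"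
      by (rule openin_continuous_map_preimage[OF continuous_map_product_projection[OF F]])
        (simp add: B_def)
    ultimately have "openin (strong_operator_topology K.rk_space) W"
      by (auto simp: strong_operator_topology_def openin_subtopology_Int2)
    moreover have "rho g \<in> W"
      using rho_unitary[OF g] e F g comp_shift_rkhs by (simp add: W_def B_def rho_def)
    moreover have "h \<in> U" if "h \<in> topspace T" "rho h \<in> W" for h
    proof (rule V)
      show h: "h \<in> carrier G" using that topspace_T by simp
      have "K.hnorm ((F \<circ> shift g) - (F \<circ> shift h)) < sqrt (2 * e)"
        using that F g h comp_shift_rkhs by (simp add: W_def B_def rho_def K.inner_dist_rk_space)
      then have "(K.hnorm ((F \<circ> shift h) - (F \<circ> shift g)))\<^sup>2 < (sqrt (2 * e))\<^sup>2"
        using F g h comp_shift_rkhs K.hnorm_minus_commute[of "(F \<circ> shift g)" "(F \<circ> shift h)"]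
        by (intro power_strict_mono) (auto intro!: K.hnorm_nonneg K.rkhs_closed)
      then show "P V (h \<otimes> inv g) > 1 - e"
        unfolding F_def hnorm_dirac_orbit[OF one_closed g h] using e by simp
    qed
    ultimately show ?thesis by blast
  qed
  show ?thesis
  proof (rule embedding_map_pointwiseI)
    show "continuous_map T (strong_operator_topology K.rk_space) rho"
      unfolding strong_operator_topology_def continuous_map_in_subtopology
      using cont rho_unitary topspace_T ext by (auto simp: continuous_map_componentwise)
    show "inj_on rho (topspace T)"
    proof (rule inj_onI, rule ccontr)
      fix g h assume gh: "g \<in> topspace T" "h \<in> topspace T" "rho g = rho h" "g \<noteq> h"
      then obtain U where "openin T U" "g \<in> U" "h \<notin> U"
        using Hausdorff_T unfolding Hausdorff_space_def disjnt_iff by meson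
      with nbhd[of U g] gh show False by metis
    qed
  qed (rule nbhd)
qed

theorem unitarily_representable: "unitarily_representable G T"
  unfolding unitarily_representable_def topological_group_embedding_def
  using K.hilbert_space_rk_space topspace_T K.topspace_SOT rho_hom rho_embedding by blast

end

lemma pd_function_one: "comm_group G \<Longrightarrow> pd_function G (\<lambda>_. 1)"
proof -
  have "(\<Sum>x\<in>S. \<Sum>y\<in>S. c x * c y) = (\<Sum>x\<in>S. c x)\<^sup>2" for S and c :: "'a \<Rightarrow> real"
    by (simp add: sum_product power2_eq_square)
  then show ?thesis by (simp add: pd_function_def)
qed

text \<open>It remains to index enough positive definite functions by subsets of the group: a set \<open>U\<close> selects
  some function whose values near 1 are confined to \<open>U\<close>, or the constant 1 if there is none.  A
  function \<open>p\<close> needed for the topology is found, or replaced by an equally good one, at the index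
  \<open>{x. p x > 1 - e}\<close>.\<close>
theorem pd_separated_imp_unitarily_representable:
  assumes G: "comm_group G" and T: "topspace T = carrier G" "Hausdorff_space T"
    and sep: "pd_separated G T"
  shows "unitarily_representable G T"
proof -
  interpret comm_group G by (rule G)
  define good where "good U p \<longleftrightarrow> pd_function G p \<and> continuous_at_shifts G T p \<and>
    (\<exists>e>0. \<forall>x\<in>carrier G. p x > 1 - e \<longrightarrow> x \<in> U)" for U p
  define P where "P U = (if Ex (good U) then SOME p. good U p else (\<lambda>_. 1))" for U
  have P: "good U (P U)" if "good U p" for U p
    using that unfolding P_def by (metis someI_ex)
  have "continuous_at_shifts G T (\<lambda>_. 1)"
    unfolding continuous_at_shifts_def unfolding T(1)[symmetric]
    by (intro ballI allI impI exI[of _ "topspace T"]) simp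
  then have PU: "pd_function G (P U) \<and> continuous_at_shifts G T (P U)" for U
  proof (cases "Ex (good U)")
    case True
    then have "good U (P U)" using P by blast
    then show ?thesis by (simp add: good_def)
  next
    case False
    then have "P U = (\<lambda>_. 1)" unfolding P_def by (rule if_not_P)
    with \<open>continuous_at_shifts G T (\<lambda>_. 1)\<close> pd_function_one[OF G] show ?thesis by simp
  qed
  have "pd_family G T P"
  proof (unfold_locales)
    fix W g assume Wg: "openin T W" "g \<in> W"
    then have g: "g \<in> carrier G" using openin_subset T by blast
    obtain p e where p: "pd_function G p" "continuous_at_shifts G T p" and e: "e > 0"
      and W: "\<And>h. h \<in> carrier G \<Longrightarrow> p (h \<otimes>\<^bsub>G\<^esub> inv\<^bsub>G\<^esub> g) > 1 - e \<Longrightarrow> h \<in> W"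
      using pd_separatedE[OF sep Wg] by blast
    define U where "U = {x \<in> carrier G. p x > 1 - e}"
    have "good U p" unfolding good_def using p e by (auto simp: U_def)
    from P[OF this] obtain e' where e': "e' > 0" "\<And>x. x \<in> carrier G \<Longrightarrow> P U x > 1 - e' \<Longrightarrow> x \<in> U"
      by (auto simp: good_def)
    show "\<exists>U. \<exists>e>0. \<forall>h\<in>carrier G. P U (h \<otimes>\<^bsub>G\<^esub> inv\<^bsub>G\<^esub> g) > 1 - e \<longrightarrow> h \<in> W"
    proof (intro exI[of _ U] exI[of _ e'] conjI ballI impI)
      fix h assume h: "h \<in> carrier G" "P U (h \<otimes>\<^bsub>G\<^esub> inv\<^bsub>G\<^esub> g) > 1 - e'"
      then have "h \<otimes>\<^bsub>G\<^esub> inv\<^bsub>G\<^esub> g \<in> U" using g by (intro e'(2)) auto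
      then show "h \<in> W" using W h by (auto simp: U_def)
    qed (rule e')
  qed (use T PU in auto)
  then show ?thesis by (rule pd_family.unitarily_representable)
qed

text \<open>Positive definite functions restrict to subgroups.\<close>
theorem pd_separated_embedding:
  assumes emb: "topological_group_embedding G S H T h"
    and G: "comm_group G" and H: "comm_group H" and sep: "pd_separated H T"
  shows "pd_separated G S"
  unfolding pd_separated_def
proof (intro allI impI, elim conjE)
  fix W g assume W: "openin S W" "g \<in> W"
  have tS: "topspace S = carrier G" and tT: "topspace T = carrier H" and hom: "h \<in> hom G H"
    and em: "embedding_map S T h"
    using emb by (auto simp: topological_group_embedding_def)
  interpret group_hom G H h
    using hom comm_group.axioms(2)[OF G] comm_group.axioms(2)[OF H]
    by (simp add: group_hom_def group_hom_axioms_def)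
  have g: "g \<in> carrier G" using W openin_subset tS by blast
  have "openin (subtopology T (h ` carrier G)) (h ` W)"
    using homeomorphic_map_openness[OF em[unfolded embedding_map_def], of W] openin_subset[OF W(1)] W(1) tS
    by simp
  then obtain V where V: "openin T V" "h ` W = V \<inter> h ` carrier G" by (auto simp: openin_subtopology)
  have inj: "inj_on h (carrier G)" using homeomorphic_imp_injective_map[OF em[unfolded embedding_map_def]] tS by simp
  obtain p e where p: "pd_function H p" "continuous_at_shifts H T p" and e: "e > 0"
      and pV: "\<And>y. y \<in> carrier H \<Longrightarrow> p (y \<otimes>\<^bsub>H\<^esub> inv\<^bsub>H\<^esub> h g) > 1 - e \<Longrightarrow> y \<in> V"
    by (rule pd_separatedE[OF sep V(1)]) (use V(2) W(2) in auto)
  have "pd_function G (p \<circ> h)"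
    unfolding pd_function_def
  proof (intro conjI allI ballI impI)
    show "(p \<circ> h) \<one>\<^bsub>G\<^esub> = 1" using p by (simp add: pd_function_def)
    show "(p \<circ> h) (inv\<^bsub>G\<^esub> x) = (p \<circ> h) x" if "x \<in> carrier G" for x
      using p that by (simp add: pd_function_def)
    fix X :: "'a set" and c :: "'a \<Rightarrow> real" assume X: "finite X" "X \<subseteq> carrier G"
    have i: "inj_on h X" using inj X inj_on_subset by blast
    let ?c = "\<lambda>y. c (inv_into X h y)"
    have "0 \<le> (\<Sum>x\<in>h ` X. \<Sum>y\<in>h ` X. ?c x * ?c y * p (x \<otimes>\<^bsub>H\<^esub> inv\<^bsub>H\<^esub> y))"
      using X by (intro pd_function_sum[OF p(1)]) (auto simp: subset_iff)
    also have "\<dots> = (\<Sum>x\<in>X. \<Sum>y\<in>X. c x * c y * (p \<circ> h) (x \<otimes>\<^bsub>G\<^esub> inv\<^bsub>G\<^esub> y))"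
      unfolding sum.reindex[OF i] comp_def using X i
      by (intro sum.cong refl) (auto simp: subset_iff)
    finally show "0 \<le> (\<Sum>x\<in>X. \<Sum>y\<in>X. c x * c y * (p \<circ> h) (x \<otimes>\<^bsub>G\<^esub> inv\<^bsub>G\<^esub> y))" .
  qed
  moreover have "continuous_at_shifts G S (p \<circ> h)"
    unfolding continuous_at_shifts_def
  proof (intro ballI allI impI)
    fix a and d :: real assume a: "a \<in> carrier G" and d: "d > 0"
    then obtain B where B: "openin T B" "h a \<in> B" "\<forall>y\<in>B. p (y \<otimes>\<^bsub>H\<^esub> inv\<^bsub>H\<^esub> h a) > 1 - d"
      using p(2) hom_closed unfolding continuous_at_shifts_def by blast
    have "continuous_map S T h"
      using homeomorphic_imp_continuous_map[OF em[unfolded embedding_map_def]]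
      by (simp add: continuous_map_in_subtopology)
    then have "openin S {x \<in> topspace S. h x \<in> B}"
      using B(1) by (rule openin_continuous_map_preimage)
    then show "\<exists>V. openin S V \<and> a \<in> V \<and> (\<forall>x\<in>V. (p \<circ> h) (x \<otimes>\<^bsub>G\<^esub> inv\<^bsub>G\<^esub> a) > 1 - d)"
      using B a tS by (intro exI[of _ "{x \<in> topspace S. h x \<in> B}"]) auto
  qed
  moreover have "x \<in> W" if x: "x \<in> carrier G" "(p \<circ> h) (x \<otimes>\<^bsub>G\<^esub> inv\<^bsub>G\<^esub> g) > 1 - e" for x
  proof -
    have "h x \<in> V" using x g by (intro pV) auto
    then have "h x \<in> h ` W" using V x by blast
    then show ?thesis using inj x openin_subset[OF W(1)] tS by (auto simp: inj_on_def)
  qed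
  ultimately show "\<exists>p. pd_function G p \<and> continuous_at_shifts G S p \<and>
       (\<exists>e>0. \<forall>h\<in>carrier G. p (h \<otimes>\<^bsub>G\<^esub> inv\<^bsub>G\<^esub> g) > 1 - e \<longrightarrow> h \<in> W)"
    using e by blast
qed

section \<open>Exponentials of negative \<open>\<ell>\<^sup>1\<close> norms\<close>

definition psd_on :: "'x set \<Rightarrow> ('x \<Rightarrow> 'x \<Rightarrow> real) \<Rightarrow> bool" where
  "psd_on S M \<longleftrightarrow> (\<forall>c. 0 \<le> (\<Sum>x\<in>S. \<Sum>y\<in>S. c x * c y * M x y))"

text \<open>The identity \<open>min a b = (\<integral>t. indicator {0..a} t * indicator {0..b} t)\<close> turns the quadratic form into an
  integral of quadratic forms of \<open>M\<close> with the coefficients of the points \<open>x\<close> with \<open>a x < t\<close> set to zero.\<close>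
lemma psd_on_min:
  assumes S: "finite S" and M: "psd_on S M" and a: "\<And>x. x \<in> S \<Longrightarrow> 0 \<le> a x"
  shows "psd_on S (\<lambda>x y. min (a x) (a y) * M x y)"
  unfolding psd_on_def
proof
  fix c :: "'a \<Rightarrow> real"
  define B where "B = (\<Sum>x\<in>S. a x)"
  have aB: "a x \<le> B" if "x \<in> S" for x
    unfolding B_def by (rule member_le_sum) (use that S a in auto)
  define u where "u x t = (if t \<in> {0..a x} then 1 else 0 :: real)" for x t
  have int: "((\<lambda>t. u x t * u y t) has_integral min (a x) (a y)) {0..B}" if "x \<in> S" "y \<in> S" for x y
  proof -
    have "((\<lambda>t::real. 1) has_integral min (a x) (a y)) {0..min (a x) (a y)}"
      using has_integral_const_real[of "1::real" 0 "min (a x) (a y)"] a[OF that(1)] a[OF that(2)] by simp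
    moreover have "{0..min (a x) (a y)} \<subseteq> {0..B}" using aB[OF that(1)] by auto
    ultimately have "((\<lambda>t. if t \<in> {0..min (a x) (a y)} then 1 else 0::real) has_integral min (a x) (a y)) {0..B}"
      by (simp only: has_integral_restrict)
    moreover have "u x t * u y t = (if t \<in> {0..min (a x) (a y)} then 1 else 0)" for t
      by (simp add: u_def)
    ultimately show ?thesis by (simp only:)
  qed
  have "((\<lambda>t. \<Sum>x\<in>S. \<Sum>y\<in>S. c x * c y * M x y * (u x t * u y t)) has_integral
      (\<Sum>x\<in>S. \<Sum>y\<in>S. c x * c y * M x y * min (a x) (a y))) {0..B}"
    by (intro has_integral_sum S has_integral_mult_right int)
  moreover have "0 \<le> (\<Sum>x\<in>S. \<Sum>y\<in>S. c x * c y * M x y * (u x t * u y t))" for t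
  proof -
    have "0 \<le> (\<Sum>x\<in>S. \<Sum>y\<in>S. (c x * u x t) * (c y * u y t) * M x y)"
      using M unfolding psd_on_def by (rule spec)
    then show ?thesis by (simp add: mult_ac)
  qed
  ultimately have "0 \<le> (\<Sum>x\<in>S. \<Sum>y\<in>S. c x * c y * M x y * min (a x) (a y))"
    by (rule has_integral_nonneg) 
  then show "0 \<le> (\<Sum>x\<in>S. \<Sum>y\<in>S. c x * c y * (min (a x) (a y) * M x y))"
    by (simp add: mult_ac)
qed

text \<open>Up to the factors \<open>exp (- u x)\<close>, which can be absorbed in the coefficients, \<open>exp (- \<bar>u x - u y\<bar>)\<close> is
  the minimum of \<open>exp (2 * u x)\<close> and \<open>exp (2 * u y)\<close>.\<close>
lemma psd_on_exp_abs:
  assumes S: "finite S" and M: "psd_on S M"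
  shows "psd_on S (\<lambda>x y. exp (- \<bar>u x - u y\<bar>) * M x y)"
  unfolding psd_on_def
proof
  fix c :: "'a \<Rightarrow> real"
  have eq: "exp (- \<bar>s - t\<bar>) = exp (- s) * exp (- t) * min (exp (2 * s)) (exp (2 * t))" for s t :: real
  proof (cases "s \<le> t")
    case True
    then show ?thesis by (simp add: min_def flip: exp_add)
  next
    case False
    then show ?thesis by (simp add: min_def flip: exp_add)
  qed
  have "0 \<le> (\<Sum>x\<in>S. \<Sum>y\<in>S. (c x * exp (- u x)) * (c y * exp (- u y)) *
      (min (exp (2 * u x)) (exp (2 * u y)) * M x y))"
    using psd_on_min[OF S M, of "\<lambda>x. exp (2 * u x)"] unfolding psd_on_def by (simp del: min_le_iff_disj)
  then show "0 \<le> (\<Sum>x\<in>S. \<Sum>y\<in>S. c x * c y * (exp (- \<bar>u x - u y\<bar>) * M x y))"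
    unfolding eq by (simp only: mult_ac)
qed

lemma psd_on_exp_sum:
  assumes S: "finite S" and M: "psd_on S M" and J: "finite J"
  shows "psd_on S (\<lambda>x y. exp (- (\<Sum>j\<in>J. \<bar>u j x - u j y\<bar>)) * M x y)"
  using J
proof (induction J rule: finite_induct)
  case empty
  then show ?case using M by simp
next
  case (insert j J)
  have "exp (- (\<Sum>j\<in>insert j J. \<bar>u j x - u j y\<bar>)) * M x y =
      exp (- \<bar>u j x - u j y\<bar>) * (exp (- (\<Sum>j\<in>J. \<bar>u j x - u j y\<bar>)) * M x y)" for x y
    unfolding sum.insert[OF insert.hyps] minus_add_distrib exp_add by (rule mult.assoc)
  then show ?case using psd_on_exp_abs[OF S insert.IH, of "u j"] by (simp only:)
qed

lemma psd_on_exp_suminf: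
  assumes S: "finite S" and J: "\<And>m. finite (J m)"
    and summ: "\<And>x y. x \<in> S \<Longrightarrow> y \<in> S \<Longrightarrow> summable (\<lambda>m. \<Sum>j\<in>J m. \<bar>u m j x - u m j y\<bar>)"
  shows "psd_on S (\<lambda>x y. exp (- suminf (\<lambda>m. \<Sum>j\<in>J m. \<bar>u m j x - u m j y\<bar>)))"
  unfolding psd_on_def
proof
  fix c :: "'a \<Rightarrow> real"
  let ?f = "\<lambda>m x y. \<Sum>j\<in>J m. \<bar>u m j x - u m j y\<bar>"
  have one: "psd_on S (\<lambda>x y. 1)"
  proof -
    have "(\<Sum>x\<in>S. \<Sum>y\<in>S. c x * c y * 1) = (\<Sum>x\<in>S. c x)\<^sup>2" for c :: "'a \<Rightarrow> real"
      by (simp add: sum_product power2_eq_square)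
    then show ?thesis by (simp add: psd_on_def)
  qed
  have fin: "psd_on S (\<lambda>x y. exp (- (\<Sum>m<n. ?f m x y)))" for n
  proof (induction n)
    case 0
    then show ?case using one by simp
  next
    case (Suc n)
    have "exp (- (\<Sum>m<Suc n. ?f m x y)) = exp (- ?f n x y) * exp (- (\<Sum>m<n. ?f m x y))" for x y
      by (simp flip: exp_add)
    then show ?case using psd_on_exp_sum[OF S Suc.IH J[of n], of "u n"] by (simp only:)
  qed
  have "(\<lambda>n. \<Sum>x\<in>S. \<Sum>y\<in>S. c x * c y * exp (- (\<Sum>m<n. ?f m x y))) \<longlonglongrightarrow>
      (\<Sum>x\<in>S. \<Sum>y\<in>S. c x * c y * exp (- suminf (\<lambda>m. ?f m x y)))"
    by (intro tendsto_intros summable_LIMSEQ summ)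
  then show "0 \<le> (\<Sum>x\<in>S. \<Sum>y\<in>S. c x * c y * exp (- suminf (\<lambda>m. ?f m x y)))"
    by (rule LIMSEQ_le_const) (use fin in \<open>auto simp: psd_on_def\<close>)
qed

section \<open>The dual of C(K) with compact convergence\<close>

lemma (in Metric_space) compactin_null_blocks:
  assumes z: "z \<in> M" and F: "\<And>m::nat. finite (F m)" "\<And>m. F m \<subseteq> M"
    and null: "\<And>e. e > 0 \<Longrightarrow> \<exists>n. \<forall>m\<ge>n. \<forall>f\<in>F m. d z f < e"
  shows "compactin mtopology (insert z (\<Union>m. F m))"
  unfolding compactin_def
proof (intro conjI allI impI)
  show "insert z (\<Union>m. F m) \<subseteq> topspace mtopology"
    using z UN_least[of UNIV F M] F(2) by simp
  fix \<U> assume \<U>: "Ball \<U> (openin mtopology) \<and> insert z (\<Union>m. F m) \<subseteq> \<Union>\<U>"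
  then obtain U where U: "U \<in> \<U>" "z \<in> U" by blast
  then obtain e where e: "e > 0" "mball z e \<subseteq> U" using \<U> openin_mtopology by metis
  obtain n where n: "\<And>m f. m \<ge> n \<Longrightarrow> f \<in> F m \<Longrightarrow> d z f < e" using null[OF e(1)] by blast
  have "finite (\<Union>m<n. F m)" using F by auto
  moreover have "(\<Union>m<n. F m) \<subseteq> \<Union>\<U>" 
  proof
    fix x assume "x \<in> (\<Union>m<n. F m)"
    then have "x \<in> insert z (\<Union>m. F m)" by blast
    then show "x \<in> \<Union>\<U>" by (rule subsetD[OF conjunct2[OF \<U>]])
  qed
  ultimately obtain \<F> where \<F>: "finite \<F>" "\<F> \<subseteq> \<U>" "(\<Union>m<n. F m) \<subseteq> \<Union>\<F>"
    using finite_subset_Union[of "\<Union>m<n. F m" \<U>] by metis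
  have "F m \<subseteq> \<Union>(insert U \<F>)" for m
  proof (cases "m < n")
    case False
    then have "F m \<subseteq> mball z e" using n[of m] F(2)[of m] z by auto
    then show ?thesis using e by auto
  qed (use \<F> in auto)
  then show "\<exists>\<F>. finite \<F> \<and> \<F> \<subseteq> \<U> \<and> insert z (\<Union>m. F m) \<subseteq> \<Union>\<F>"
    using \<F> U by (intro exI[of _ "insert U \<F>"]) auto
qed

locale compact_K =
  fixes K :: "'k topology"
  assumes compact_K: "compact_space K"
begin

definition CK :: "('k \<Rightarrow> real) set" where "CK = mspace (C_space K)"

definition cdist :: "('k \<Rightarrow> real) \<Rightarrow> ('k \<Rightarrow> real) \<Rightarrow> real" where "cdist = mdist (C_space K)"

sublocale C: Metric_space CK cdist
  unfolding CK_def cdist_def by (rule Metric_space_mspace_mdist)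

lemma mtopology_C: "mtopology_of (C_space K) = C.mtopology"
  by (simp add: mtopology_of_def CK_def cdist_def)

lemma CK_iff: "f \<in> CK \<longleftrightarrow> f \<in> extensional (topspace K) \<and> continuous_map K euclideanreal f"
proof -
  have "Met_TC.mbounded (f ` topspace K)" if "continuous_map K euclideanreal f"
    by (intro Met_TC.compactin_imp_mbounded) (use image_compactin[OF _ that, of "topspace K"] compact_K in
      \<open>auto simp: compact_space_def\<close>)
  then show ?thesis by (auto simp: CK_def C_space_def)
qed

lemma CK_restrict:
  assumes "continuous_map K euclideanreal f"
  shows "restrict f (topspace K) \<in> CK"
  unfolding CK_iff
proof
  show "continuous_map K euclideanreal (restrict f (topspace K))"
    by (rule continuous_map_eq[OF assms]) simp
qed simp

lemma CK_cont: "f \<in> CK \<Longrightarrow> continuous_map K euclideanreal f"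
  by (simp add: CK_iff)

lemma CK_eqI: "f \<in> CK \<Longrightarrow> g \<in> CK \<Longrightarrow> (\<And>x. x \<in> topspace K \<Longrightarrow> f x = g x) \<Longrightarrow> f = g"
  by (rule extensionalityI[of _ "topspace K"]) (auto simp: CK_iff)

lemma cdist_leI:
  assumes "0 \<le> r" "\<And>x. x \<in> topspace K \<Longrightarrow> \<bar>f x - g x\<bar> \<le> r"
  shows "cdist f g \<le> r"
  unfolding cdist_def C_space_def
  using assms by (intro mdist_cfunspace_le) (auto simp: dist_real_def)

lemma abs_diff_le_cdist:
  assumes "f \<in> CK" "g \<in> CK" "x \<in> topspace K"
  shows "\<bar>f x - g x\<bar> \<le> cdist f g"
proof -
  have "topspace K \<noteq> {}" using assms by auto
  then have "\<forall>x\<in>topspace K. mdist euclidean_metric (f x) (g x) \<le> cdist f g"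
    using cfunspace_mdist_le[of f K euclidean_metric g "cdist f g"] assms(1,2)
    unfolding cdist_def C_space_def CK_def by blast
  then show ?thesis using assms(3) by (simp add: dist_real_def)
qed

lemma CK_lin:
  assumes "f \<in> CK" "g \<in> CK"
  shows "(\<lambda>x\<in>topspace K. a * f x + b * g x) \<in> CK"
  by (intro CK_restrict continuous_intros) (use assms CK_cont in auto)

lemma CK_sum:
  assumes "finite I" "\<And>i. i \<in> I \<Longrightarrow> h i \<in> CK"
  shows "(\<lambda>x\<in>topspace K. \<Sum>i\<in>I. c i * h i x) \<in> CK"
  by (intro CK_restrict continuous_intros) (use assms CK_cont in auto)

lemma CK_mult:
  assumes "f \<in> CK" "g \<in> CK"
  shows "(\<lambda>x\<in>topspace K. a * f x * g x) \<in> CK"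
  by (intro CK_restrict continuous_intros) (use assms CK_cont in auto)

lemma CK_const: "(\<lambda>x\<in>topspace K. c) \<in> CK"
  by (intro CK_restrict continuous_intros)

abbreviation dualK :: "(('k \<Rightarrow> real) \<Rightarrow> real) set" where "dualK \<equiv> C_dual K"

lemma dual_iff: "\<phi> \<in> dualK \<longleftrightarrow> \<phi> \<in> extensional CK \<and> continuous_map C.mtopology euclideanreal \<phi> \<and>
     (\<forall>f\<in>CK. \<forall>g\<in>CK. \<forall>a b. \<phi> (\<lambda>x\<in>topspace K. a * f x + b * g x) = a * \<phi> f + b * \<phi> g)"
  by (simp add: C_dual_def mtopology_C CK_def[symmetric])

lemma dual_lin:
  "\<phi> \<in> dualK \<Longrightarrow> f \<in> CK \<Longrightarrow> g \<in> CK \<Longrightarrow> \<phi> (\<lambda>x\<in>topspace K. a * f x + b * g x) = a * \<phi> f + b * \<phi> g"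
  by (simp add: dual_iff)

lemma dual_zero: "\<phi> \<in> dualK \<Longrightarrow> \<phi> (\<lambda>x\<in>topspace K. 0) = 0"
  using dual_lin[OF _ CK_const CK_const, of \<phi> 0 0 0 0] by simp

lemma dual_scale: "\<phi> \<in> dualK \<Longrightarrow> f \<in> CK \<Longrightarrow> \<phi> (\<lambda>x\<in>topspace K. a * f x) = a * \<phi> f"
  using dual_lin[of \<phi> f f a 0] by simp

lemma dual_sum:
  assumes \<phi>: "\<phi> \<in> dualK" and "finite I" "\<And>i. i \<in> I \<Longrightarrow> h i \<in> CK"
  shows "\<phi> (\<lambda>x\<in>topspace K. \<Sum>i\<in>I. c i * h i x) = (\<Sum>i\<in>I. c i * \<phi> (h i))"
  using assms(2,3)
proof (induction I rule: finite_induct)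
  case empty
  show ?case unfolding sum.empty by (rule dual_zero[OF \<phi>])
next
  case (insert i I)
  have s: "(\<lambda>x\<in>topspace K. \<Sum>i\<in>I. c i * h i x) \<in> CK" using insert by (intro CK_sum) auto
  have eq: "(\<lambda>x\<in>topspace K. \<Sum>i\<in>insert i I. c i * h i x) =
      (\<lambda>x\<in>topspace K. c i * h i x + 1 * (\<lambda>x\<in>topspace K. \<Sum>i\<in>I. c i * h i x) x)"
    using insert.hyps by (auto simp: fun_eq_iff)
  have "\<phi> (\<lambda>x\<in>topspace K. \<Sum>i\<in>insert i I. c i * h i x) =
      c i * \<phi> (h i) + 1 * \<phi> (\<lambda>x\<in>topspace K. \<Sum>i\<in>I. c i * h i x)"
    unfolding eq by (rule dual_lin[OF \<phi> _ s]) (use insert.prems in auto)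
  also have "\<phi> (\<lambda>x\<in>topspace K. \<Sum>i\<in>I. c i * h i x) = (\<Sum>i\<in>I. c i * \<phi> (h i))"
    by (rule insert.IH) (use insert.prems in auto)
  finally show ?case using insert.hyps by simp
qed

lemma dual_bounded:
  assumes \<phi>: "\<phi> \<in> dualK"
  obtains C where "C \<ge> 0" "\<And>f r. f \<in> CK \<Longrightarrow> 0 \<le> r \<Longrightarrow> (\<And>x. x \<in> topspace K \<Longrightarrow> \<bar>f x\<bar> \<le> r) \<Longrightarrow> \<bar>\<phi> f\<bar> \<le> C * r"
proof -
  define z where "z = (\<lambda>x\<in>topspace K. 0::real)"
  have z: "z \<in> CK" by (simp add: z_def CK_const)
  have "continuous_map C.mtopology Met_TC.mtopology \<phi>" using \<phi> by (simp add: dual_iff)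
  then obtain U where U: "openin C.mtopology U" "z \<in> U" "\<forall>f\<in>U. \<phi> f \<in> Met_TC.mball (\<phi> z) 1"
    unfolding Met_TC.continuous_map_to_metric using z by (metis C.topspace_mtopology zero_less_one)
  then obtain d where d: "d > 0" "C.mball z d \<subseteq> U" using C.openin_mtopology by metis
  have small: "\<bar>\<phi> f\<bar> \<le> 1" if "f \<in> CK" "\<And>x. x \<in> topspace K \<Longrightarrow> \<bar>f x\<bar> \<le> d / 2" for f
  proof -
    have "cdist z f \<le> d / 2" using that d by (intro cdist_leI) (auto simp: z_def)
    then have "f \<in> C.mball z d" using that z d by simp
    then have "\<phi> f \<in> Met_TC.mball (\<phi> z) 1" using d U by blast
    then show ?thesis using dual_zero[OF \<phi>] by (simp add: z_def dist_real_def)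
  qed
  have "\<bar>\<phi> f\<bar> \<le> 2 / d * r" if f: "f \<in> CK" "0 \<le> r" "\<And>x. x \<in> topspace K \<Longrightarrow> \<bar>f x\<bar> \<le> r" for f r
  proof (cases "r = 0")
    case True
    then have "f = z" using f z by (intro CK_eqI) (auto simp: z_def)
    then show ?thesis using True dual_zero[OF \<phi>] by (simp add: z_def)
  next
    case False
    then have r: "r > 0" using f by simp
    let ?g = "\<lambda>x\<in>topspace K. d / (2 * r) * f x"
    have "?g \<in> CK" using CK_lin[OF f(1) f(1), of "d / (2 * r)" 0] by simp
    moreover have "\<bar>?g x\<bar> \<le> d / 2" if "x \<in> topspace K" for x
    proof -
      have "\<bar>?g x\<bar> = d / (2 * r) * \<bar>f x\<bar>" using that d r by (simp add: abs_mult)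
      also have "\<dots> \<le> d / (2 * r) * r" using f(3)[OF that] d r by (intro mult_left_mono) auto
      finally show ?thesis using r by simp
    qed
    ultimately have "\<bar>\<phi> ?g\<bar> \<le> 1" by (rule small)
    then have "d / (2 * r) * \<bar>\<phi> f\<bar> \<le> 1"
      using d r by (simp only: dual_scale[OF \<phi> f(1)] abs_mult) simp
    then show ?thesis using d r by (simp add: field_simps)
  qed
  then show ?thesis using d that[of "2 / d"] by simp
qed

text \<open>Boundedness is phrased without the norm of \<open>C(K)\<close>, which would need a separate treatment of the
  empty space.\<close>
lemma dualI:
  assumes ext: "\<phi> \<in> extensional CK"
    and lin: "\<And>f g a b. f \<in> CK \<Longrightarrow> g \<in> CK \<Longrightarrow> \<phi> (\<lambda>x\<in>topspace K. a * f x + b * g x) = a * \<phi> f + b * \<phi> g"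
    and bd: "C \<ge> 0" "\<And>f r. f \<in> CK \<Longrightarrow> 0 \<le> r \<Longrightarrow> (\<And>x. x \<in> topspace K \<Longrightarrow> \<bar>f x\<bar> \<le> r) \<Longrightarrow> \<bar>\<phi> f\<bar> \<le> C * r"
  shows "\<phi> \<in> dualK"
proof -
  have le: "\<bar>\<phi> f - \<phi> g\<bar> \<le> C * cdist f g" if fg: "f \<in> CK" "g \<in> CK" for f g
  proof -
    have "\<phi> f - \<phi> g = \<phi> (\<lambda>x\<in>topspace K. 1 * f x + (-1) * g x)" by (simp only: lin[OF fg])
    also have "\<bar>\<dots>\<bar> \<le> C * cdist f g"
      using fg abs_diff_le_cdist[OF fg] by (intro bd CK_lin) auto
    finally show ?thesis .
  qed
  have "continuous_map C.mtopology Met_TC.mtopology \<phi>"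
    unfolding Met_TC.continuous_map_to_metric
  proof (intro ballI allI impI)
    fix f and e :: real assume "f \<in> topspace C.mtopology" and e: "e > 0"
    then have f: "f \<in> CK" by simp
    have "\<phi> g \<in> Met_TC.mball (\<phi> f) e" if "g \<in> C.mball f (e / (C + 1))" for g
    proof -
      have "\<bar>\<phi> f - \<phi> g\<bar> \<le> C * cdist f g" using that by (intro le) auto
      also have "\<dots> \<le> (C + 1) * cdist f g" by (intro mult_right_mono) auto
      also have "\<dots> < e" using that bd(1) by (simp add: field_simps)
      finally show ?thesis by (simp add: dist_real_def)
    qed
    then show "\<exists>U. openin C.mtopology U \<and> f \<in> U \<and> (\<forall>y\<in>U. \<phi> y \<in> Met_TC.mball (\<phi> f) e)"
      using f e bd(1) by (intro exI[of _ "C.mball f (e / (C + 1))"]) auto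
  qed
  then show ?thesis using ext lin by (simp add: dual_iff)
qed

lemma dual_comb:
  assumes \<phi>: "\<phi> \<in> dualK" and \<psi>: "\<psi> \<in> dualK"
  shows "(\<lambda>f\<in>CK. s * \<phi> f + t * \<psi> f) \<in> dualK"
proof -
  obtain C where C: "C \<ge> 0" "\<And>f r. f \<in> CK \<Longrightarrow> 0 \<le> r \<Longrightarrow> (\<And>x. x \<in> topspace K \<Longrightarrow> \<bar>f x\<bar> \<le> r) \<Longrightarrow> \<bar>\<phi> f\<bar> \<le> C * r"
    using dual_bounded[OF \<phi>] by blast
  obtain D where D: "D \<ge> 0" "\<And>f r. f \<in> CK \<Longrightarrow> 0 \<le> r \<Longrightarrow> (\<And>x. x \<in> topspace K \<Longrightarrow> \<bar>f x\<bar> \<le> r) \<Longrightarrow> \<bar>\<psi> f\<bar> \<le> D * r"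
    using dual_bounded[OF \<psi>] by blast
  show ?thesis
  proof (rule dualI[where C = "\<bar>s\<bar> * C + \<bar>t\<bar> * D"])
    fix f r assume f: "f \<in> CK" "0 \<le> (r::real)" "\<And>x. x \<in> topspace K \<Longrightarrow> \<bar>f x\<bar> \<le> r"
    have "\<bar>s * \<phi> f + t * \<psi> f\<bar> \<le> \<bar>s\<bar> * \<bar>\<phi> f\<bar> + \<bar>t\<bar> * \<bar>\<psi> f\<bar>"
      using abs_triangle_ineq[of "s * \<phi> f" "t * \<psi> f"] by (simp add: abs_mult)
    also have "\<dots> \<le> \<bar>s\<bar> * (C * r) + \<bar>t\<bar> * (D * r)"
      using C(2)[OF f] D(2)[OF f] by (intro add_mono mult_left_mono) auto
    finally show "\<bar>(\<lambda>f\<in>CK. s * \<phi> f + t * \<psi> f) f\<bar> \<le> (\<bar>s\<bar> * C + \<bar>t\<bar> * D) * r"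
      using f by (simp add: algebra_simps)
  next
    fix f g a b assume fg: "f \<in> CK" "g \<in> CK"
    show "(\<lambda>f\<in>CK. s * \<phi> f + t * \<psi> f) (\<lambda>x\<in>topspace K. a * f x + b * g x) =
        a * (\<lambda>f\<in>CK. s * \<phi> f + t * \<psi> f) f + b * (\<lambda>f\<in>CK. s * \<phi> f + t * \<psi> f) g"
      using fg CK_lin[OF fg, of a b] dual_lin[OF \<phi> fg, of a b] dual_lin[OF \<psi> fg, of a b]
      by (simp only: restrict_apply' algebra_simps)
  qed (use C(1) D(1) in simp_all)
qed

lemma dual_eqI: "\<phi> \<in> dualK \<Longrightarrow> \<psi> \<in> dualK \<Longrightarrow> (\<And>f. f \<in> CK \<Longrightarrow> \<phi> f = \<psi> f) \<Longrightarrow> \<phi> = \<psi>"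
  by (rule extensionalityI[of _ CK]) (auto simp: dual_iff)

lemma dual_undef: "\<phi> \<in> dualK \<Longrightarrow> f \<notin> CK \<Longrightarrow> \<phi> f = undefined"
  by (simp add: dual_iff extensional_def)

abbreviation "Mc \<equiv> Mc_group K"
abbreviation "Mct \<equiv> Mc_topology K"

lemma Mc_simps: "carrier Mc = dualK" "\<phi> \<otimes>\<^bsub>Mc\<^esub> \<psi> = (\<lambda>f\<in>CK. \<phi> f + \<psi> f)"
  "\<one>\<^bsub>Mc\<^esub> = (\<lambda>f\<in>CK. 0)"
  by (simp_all add: Mc_group_def CK_def)

lemma Mc_zero: "(\<lambda>f\<in>CK. 0) \<in> dualK"
  by (rule dualI[of _ 0]) (simp_all add: CK_lin)

lemma Mc_comm_group: "comm_group Mc"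
proof (rule comm_groupI)
  note c1 = dual_comb[where s=1 and t=1, simplified]
  show "x \<otimes>\<^bsub>Mc\<^esub> y \<in> carrier Mc" if "x \<in> carrier Mc" "y \<in> carrier Mc" for x y
    using that c1 by (simp add: Mc_simps)
  show "\<exists>y\<in>carrier Mc. y \<otimes>\<^bsub>Mc\<^esub> x = \<one>\<^bsub>Mc\<^esub>" if "x \<in> carrier Mc" for x
    using that dual_comb[of x x "-1" 0]
    by (intro bexI[of _ "\<lambda>f\<in>CK. - x f"]) (auto simp: Mc_simps fun_eq_iff)
  show "x \<otimes>\<^bsub>Mc\<^esub> y \<otimes>\<^bsub>Mc\<^esub> z = x \<otimes>\<^bsub>Mc\<^esub> (y \<otimes>\<^bsub>Mc\<^esub> z)" for x y z
    by (simp add: Mc_simps fun_eq_iff)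
  show "x \<otimes>\<^bsub>Mc\<^esub> y = y \<otimes>\<^bsub>Mc\<^esub> x" for x y
    by (simp add: Mc_simps fun_eq_iff)
  show "\<one>\<^bsub>Mc\<^esub> \<in> carrier Mc" by (simp add: Mc_simps Mc_zero)
  show "\<one>\<^bsub>Mc\<^esub> \<otimes>\<^bsub>Mc\<^esub> x = x" if "x \<in> carrier Mc" for x
    using that dual_undef[of x] by (simp add: Mc_simps fun_eq_iff)
qed

lemma Mc_inv: "\<phi> \<in> dualK \<Longrightarrow> inv\<^bsub>Mc\<^esub> \<phi> = (\<lambda>f\<in>CK. - \<phi> f)"
proof -
  assume \<phi>: "\<phi> \<in> dualK"
  interpret comm_group Mc by (rule Mc_comm_group)
  show ?thesis
    by (rule inv_equality) (use \<phi> dual_comb[of \<phi> \<phi> "-1" 0] in \<open>auto simp: Mc_simps fun_eq_iff\<close>)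
qed

definition nbhd :: "(('k \<Rightarrow> real) \<Rightarrow> real) \<Rightarrow> ('k \<Rightarrow> real) set \<Rightarrow> real \<Rightarrow> (('k \<Rightarrow> real) \<Rightarrow> real) set" where
  "nbhd \<phi> A e = {\<psi> \<in> dualK. \<forall>f\<in>A. \<bar>\<psi> f - \<phi> f\<bar> < e}"

text \<open>The slack \<open>e - \<bar>\<psi> f - \<phi> f\<bar>\<close> is bounded away from zero on \<open>A\<close> by compactness.  Hence the basic sets
  centred at a point form a neighbourhood base there.\<close>
lemma nbhd_refine:
  assumes \<phi>: "\<phi> \<in> dualK" and A: "compactin C.mtopology A" and \<psi>: "\<psi> \<in> nbhd \<phi> A e"
  shows "\<exists>e'>0. nbhd \<psi> A e' \<subseteq> nbhd \<phi> A e"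
proof (cases "A = {}")
  case True
  then show ?thesis by (intro exI[of _ 1]) (auto simp: nbhd_def)
next
  case False
  have \<psi>d: "\<psi> \<in> dualK" using \<psi> by (simp add: nbhd_def)
  have "continuous_map C.mtopology euclideanreal (\<lambda>f. \<bar>\<psi> f - \<phi> f\<bar>)"
    by (intro continuous_intros) (use \<phi> \<psi>d in \<open>auto simp: dual_iff\<close>)
  then have "compactin euclideanreal ((\<lambda>f. \<bar>\<psi> f - \<phi> f\<bar>) ` A)" by (rule image_compactin[OF A])
  then have "compact ((\<lambda>f. \<bar>\<psi> f - \<phi> f\<bar>) ` A)" by simp
  then obtain f where f: "f \<in> A" "\<And>g. g \<in> A \<Longrightarrow> \<bar>\<psi> g - \<phi> g\<bar> \<le> \<bar>\<psi> f - \<phi> f\<bar>"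
    using compact_attains_sup[of "(\<lambda>f. \<bar>\<psi> f - \<phi> f\<bar>) ` A"] False by auto
  have "nbhd \<psi> A (e - \<bar>\<psi> f - \<phi> f\<bar>) \<subseteq> nbhd \<phi> A e"
  proof
    fix \<theta> assume \<theta>: "\<theta> \<in> nbhd \<psi> A (e - \<bar>\<psi> f - \<phi> f\<bar>)"
    have "\<bar>\<theta> g - \<phi> g\<bar> < e" if g: "g \<in> A" for g
    proof -
      have "\<bar>\<theta> g - \<psi> g\<bar> < e - \<bar>\<psi> f - \<phi> f\<bar>" using \<theta> g by (simp add: nbhd_def)
      with f(2)[OF g] show ?thesis by linarith
    qed
    then show "\<theta> \<in> nbhd \<phi> A e" using \<theta> by (simp add: nbhd_def)
  qed
  moreover have "e - \<bar>\<psi> f - \<phi> f\<bar> > 0" using \<psi> f by (simp add: nbhd_def)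
  ultimately show ?thesis by blast
qed

lemma Mc_topology_eq: "Mct = topology_generated_by {nbhd \<phi> A e | \<phi> A e. \<phi> \<in> dualK \<and> compactin C.mtopology A \<and> e > 0}"
  by (simp add: Mc_topology_def nbhd_def mtopology_C)

lemma openin_nbhd: "\<phi> \<in> dualK \<Longrightarrow> compactin C.mtopology A \<Longrightarrow> e > 0 \<Longrightarrow> openin Mct (nbhd \<phi> A e)"
  unfolding Mc_topology_eq by (intro topology_generated_by_Basis) blast

lemma nbhd_self: "\<phi> \<in> dualK \<Longrightarrow> e > 0 \<Longrightarrow> \<phi> \<in> nbhd \<phi> A e"
  by (simp add: nbhd_def)

lemma Mc_topspace: "topspace Mct = dualK"
proof -
  have "\<phi> \<in> topspace Mct" if "\<phi> \<in> dualK" for \<phi>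
    using openin_subset[OF openin_nbhd[OF that, of "{}" 1]] nbhd_self[OF that, of 1 "{}"] by auto
  moreover have "topspace Mct \<subseteq> dualK"
    unfolding Mc_topology_eq topology_generated_by_topspace by (auto simp: nbhd_def)
  ultimately show ?thesis by auto
qed

lemma openin_Mc_nbhd:
  assumes "openin Mct W" "\<phi> \<in> W"
  obtains A e where "compactin C.mtopology A" "e > 0" "nbhd \<phi> A e \<subseteq> W"
proof -
  have "generate_topology_on {nbhd \<phi> A e | \<phi> A e. \<phi> \<in> dualK \<and> compactin C.mtopology A \<and> e > 0} W"
    using assms(1) unfolding Mc_topology_eq openin_topology_generated_by_iff .
  then have "\<phi> \<in> W \<Longrightarrow> \<exists>A e. compactin C.mtopology A \<and> e > 0 \<and> nbhd \<phi> A e \<subseteq> W" for \<phi>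
  proof induction
    case Empty
    then show ?case by simp
  next
    case (Int a b)
    obtain A e where A: "compactin C.mtopology A" "e > 0" "nbhd \<phi> A e \<subseteq> a"
      using Int by auto
    obtain B e' where B: "compactin C.mtopology B" "e' > 0" "nbhd \<phi> B e' \<subseteq> b"
      using Int by auto
    have "nbhd \<phi> (A \<union> B) (min e e') \<subseteq> nbhd \<phi> A e \<inter> nbhd \<phi> B e'" by (auto simp: nbhd_def)
    then show ?case
      using A B by (intro exI[of _ "A \<union> B"] exI[of _ "min e e'"]) (auto simp: compactin_Un)
  next
    case (UN k)
    then obtain a where a: "a \<in> k" "\<phi> \<in> a" by blast
    then obtain A e where "compactin C.mtopology A" "e > 0" "nbhd \<phi> A e \<subseteq> a"
      using UN.IH[OF a] by blast
    then show ?case using a by (intro exI[of _ A] exI[of _ e]) auto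
  next
    case (Basis s)
    then obtain \<theta> A e where s: "s = nbhd \<theta> A e" "\<theta> \<in> dualK" "compactin C.mtopology A" by blast
    obtain e' where "e' > 0" "nbhd \<phi> A e' \<subseteq> nbhd \<theta> A e"
      using nbhd_refine[OF s(2,3)] Basis.prems s(1) by blast
    then show ?case unfolding s(1) using s(3) by (intro exI[of _ A] exI[of _ e']) auto
  qed
  from this[OF assms(2)] show ?thesis by (elim exE conjE) (rule that)
qed

lemma continuous_map_to_Mc:
  assumes "\<And>x. x \<in> topspace X \<Longrightarrow> F x \<in> dualK"
    and "\<And>x A e. x \<in> topspace X \<Longrightarrow> compactin C.mtopology A \<Longrightarrow> e > 0 \<Longrightarrow>
      \<exists>V. openin X V \<and> x \<in> V \<and> (\<forall>y\<in>V. \<forall>f\<in>A. \<bar>F y f - F x f\<bar> < e)"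
  shows "continuous_map X Mct F"
  unfolding continuous_map_def
proof (intro conjI allI impI)
  show "F \<in> topspace X \<rightarrow> topspace Mct" using assms(1) by (simp add: Mc_topspace)
  fix W assume W: "openin Mct W"
  show "openin X {x \<in> topspace X. F x \<in> W}"
  proof (subst openin_subopen, intro ballI)
    fix x assume "x \<in> {x \<in> topspace X. F x \<in> W}"
    then have x: "x \<in> topspace X" "F x \<in> W" by auto
    obtain A e where A: "compactin C.mtopology A" "e > 0" "nbhd (F x) A e \<subseteq> W"
      using openin_Mc_nbhd[OF W x(2)] by blast
    obtain V where V: "openin X V" "x \<in> V" "\<forall>y\<in>V. \<forall>f\<in>A. \<bar>F y f - F x f\<bar> < e"
      using assms(2)[OF x(1) A(1,2)] by blast
    have "V \<subseteq> {x \<in> topspace X. F x \<in> W}"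
    proof
      fix y assume y: "y \<in> V"
      then have yX: "y \<in> topspace X" using openin_subset[OF V(1)] by blast
      then have "F y \<in> nbhd (F x) A e" using V(3) y assms(1) by (simp add: nbhd_def)
      then show "y \<in> {x \<in> topspace X. F x \<in> W}" using yX A(3) by blast
    qed
    then show "\<exists>T. openin X T \<and> x \<in> T \<and> T \<subseteq> {x \<in> topspace X. F x \<in> W}" using V by blast
  qed
qed

lemma compactin_bounded:
  assumes A: "compactin C.mtopology A"
  obtains M where "M > 0" "\<And>f x. f \<in> A \<Longrightarrow> x \<in> topspace K \<Longrightarrow> \<bar>f x\<bar> \<le> M"
proof -
  define z where "z = (\<lambda>x\<in>topspace K. 0::real)"
  have z: "z \<in> CK" by (simp add: z_def CK_const)
  have "C.mbounded A" by (rule C.compactin_imp_mbounded[OF A])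
  then obtain w B where B: "A \<subseteq> C.mcball w B" by (auto simp: C.mbounded_def)
  have "\<bar>f x\<bar> \<le> \<bar>cdist z w + B\<bar> + 1" if "f \<in> A" "x \<in> topspace K" for f x
  proof -
    have f: "f \<in> CK" "w \<in> CK" "cdist w f \<le> B" using that B by auto
    then have "cdist z f \<le> cdist z w + B" using C.triangle[OF z f(2,1)] by simp
    then show ?thesis using abs_diff_le_cdist[OF z f(1) that(2)] that by (simp add: z_def)
  qed
  then show ?thesis using that[of "\<bar>cdist z w + B\<bar> + 1"] by simp
qed

text \<open>A finite \<open>e/3\<close>-net of \<open>A\<close> reduces the claim to finitely many continuous functions.\<close>
lemma compactin_equicontinuous:
  assumes A: "compactin C.mtopology A" and x: "x \<in> topspace K" and e: "e > 0"
  shows "\<exists>V. openin K V \<and> x \<in> V \<and> (\<forall>y\<in>V. \<forall>f\<in>A. \<bar>f x - f y\<bar> < e)"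
proof -
  have "C.mtotally_bounded A" by (rule C.compactin_imp_mtotally_bounded[OF A])
  then obtain E where E: "finite E" "E \<subseteq> A" "A \<subseteq> (\<Union>f\<in>E. C.mball f (e / 3))"
    using e unfolding C.mtotally_bounded_def by (metis divide_pos_pos zero_less_numeral)
  have EC: "E \<subseteq> CK" using E compactin_subset_topspace[OF A] by auto
  define V where "V = (\<Inter>g\<in>E. {y \<in> topspace K. g y \<in> ball (g x) (e / 3)}) \<inter> topspace K"
  have "openin K {y \<in> topspace K. g y \<in> ball (g x) (e / 3)}" if "g \<in> E" for g
    by (rule openin_continuous_map_preimage[OF CK_cont]) (use that EC in auto)
  then have "openin K V" unfolding V_def using E(1) by (intro openin_INT) auto
  moreover have "x \<in> V" using x e by (simp add: V_def)
  moreover have "\<bar>f x - f y\<bar> < e" if y: "y \<in> V" and f: "f \<in> A" for f y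
  proof -
    obtain g where g: "g \<in> E" "f \<in> C.mball g (e / 3)" using E f by blast
    have yK: "y \<in> topspace K" using y by (simp add: V_def)
    have "\<bar>g x - g y\<bar> < e / 3" using y g by (simp add: V_def dist_real_def)
    moreover have "\<bar>g x - f x\<bar> \<le> cdist g f" "\<bar>g y - f y\<bar> \<le> cdist g f"
      using g x yK by (auto intro!: abs_diff_le_cdist)
    moreover have "cdist g f < e / 3" using g by simp
    ultimately show ?thesis by linarith
  qed
  ultimately show ?thesis by blast
qed

end

section \<open>Norms from geometric families\<close>

context compact_K
begin

text \<open>A sequence of finite blocks of functions; the bound on the sums of absolute values makes every
  signed sum over the block \<open>m\<close> have norm at most \<open>C / 4\<^sup>m\<close>.\<close>
definition geometric_family :: "(nat \<Rightarrow> 'i set) \<Rightarrow> (nat \<Rightarrow> 'i \<Rightarrow> 'k \<Rightarrow> real) \<Rightarrow> bool" where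
  "geometric_family J h \<longleftrightarrow> (\<forall>m. finite (J m)) \<and> (\<forall>m. \<forall>i\<in>J m. h m i \<in> CK) \<and>
     (\<exists>C\<ge>0. \<forall>m. \<forall>x\<in>topspace K. (\<Sum>i\<in>J m. \<bar>h m i x\<bar>) \<le> C / 4 ^ m)"

definition family_norm :: "(nat \<Rightarrow> 'i set) \<Rightarrow> (nat \<Rightarrow> 'i \<Rightarrow> 'k \<Rightarrow> real) \<Rightarrow> (('k \<Rightarrow> real) \<Rightarrow> real) \<Rightarrow> real" where
  "family_norm J h \<phi> = suminf (\<lambda>m. \<Sum>i\<in>J m. \<bar>\<phi> (h m i)\<bar>)"

context
  fixes J :: "nat \<Rightarrow> 'i set" and h
  assumes geometric: "geometric_family J h"
begin

lemma fin_J: "finite (J m)" and h_CK: "i \<in> J m \<Longrightarrow> h m i \<in> CK"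
  using geometric by (auto simp: geometric_family_def)

lemma geometric_bound:
  obtains C where "C \<ge> 0" "\<And>m x. x \<in> topspace K \<Longrightarrow> (\<Sum>i\<in>J m. \<bar>h m i x\<bar>) \<le> C / 4 ^ m"
proof -
  have "\<exists>C\<ge>0. \<forall>m. \<forall>x\<in>topspace K. (\<Sum>i\<in>J m. \<bar>h m i x\<bar>) \<le> C / 4 ^ m"
    using geometric by (simp only: geometric_family_def)
  then show ?thesis using that by (elim exE conjE) simp
qed

text \<open>The signs of the values \<open>\<phi> (h m i)\<close> turn the \<open>\<ell>\<^sup>1\<close> sum over a block into a single value of \<open>\<phi>\<close>.\<close>
definition signed_sum :: "nat \<Rightarrow> real \<Rightarrow> ('i \<Rightarrow> real) \<Rightarrow> 'k \<Rightarrow> real" where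
  "signed_sum m a s = (\<lambda>x\<in>topspace K. \<Sum>i\<in>J m. (a * s i) * h m i x)"

lemma signed_sum_CK: "signed_sum m a s \<in> CK"
  unfolding signed_sum_def by (intro CK_sum fin_J h_CK)

lemma signed_sum_dual: "\<phi> \<in> dualK \<Longrightarrow> \<phi> (signed_sum m a (\<lambda>i\<in>J m. sgn (\<phi> (h m i)))) = a * (\<Sum>i\<in>J m. \<bar>\<phi> (h m i)\<bar>)"
proof -
  assume \<phi>: "\<phi> \<in> dualK"
  have "\<phi> (signed_sum m a (\<lambda>i\<in>J m. sgn (\<phi> (h m i)))) = (\<Sum>i\<in>J m. a * (\<lambda>i\<in>J m. sgn (\<phi> (h m i))) i * \<phi> (h m i))"
    unfolding signed_sum_def by (rule dual_sum[OF \<phi> fin_J h_CK])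
  also have "\<dots> = (\<Sum>i\<in>J m. a * \<bar>\<phi> (h m i)\<bar>)"
    by (intro sum.cong refl) (simp add: abs_sgn mult_ac)
  finally show ?thesis by (simp add: sum_distrib_left)
qed

lemma signed_sum_le:
  assumes s: "\<And>i. i \<in> J m \<Longrightarrow> \<bar>s i\<bar> \<le> 1" and a: "0 \<le> a" and x: "x \<in> topspace K"
  shows "\<bar>signed_sum m a s x\<bar> \<le> a * (\<Sum>i\<in>J m. \<bar>h m i x\<bar>)"
proof -
  have "\<bar>signed_sum m a s x\<bar> \<le> (\<Sum>i\<in>J m. \<bar>(a * s i) * h m i x\<bar>)"
    using x by (simp only: signed_sum_def restrict_apply' sum_abs)
  also have "\<dots> \<le> (\<Sum>i\<in>J m. a * \<bar>h m i x\<bar>)"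
  proof (rule sum_mono)
    fix i assume "i \<in> J m"
    then have "a * \<bar>s i\<bar> * \<bar>h m i x\<bar> \<le> a * 1 * \<bar>h m i x\<bar>"
      using s a by (intro mult_right_mono mult_left_mono) auto
    then show "\<bar>(a * s i) * h m i x\<bar> \<le> a * \<bar>h m i x\<bar>" using a by (simp add: abs_mult)
  qed
  finally show ?thesis by (simp add: sum_distrib_left)
qed

lemma summable_levels:
  assumes \<phi>: "\<phi> \<in> dualK"
  shows "summable (\<lambda>m. \<Sum>i\<in>J m. \<bar>\<phi> (h m i)\<bar>)"
proof -
  obtain C where C: "C \<ge> 0" "\<And>m x. x \<in> topspace K \<Longrightarrow> (\<Sum>i\<in>J m. \<bar>h m i x\<bar>) \<le> C / 4 ^ m"
    by (rule geometric_bound) (rule that)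
  obtain B where B: "B \<ge> 0" "\<And>f r. f \<in> CK \<Longrightarrow> 0 \<le> r \<Longrightarrow> (\<And>x. x \<in> topspace K \<Longrightarrow> \<bar>f x\<bar> \<le> r) \<Longrightarrow> \<bar>\<phi> f\<bar> \<le> B * r"
    using dual_bounded[OF \<phi>] by blast
  have le: "(\<Sum>i\<in>J m. \<bar>\<phi> (h m i)\<bar>) \<le> B * (C / 4 ^ m)" for m
  proof -
    let ?s = "\<lambda>i\<in>J m. sgn (\<phi> (h m i))"
    have "(\<Sum>i\<in>J m. \<bar>\<phi> (h m i)\<bar>) = \<phi> (signed_sum m 1 ?s)"
      using signed_sum_dual[OF \<phi>, of m 1] by simp
    also have "\<dots> \<le> \<bar>\<phi> (signed_sum m 1 ?s)\<bar>" by (rule abs_ge_self)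
    also have "\<dots> \<le> B * (C / 4 ^ m)"
    proof (rule B(2)[OF signed_sum_CK])
      show "0 \<le> C / 4 ^ m" using C(1) by simp
      fix x assume x: "x \<in> topspace K"
      have "\<bar>signed_sum m 1 ?s x\<bar> \<le> 1 * (\<Sum>i\<in>J m. \<bar>h m i x\<bar>)"
        by (rule signed_sum_le) (use x in \<open>auto simp: abs_sgn_eq\<close>)
      then show "\<bar>signed_sum m 1 ?s x\<bar> \<le> C / 4 ^ m" using C(2)[OF x, of m] by simp
    qed
    finally show ?thesis .
  qed
  have summ: "summable (\<lambda>m. B * (C / 4 ^ m))"
    using summable_mult[OF summable_geometric[of "1 / 4 :: real"], of "B * C"] by (simp add: power_divide)
  have "norm (\<Sum>i\<in>J m. \<bar>\<phi> (h m i)\<bar>) = (\<Sum>i\<in>J m. \<bar>\<phi> (h m i)\<bar>)" for m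
    unfolding real_norm_def by (rule abs_of_nonneg, rule sum_nonneg, rule abs_ge_zero)
  then have "norm (\<Sum>i\<in>J m. \<bar>\<phi> (h m i)\<bar>) \<le> B * (C / 4 ^ m)" for m using le by metis
  then show ?thesis by (rule summable_comparison_test'[OF summ, of 0])
qed

text \<open>With the factor \<open>2\<^sup>m\<close> the signed sums over the block \<open>m\<close> still have norm at most \<open>C / 2\<^sup>m\<close>, so all of
  them together with zero form a compact set.  A bound \<open>e/4\<close> for \<open>\<phi>\<close> on this set gives the bound
  \<open>e/4 \<cdot> 2\<^sup>-\<^sup>m\<close> for the block \<open>m\<close>, and these sum to \<open>e/2\<close>.  The value 0 is admitted as a sign because it
  is the sign of 0.\<close>
lemma family_norm_small:
  assumes e: "e > 0"
  obtains A d where "compactin C.mtopology A" "d > 0"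
    "\<And>\<phi>. \<phi> \<in> dualK \<Longrightarrow> (\<And>f. f \<in> A \<Longrightarrow> \<bar>\<phi> f\<bar> < d) \<Longrightarrow> family_norm J h \<phi> < e"
proof -
  obtain C where C: "C \<ge> 0" "\<And>m x. x \<in> topspace K \<Longrightarrow> (\<Sum>i\<in>J m. \<bar>h m i x\<bar>) \<le> C / 4 ^ m"
    by (rule geometric_bound) (rule that)
  define F where "F m = (\<lambda>s. signed_sum m (2 ^ m) s) ` (J m \<rightarrow>\<^sub>E {-1, 0, 1})" for m
  define z where "z = (\<lambda>x\<in>topspace K. 0::real)"
  define A where "A = insert z (\<Union>m. F m)"
  have "compactin C.mtopology A"
    unfolding A_def
  proof (rule C.compactin_null_blocks)
    show "z \<in> CK" unfolding z_def by (rule CK_const)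
    show "finite (F m)" for m unfolding F_def by (intro finite_imageI finite_PiE fin_J) simp
    show "F m \<subseteq> CK" for m unfolding F_def using signed_sum_CK by blast
    fix e :: real assume e: "e > 0"
    have "(\<lambda>m. C * (1 / 2) ^ m) \<longlonglongrightarrow> C * 0"
      by (intro tendsto_mult_left LIMSEQ_power_zero) simp
    then have "\<forall>\<^sub>F m in sequentially. C * (1 / 2) ^ m < e"
      using e by (intro order_tendstoD(2)[where y = "C * 0"]) auto
    then obtain n where n: "\<And>m. m \<ge> n \<Longrightarrow> C * (1 / 2) ^ m < e"
      by (auto simp: eventually_sequentially)
    have "cdist z f < e" if m: "m \<ge> n" and f: "f \<in> F m" for m f
    proof -
      obtain s where s: "f = signed_sum m (2 ^ m) s" "s \<in> J m \<rightarrow>\<^sub>E {-1, 0, 1}" using f by (auto simp: F_def)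
      have "cdist z f \<le> C * (1 / 2) ^ m"
      proof (rule cdist_leI)
        show "0 \<le> C * (1 / 2) ^ m" using C(1) by simp
        fix x assume x: "x \<in> topspace K"
        have "\<bar>f x\<bar> \<le> 2 ^ m * (\<Sum>i\<in>J m. \<bar>h m i x\<bar>)"
          unfolding s(1)
        proof (rule signed_sum_le[OF _ _ x])
          fix i assume "i \<in> J m"
          then have "s i \<in> {-1, 0, 1}" using s(2) by (rule_tac PiE_mem)
          then show "\<bar>s i\<bar> \<le> 1" by auto
        qed simp
        also have "\<dots> \<le> 2 ^ m * (C / 4 ^ m)" by (intro mult_left_mono C x) simp
        also have "\<dots> = C * (1 / 2) ^ m"
        proof -
          have "(4::real) ^ m = 2 ^ m * 2 ^ m" by (simp flip: power_mult_distrib)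
          then show ?thesis by (simp add: power_divide)
        qed
        finally show "\<bar>z x - f x\<bar> \<le> C * (1 / 2) ^ m" using x by (simp add: z_def)
      qed
      with n[OF m] show ?thesis by simp
    qed
    then show "\<exists>n. \<forall>m\<ge>n. \<forall>f\<in>F m. cdist z f < e" by blast
  qed
  moreover have "family_norm J h \<phi> < e" if \<phi>: "\<phi> \<in> dualK" and small: "\<And>f. f \<in> A \<Longrightarrow> \<bar>\<phi> f\<bar> < e / 4" for \<phi>
  proof -
    have le: "(\<Sum>i\<in>J m. \<bar>\<phi> (h m i)\<bar>) \<le> e / 4 * (1 / 2) ^ m" for m
    proof -
      let ?s = "\<lambda>i\<in>J m. sgn (\<phi> (h m i))"
      have "?s \<in> J m \<rightarrow>\<^sub>E {-1, 0, 1}" by (auto simp: sgn_real_def)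
      then have "signed_sum m (2 ^ m) ?s \<in> A" unfolding A_def F_def by blast
      then have "\<bar>\<phi> (signed_sum m (2 ^ m) ?s)\<bar> < e / 4" by (rule small)
      then have "2 ^ m * (\<Sum>i\<in>J m. \<bar>\<phi> (h m i)\<bar>) < e / 4"
        unfolding signed_sum_dual[OF \<phi>] by simp
      then show ?thesis by (simp add: power_divide field_simps)
    qed
    have g: "(\<lambda>m. e / 4 * (1 / 2) ^ m) sums (e / 4 * 2)"
      using sums_mult[OF geometric_sums[of "1 / 2 :: real"], of "e / 4"] by simp
    have "family_norm J h \<phi> \<le> suminf (\<lambda>m. e / 4 * (1 / 2) ^ m)"
      unfolding family_norm_def
      by (rule suminf_le[OF le summable_levels[OF \<phi>] sums_summable[OF g]])
    also have "\<dots> = e / 2" using sums_unique[OF g] by simp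
    finally show ?thesis using e by simp
  qed
  ultimately show ?thesis using that[of A "e / 4"] e by simp
qed

lemma Mc_diff: "\<phi> \<in> dualK \<Longrightarrow> \<psi> \<in> dualK \<Longrightarrow> \<phi> \<otimes>\<^bsub>Mc\<^esub> inv\<^bsub>Mc\<^esub> \<psi> = (\<lambda>f\<in>CK. 1 * \<phi> f + (-1) * \<psi> f)"
  by (auto simp: Mc_inv Mc_simps fun_eq_iff)

lemma Mc_diff_dual: "\<phi> \<in> dualK \<Longrightarrow> \<psi> \<in> dualK \<Longrightarrow> \<phi> \<otimes>\<^bsub>Mc\<^esub> inv\<^bsub>Mc\<^esub> \<psi> \<in> dualK"
  unfolding Mc_diff by (rule dual_comb)

lemma pd_function_family_norm: "pd_function Mc (\<lambda>\<phi>. exp (- family_norm J h \<phi>))"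
  unfolding pd_function_def
proof (intro conjI ballI allI impI)
  have "family_norm J h \<one>\<^bsub>Mc\<^esub> = 0"
    unfolding family_norm_def by (simp add: Mc_simps h_CK)
  then show "exp (- family_norm J h \<one>\<^bsub>Mc\<^esub>) = 1" by simp
  show "exp (- family_norm J h (inv\<^bsub>Mc\<^esub> \<phi>)) = exp (- family_norm J h \<phi>)" if "\<phi> \<in> carrier Mc" for \<phi>
    using that unfolding family_norm_def by (simp add: Mc_simps Mc_inv h_CK)
  fix S :: "(('k \<Rightarrow> real) \<Rightarrow> real) set" and c assume S: "finite S" "S \<subseteq> carrier Mc"
  have eq: "family_norm J h (\<phi> \<otimes>\<^bsub>Mc\<^esub> inv\<^bsub>Mc\<^esub> \<psi>) = suminf (\<lambda>m. \<Sum>j\<in>J m. \<bar>\<phi> (h m j) - \<psi> (h m j)\<bar>)"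
    if "\<phi> \<in> S" "\<psi> \<in> S" for \<phi> \<psi>
  proof -
    have "\<phi> \<in> dualK" "\<psi> \<in> dualK" using that S by (auto simp: Mc_simps)
    then show ?thesis unfolding family_norm_def by (simp add: Mc_diff h_CK)
  qed
  have "psd_on S (\<lambda>\<phi> \<psi>. exp (- suminf (\<lambda>m. \<Sum>j\<in>J m. \<bar>\<phi> (h m j) - \<psi> (h m j)\<bar>)))"
  proof (rule psd_on_exp_suminf[OF S(1) fin_J])
    fix \<phi> \<psi> assume "\<phi> \<in> S" "\<psi> \<in> S"
    then have "\<phi> \<in> dualK" "\<psi> \<in> dualK" using S by (auto simp: Mc_simps)
    then show "summable (\<lambda>m. \<Sum>j\<in>J m. \<bar>\<phi> (h m j) - \<psi> (h m j)\<bar>)"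
      using summable_levels[OF Mc_diff_dual[of \<phi> \<psi>]] by (simp add: Mc_diff h_CK)
  qed
  then have "0 \<le> (\<Sum>\<phi>\<in>S. \<Sum>\<psi>\<in>S. c \<phi> * c \<psi> * exp (- suminf (\<lambda>m. \<Sum>j\<in>J m. \<bar>\<phi> (h m j) - \<psi> (h m j)\<bar>)))"
    unfolding psd_on_def by (rule spec)
  also have "\<dots> = (\<Sum>\<phi>\<in>S. \<Sum>\<psi>\<in>S. c \<phi> * c \<psi> * exp (- family_norm J h (\<phi> \<otimes>\<^bsub>Mc\<^esub> inv\<^bsub>Mc\<^esub> \<psi>)))"
    by (intro sum.cong refl) (simp only: eq)
  finally show "0 \<le> (\<Sum>\<phi>\<in>S. \<Sum>\<psi>\<in>S. c \<phi> * c \<psi> * exp (- family_norm J h (\<phi> \<otimes>\<^bsub>Mc\<^esub> inv\<^bsub>Mc\<^esub> \<psi>)))" .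
qed

lemma family_norm_nbhd:
  assumes \<phi>: "\<phi> \<in> dualK" and e: "e > 0"
  obtains V where "openin Mct V" "\<phi> \<in> V" "\<And>\<psi>. \<psi> \<in> V \<Longrightarrow> \<psi> \<in> dualK"
    "\<And>\<psi>. \<psi> \<in> V \<Longrightarrow> family_norm J h (\<psi> \<otimes>\<^bsub>Mc\<^esub> inv\<^bsub>Mc\<^esub> \<phi>) < e"
proof -
  obtain A d where A: "compactin C.mtopology A" "d > 0"
    "\<And>\<phi>. \<phi> \<in> dualK \<Longrightarrow> (\<And>f. f \<in> A \<Longrightarrow> \<bar>\<phi> f\<bar> < d) \<Longrightarrow> family_norm J h \<phi> < e"
    using family_norm_small[OF e] by blast
  have AC: "A \<subseteq> CK" using compactin_subset_topspace[OF A(1)] by simp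
  have "family_norm J h (\<psi> \<otimes>\<^bsub>Mc\<^esub> inv\<^bsub>Mc\<^esub> \<phi>) < e" if \<psi>: "\<psi> \<in> nbhd \<phi> A d" for \<psi>
  proof (rule A(3))
    have \<psi>d: "\<psi> \<in> dualK" using \<psi> by (simp add: nbhd_def)
    show "\<psi> \<otimes>\<^bsub>Mc\<^esub> inv\<^bsub>Mc\<^esub> \<phi> \<in> dualK" by (rule Mc_diff_dual[OF \<psi>d \<phi>])
    show "\<bar>(\<psi> \<otimes>\<^bsub>Mc\<^esub> inv\<^bsub>Mc\<^esub> \<phi>) f\<bar> < d" if f: "f \<in> A" for f
      unfolding Mc_diff[OF \<psi>d \<phi>] using subsetD[OF AC f] \<psi> f by (simp add: nbhd_def)
  qed
  then show ?thesis
    using that[OF openin_nbhd[OF \<phi> A(1,2)] nbhd_self[OF \<phi> A(2)]] by (auto simp: nbhd_def)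
qed

lemma continuous_at_shifts_family_norm: "continuous_at_shifts Mc Mct (\<lambda>\<phi>. exp (- family_norm J h \<phi>))"
  unfolding continuous_at_shifts_def
proof (intro ballI allI impI)
  fix \<phi> and e :: real assume "\<phi> \<in> carrier Mc" and e: "e > 0"
  then have \<phi>: "\<phi> \<in> dualK" by (simp add: Mc_simps)
  obtain V where V: "openin Mct V" "\<phi> \<in> V" "\<And>\<psi>. \<psi> \<in> V \<Longrightarrow> \<psi> \<in> dualK"
    "\<And>\<psi>. \<psi> \<in> V \<Longrightarrow> family_norm J h (\<psi> \<otimes>\<^bsub>Mc\<^esub> inv\<^bsub>Mc\<^esub> \<phi>) < e"
    using family_norm_nbhd[OF \<phi> e] by blast
  have "1 - e < exp (- family_norm J h (\<psi> \<otimes>\<^bsub>Mc\<^esub> inv\<^bsub>Mc\<^esub> \<phi>))" if "\<psi> \<in> V" for \<psi>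
    using exp_ge_add_one_self[of "- family_norm J h (\<psi> \<otimes>\<^bsub>Mc\<^esub> inv\<^bsub>Mc\<^esub> \<phi>)"] V(4)[OF that] by linarith
  with V show "\<exists>V. openin Mct V \<and> \<phi> \<in> V \<and> (\<forall>\<psi>\<in>V. 1 - e < exp (- family_norm J h (\<psi> \<otimes>\<^bsub>Mc\<^esub> inv\<^bsub>Mc\<^esub> \<phi>)))"
    by blast
qed

end

text \<open>Continuity at the diagonal; the triangle inequality propagates it to all points.\<close>
definition continuous_pseudometric :: "('k \<Rightarrow> 'k \<Rightarrow> real) \<Rightarrow> bool" where
  "continuous_pseudometric d \<longleftrightarrow>
     (\<forall>x\<in>topspace K. d x x = 0) \<and> (\<forall>x\<in>topspace K. \<forall>y\<in>topspace K. d x y = d y x) \<and>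
     (\<forall>x\<in>topspace K. \<forall>y\<in>topspace K. \<forall>z\<in>topspace K. d x z \<le> d x y + d y z) \<and>
     (\<forall>x\<in>topspace K. \<forall>e>0. \<exists>V. openin K V \<and> x \<in> V \<and> (\<forall>y\<in>V. d x y < e))"

definition partition_of_unity :: "('k \<Rightarrow> 'k \<Rightarrow> real) \<Rightarrow> real \<Rightarrow> 'k set \<Rightarrow> ('k \<Rightarrow> 'k \<Rightarrow> real) \<Rightarrow> bool" where
  "partition_of_unity d r I g \<longleftrightarrow> finite I \<and> I \<subseteq> topspace K \<and> (\<forall>y\<in>I. g y \<in> CK) \<and>
     (\<forall>y\<in>I. \<forall>x\<in>topspace K. 0 \<le> g y x \<and> (g y x \<noteq> 0 \<longrightarrow> d x y < r)) \<and>
     (\<forall>x\<in>topspace K. (\<Sum>y\<in>I. g y x) = 1)"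

lemma partition_of_unity_exists:
  assumes d: "continuous_pseudometric d" and r: "r > 0"
  shows "\<exists>I g. partition_of_unity d r I g"
proof -
  have d0: "\<And>x. x \<in> topspace K \<Longrightarrow> d x x = 0"
    and sym: "\<And>x y. x \<in> topspace K \<Longrightarrow> y \<in> topspace K \<Longrightarrow> d x y = d y x"
    and tri: "\<And>x y z. x \<in> topspace K \<Longrightarrow> y \<in> topspace K \<Longrightarrow> z \<in> topspace K \<Longrightarrow> d x z \<le> d x y + d y z"
    and cont: "\<And>x e. x \<in> topspace K \<Longrightarrow> e > 0 \<Longrightarrow> \<exists>V. openin K V \<and> x \<in> V \<and> (\<forall>y\<in>V. d x y < e)"
    using d by (auto simp: continuous_pseudometric_def)
  have cont_d: "continuous_map K euclideanreal (\<lambda>x. d x y)" if y: "y \<in> topspace K" for y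
  proof -
    have "continuous_map K Met_TC.mtopology (\<lambda>x. d x y)"
      unfolding Met_TC.continuous_map_to_metric
    proof (intro ballI allI impI)
      fix x and e :: real assume x: "x \<in> topspace K" and e: "e > 0"
      obtain V where V: "openin K V" "x \<in> V" "\<forall>y\<in>V. d x y < e" using cont[OF x e] by blast
      have "d z y \<in> Met_TC.mball (d x y) e" if z: "z \<in> V" for z
      proof -
        have zK: "z \<in> topspace K" using z openin_subset[OF V(1)] by blast
        have "d x y \<le> d x z + d z y" "d z y \<le> d x z + d x y" "d x z < e"
          using tri[OF x zK y] tri[OF zK x y] sym[OF zK x] V(3) z by auto
        then show ?thesis by (simp add: dist_real_def abs_less_iff)
      qed
      with V show "\<exists>U. openin K U \<and> x \<in> U \<and> (\<forall>z\<in>U. d z y \<in> Met_TC.mball (d x y) e)" by blast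
    qed
    then show ?thesis by simp
  qed
  have "\<forall>x\<in>topspace K. \<exists>V. openin K V \<and> x \<in> V \<and> (\<forall>y\<in>V. d x y < r)" using cont r by blast
  then obtain V where V: "\<And>x. x \<in> topspace K \<Longrightarrow> openin K (V x)" "\<And>x. x \<in> topspace K \<Longrightarrow> x \<in> V x"
    "\<And>x y. x \<in> topspace K \<Longrightarrow> y \<in> V x \<Longrightarrow> d x y < r" by metis
  have "compactin K (topspace K)" using compact_K by (simp add: compact_space_def)
  then have "\<exists>\<F>. finite \<F> \<and> \<F> \<subseteq> V ` topspace K \<and> topspace K \<subseteq> \<Union>\<F>"
  proof (rule compactinD)
    show "openin K U" if "U \<in> V ` topspace K" for U using that V(1) by (elim imageE) simp
    show "topspace K \<subseteq> \<Union>(V ` topspace K)" using V(2) by (intro subsetI UN_I)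
  qed
  then obtain \<F> where \<F>: "finite \<F>" "\<F> \<subseteq> V ` topspace K" "topspace K \<subseteq> \<Union>\<F>" by blast
  obtain I where I: "I \<subseteq> topspace K" "finite I" "\<F> = V ` I"
    using finite_subset_image[OF \<F>(1,2)] by blast
  define w where "w y x = max 0 (r - d x y)" for y x
  have w0: "0 \<le> w y x" for y x by (simp add: w_def)
  have pos: "(\<Sum>y\<in>I. w y x) > 0" if x: "x \<in> topspace K" for x
  proof -
    obtain y where y: "y \<in> I" "x \<in> V y" using \<F>(3) I x by auto
    then have "d x y < r" using V(3)[of y x] sym[of x y] x I by auto
    then have "0 < w y x" by (simp add: w_def)
    also have "w y x \<le> (\<Sum>y\<in>I. w y x)" by (rule member_le_sum) (use y I w0 in auto)
    finally show ?thesis .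
  qed
  have contw: "continuous_map K euclideanreal (\<lambda>x. w y x)" if "y \<in> topspace K" for y
    unfolding w_def using cont_d[OF that] by (intro continuous_intros)
  define g where "g y = (\<lambda>x\<in>topspace K. w y x / (\<Sum>z\<in>I. w z x))" for y
  have "partition_of_unity d r I g"
    unfolding partition_of_unity_def
  proof (intro conjI ballI impI)
    show "g y \<in> CK" if "y \<in> I" for y
      unfolding g_def
    proof (rule CK_restrict, rule continuous_map_real_divide)
      show "continuous_map K euclideanreal (w y)" using contw[of y] that I by auto
      show "continuous_map K euclideanreal (\<lambda>x. \<Sum>z\<in>I. w z x)"
        using I contw by (intro continuous_map_sum) auto
      show "(\<Sum>z\<in>I. w z x) \<noteq> 0" if "x \<in> topspace K" for x using pos[OF that] by simp
    qed
    fix x assume x: "x \<in> topspace K"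
    show "0 \<le> g y x" for y using pos[OF x] w0 x by (simp add: g_def)
    show "d x y < r" if "g y x \<noteq> 0" for y
      using that x by (auto simp: g_def w_def max_def split: if_splits)
    show "(\<Sum>y\<in>I. g y x) = 1"
      using pos[OF x] x by (simp add: g_def flip: sum_divide_distrib)
  qed (use I in auto)
  then show ?thesis by blast
qed

end

section \<open>The norm attached to a continuous pseudometric\<close>

locale pseudometric_K = compact_K +
  fixes d :: "'a \<Rightarrow> 'a \<Rightarrow> real" and M :: real
  assumes d: "continuous_pseudometric d" and M: "M \<ge> 0"
begin

text \<open>One partition of unity for each radius \<open>1 / 4\<^sup>m\<close>: the pair of its finite set \<open>I m\<close> of centres and its
  functions \<open>g m\<close>.\<close>
definition parts :: "nat \<Rightarrow> 'a set \<times> ('a \<Rightarrow> 'a \<Rightarrow> real)" where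
  "parts m = (SOME p. partition_of_unity d (1 / 4 ^ m) (fst p) (snd p))"

definition I :: "nat \<Rightarrow> 'a set" where "I m = fst (parts m)"
definition g :: "nat \<Rightarrow> 'a \<Rightarrow> 'a \<Rightarrow> real" where "g m = snd (parts m)"

lemma partition: "partition_of_unity d (1 / 4 ^ m) (I m) (g m)"
proof -
  have "\<exists>p. partition_of_unity d (1 / 4 ^ m) (fst p) (snd p)"
    using partition_of_unity_exists[OF d, of "1 / 4 ^ m"] by auto
  then show ?thesis unfolding I_def g_def parts_def by (rule someI_ex)
qed

lemma partitionD:
  "finite (I m)" "y \<in> I m \<Longrightarrow> y \<in> topspace K" "y \<in> I m \<Longrightarrow> g m y \<in> CK"
  "y \<in> I m \<Longrightarrow> x \<in> topspace K \<Longrightarrow> 0 \<le> g m y x"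
  "y \<in> I m \<Longrightarrow> x \<in> topspace K \<Longrightarrow> g m y x \<noteq> 0 \<Longrightarrow> d x y < 1 / 4 ^ m"
  "x \<in> topspace K \<Longrightarrow> (\<Sum>y\<in>I m. g m y x) = 1"
  using partition[of m] by (auto simp: partition_of_unity_def)

definition gg :: "nat \<Rightarrow> 'a \<times> 'a \<Rightarrow> 'a \<Rightarrow> real" where
  "gg m p = (\<lambda>x\<in>topspace K. 1 * g (Suc m) (fst p) x * g m (snd p) x)"

text \<open>The block 0 contains the functions of the coarsest partition, indexed by the diagonal so that all
  blocks have the same index type; the block \<open>m + 1\<close> contains the products of the partitions \<open>m\<close> and
  \<open>m + 1\<close>.  The weight \<open>2 / 4\<^sup>m\<close> bounds the distance of two centres whose functions are nonzero at a
  common point.\<close>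
fun J :: "nat \<Rightarrow> ('a \<times> 'a) set" where
  "J 0 = (\<lambda>y. (y, y)) ` I 0"
| "J (Suc m) = I (Suc m) \<times> I m"

fun h :: "nat \<Rightarrow> 'a \<times> 'a \<Rightarrow> 'a \<Rightarrow> real" where
  "h 0 p = (\<lambda>x\<in>topspace K. M * g 0 (fst p) x)"
| "h (Suc m) p = (\<lambda>x\<in>topspace K. 2 / 4 ^ m * gg m p x)"

lemma gg_CK: "p \<in> J (Suc m) \<Longrightarrow> gg m p \<in> CK"
  unfolding gg_def by (rule CK_mult) (auto intro: partitionD)

lemma geometric_J_h: "geometric_family J h"
  unfolding geometric_family_def
proof (intro conjI allI ballI exI[of _ "M + 8"] impI)
  show "0 \<le> M + 8" using M by simp
  show "finite (J m)" for m by (cases m) (auto simp: partitionD)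
  show "h m p \<in> CK" if "p \<in> J m" for m p
  proof (cases m)
    case 0
    then have "fst p \<in> I 0" using that by auto
    then show ?thesis unfolding 0 h.simps
      using CK_lin[OF partitionD(3) partitionD(3), of "fst p" 0 "fst p" 0 M 0] by simp
  next
    case (Suc n)
    then show ?thesis
      using that CK_lin[OF gg_CK gg_CK, of p n p n "2 / 4 ^ n" 0] by simp
  qed
  fix m x assume x: "x \<in> topspace K"
  show "(\<Sum>p\<in>J m. \<bar>h m p x\<bar>) \<le> (M + 8) / 4 ^ m"
  proof (cases m)
    case 0
    have "(\<Sum>p\<in>J 0. \<bar>h 0 p x\<bar>) = (\<Sum>y\<in>I 0. \<bar>h 0 (y, y) x\<bar>)"
      unfolding J.simps by (rule sum.reindex_cong[OF _ refl]) (auto simp: inj_on_def)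
    also have "\<dots> = (\<Sum>y\<in>I 0. M * g 0 y x)"
      using x M by (intro sum.cong) (auto simp: abs_mult partitionD)
    also have "\<dots> = M" using partitionD(6)[OF x, of 0] by (simp flip: sum_distrib_left)
    finally show ?thesis using 0 M by simp
  next
    case (Suc n)
    have "(\<Sum>p\<in>J (Suc n). \<bar>h (Suc n) p x\<bar>) = (\<Sum>p\<in>I (Suc n) \<times> I n. 2 / 4 ^ n * (g (Suc n) (fst p) x * g n (snd p) x))"
      using x by (intro sum.cong) (auto simp: gg_def abs_mult partitionD)
    also have "\<dots> = 2 / 4 ^ n * (\<Sum>y\<in>I (Suc n). \<Sum>z\<in>I n. g (Suc n) y x * g n z x)"
      by (simp add: sum.cartesian_product sum_distrib_left case_prod_unfold)
    also have "(\<Sum>y\<in>I (Suc n). \<Sum>z\<in>I n. g (Suc n) y x * g n z x) = 1"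
      using partitionD(6)[OF x] by (simp flip: sum_product)
    finally have "(\<Sum>p\<in>J (Suc n). \<bar>h (Suc n) p x\<bar>) = 8 / 4 ^ Suc n" by simp
    also have "\<dots> \<le> (M + 8) / 4 ^ Suc n" using M by (intro divide_right_mono) auto
    finally show ?thesis using Suc by simp
  qed
qed

abbreviation "N \<equiv> family_norm J h"

text \<open>The seminorm \<open>q\<close> is defined on a subspace \<open>V\<close> only, as the free vector space on \<open>K\<close> is a subspace of
  its type.\<close>
context
  fixes s :: "real \<Rightarrow> 'e::ab_group_add \<Rightarrow> 'e" and V :: "'e set" and q :: "'e \<Rightarrow> real" and v :: "'a \<Rightarrow> 'e"
  assumes vs: "vector_space s" and sub: "module.subspace s V"
    and q_add: "\<And>a b. a \<in> V \<Longrightarrow> b \<in> V \<Longrightarrow> q (a + b) \<le> q a + q b"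
    and q_scale: "\<And>a c. a \<in> V \<Longrightarrow> q (s c a) = \<bar>c\<bar> * q a"
    and v: "\<And>x. x \<in> topspace K \<Longrightarrow> v x \<in> V"
    and v_diff: "\<And>x y. x \<in> topspace K \<Longrightarrow> y \<in> topspace K \<Longrightarrow> q (v x - v y) \<le> d x y"
    and v_bound: "\<And>x. x \<in> topspace K \<Longrightarrow> q (v x) \<le> M"
begin

interpretation vector_space s by (rule vs)

lemma q_sum:
  assumes "finite T" "\<And>i. i \<in> T \<Longrightarrow> w i \<in> V"
  shows "q (\<Sum>i\<in>T. s (c i) (w i)) \<le> (\<Sum>i\<in>T. \<bar>c i\<bar> * q (w i))"
  using assms
proof (induction T rule: finite_induct)
  case empty
  have "q (s 0 0) = \<bar>0\<bar> * q 0" by (rule q_scale) (rule subspace_0[OF sub])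
  then show ?case by simp
next
  case (insert i T)
  have "(\<Sum>i\<in>T. s (c i) (w i)) \<in> V" using insert.prems by (intro subspace_sum[OF sub] subspace_scale[OF sub]) auto
  then have "q (s (c i) (w i) + (\<Sum>i\<in>T. s (c i) (w i))) \<le> q (s (c i) (w i)) + q (\<Sum>i\<in>T. s (c i) (w i))"
    using insert.prems by (intro q_add subspace_scale[OF sub]) auto
  also have "q (s (c i) (w i)) = \<bar>c i\<bar> * q (w i)" using insert.prems by (intro q_scale) auto
  also have "q (\<Sum>i\<in>T. s (c i) (w i)) \<le> (\<Sum>i\<in>T. \<bar>c i\<bar> * q (w i))" using insert.prems by (intro insert.IH) auto
  finally show ?case using insert.hyps by simp
qed

text \<open>A Riemann sum for the integral of \<open>v\<close> against \<open>\<phi>\<close>.\<close>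
definition smoothing :: "(('a \<Rightarrow> real) \<Rightarrow> real) \<Rightarrow> nat \<Rightarrow> 'e" where
  "smoothing \<phi> m = (\<Sum>y\<in>I m. s (\<phi> (g m y)) (v y))"

lemma smoothing_V: "smoothing \<phi> m \<in> V"
  unfolding smoothing_def using v partitionD(2) by (intro subspace_sum[OF sub] subspace_scale[OF sub]) auto

text \<open>Both sums are refined to sums over pairs of centres, since each partition sums to 1; then the
  values of \<open>v\<close> are compared at centres that are close or belong to a vanishing product.\<close>
lemma smoothing_step:
  assumes \<phi>: "\<phi> \<in> dualK"
  shows "q (smoothing \<phi> (Suc m) - smoothing \<phi> m) \<le> (\<Sum>p\<in>J (Suc m). \<bar>\<phi> (h (Suc m) p)\<bar>)"
proof -
  have gg_split: "\<phi> (g (Suc m) y) = (\<Sum>z\<in>I m. \<phi> (gg m (y, z)))" if y: "y \<in> I (Suc m)" for y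
  proof -
    have "g (Suc m) y = (\<lambda>x\<in>topspace K. \<Sum>z\<in>I m. 1 * gg m (y, z) x)"
    proof (rule CK_eqI)
      show "g (Suc m) y \<in> CK" using y by (rule partitionD)
      show "(\<lambda>x\<in>topspace K. \<Sum>z\<in>I m. 1 * gg m (y, z) x) \<in> CK"
        by (rule CK_sum) (use y in \<open>auto simp: partitionD intro!: gg_CK\<close>)
      show "g (Suc m) y x = (\<lambda>x\<in>topspace K. \<Sum>z\<in>I m. 1 * gg m (y, z) x) x" if "x \<in> topspace K" for x
        using that partitionD(6)[OF that, of m] by (simp add: gg_def flip: sum_distrib_left)
    qed
    then have "\<phi> (g (Suc m) y) = (\<Sum>z\<in>I m. 1 * \<phi> (gg m (y, z)))"
      by (metis (no_types, lifting) dual_sum[OF \<phi> partitionD(1)[of m], of "\<lambda>z. gg m (y, z)" "\<lambda>_. 1"] gg_CK J.simps(2) mem_Sigma_iff y)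
    then show ?thesis by simp
  qed
  have gg_split': "\<phi> (g m z) = (\<Sum>y\<in>I (Suc m). \<phi> (gg m (y, z)))" if z: "z \<in> I m" for z
  proof -
    have "g m z = (\<lambda>x\<in>topspace K. \<Sum>y\<in>I (Suc m). 1 * gg m (y, z) x)"
    proof (rule CK_eqI)
      show "g m z \<in> CK" using z by (rule partitionD)
      show "(\<lambda>x\<in>topspace K. \<Sum>y\<in>I (Suc m). 1 * gg m (y, z) x) \<in> CK"
        by (rule CK_sum) (use z in \<open>auto simp: partitionD intro!: gg_CK\<close>)
      show "g m z x = (\<lambda>x\<in>topspace K. \<Sum>y\<in>I (Suc m). 1 * gg m (y, z) x) x" if "x \<in> topspace K" for x
        using that partitionD(6)[OF that, of "Suc m"] by (simp add: gg_def flip: sum_distrib_right)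
    qed
    then have "\<phi> (g m z) = (\<Sum>y\<in>I (Suc m). 1 * \<phi> (gg m (y, z)))"
      by (metis (no_types, lifting) dual_sum[OF \<phi> partitionD(1)[of "Suc m"], of "\<lambda>y. gg m (y, z)" "\<lambda>_. 1"] gg_CK J.simps(2) mem_Sigma_iff z)
    then show ?thesis by simp
  qed
  have "smoothing \<phi> (Suc m) = (\<Sum>y\<in>I (Suc m). \<Sum>z\<in>I m. s (\<phi> (gg m (y, z))) (v y))"
    unfolding smoothing_def by (intro sum.cong refl) (simp only: gg_split scale_sum_left)
  moreover have "smoothing \<phi> m = (\<Sum>y\<in>I (Suc m). \<Sum>z\<in>I m. s (\<phi> (gg m (y, z))) (v z))"
    unfolding smoothing_def
    by (subst sum.swap) (intro sum.cong refl, simp only: gg_split' scale_sum_left)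
  ultimately have "smoothing \<phi> (Suc m) - smoothing \<phi> m
      = (\<Sum>y\<in>I (Suc m). \<Sum>z\<in>I m. s (\<phi> (gg m (y, z))) (v y - v z))"
    by (simp add: scale_right_diff_distrib sum_subtractf)
  also have "\<dots> = (\<Sum>p\<in>J (Suc m). s (\<phi> (gg m p)) (v (fst p) - v (snd p)))"
    by (simp add: sum.cartesian_product case_prod_unfold)
  finally have eq: "smoothing \<phi> (Suc m) - smoothing \<phi> m = \<dots>" .
  have "q (smoothing \<phi> (Suc m) - smoothing \<phi> m) \<le> (\<Sum>p\<in>J (Suc m). \<bar>\<phi> (gg m p)\<bar> * q (v (fst p) - v (snd p)))"
    unfolding eq by (rule q_sum) (auto simp: partitionD intro!: subspace_diff[OF sub] v)
  also have "\<dots> \<le> (\<Sum>p\<in>J (Suc m). \<bar>\<phi> (h (Suc m) p)\<bar>)"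
  proof (rule sum_mono)
    fix p assume p: "p \<in> J (Suc m)"
    obtain y z where yz: "p = (y, z)" "y \<in> I (Suc m)" "z \<in> I m" using p by auto
    have yzK: "y \<in> topspace K" "z \<in> topspace K" using yz partitionD(2) by auto
    have "\<phi> (h (Suc m) p) = 2 / 4 ^ m * \<phi> (gg m p)"
      unfolding h.simps by (rule dual_scale[OF \<phi> gg_CK[OF p]])
    then have hp: "\<bar>\<phi> (h (Suc m) p)\<bar> = \<bar>\<phi> (gg m p)\<bar> * (2 / 4 ^ m)" by (simp add: abs_mult)
    show "\<bar>\<phi> (gg m p)\<bar> * q (v (fst p) - v (snd p)) \<le> \<bar>\<phi> (h (Suc m) p)\<bar>"
    proof (cases "\<exists>x\<in>topspace K. gg m p x \<noteq> 0")
      case True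
      then obtain x where x: "x \<in> topspace K" "g (Suc m) y x \<noteq> 0" "g m z x \<noteq> 0"
        by (auto simp: gg_def yz)
      have "d x y < 1 / 4 ^ Suc m" "d x z < 1 / 4 ^ m"
        using partitionD(5) x yz by blast+
      moreover have "(1::real) / 4 ^ Suc m \<le> 1 / 4 ^ m" by (simp add: field_simps)
      moreover have "d y z \<le> d x y + d x z"
        using d x yzK unfolding continuous_pseudometric_def by metis
      moreover have "(2::real) / 4 ^ m = 1 / 4 ^ m + 1 / 4 ^ m" by simp
      ultimately have "q (v y - v z) \<le> 2 / 4 ^ m" using v_diff[OF yzK] by linarith
      then show ?thesis unfolding hp using yz by (intro mult_left_mono) auto
    next
      case False
      have "gg m p = (\<lambda>x\<in>topspace K. 0)"
        by (rule CK_eqI[OF gg_CK[OF p] CK_const]) (use False in auto)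
      then show ?thesis using dual_zero[OF \<phi>] by simp
    qed
  qed
  finally show ?thesis .
qed

lemma smoothing_le:
  assumes \<phi>: "\<phi> \<in> dualK"
  shows "q (smoothing \<phi> m) \<le> (\<Sum>n\<le>m. \<Sum>p\<in>J n. \<bar>\<phi> (h n p)\<bar>)"
proof (induction m)
  case 0
  have "q (smoothing \<phi> 0) \<le> (\<Sum>y\<in>I 0. \<bar>\<phi> (g 0 y)\<bar> * q (v y))"
    unfolding smoothing_def by (rule q_sum) (auto simp: partitionD intro!: v)
  also have "\<dots> \<le> (\<Sum>y\<in>I 0. \<bar>\<phi> (h 0 (y, y))\<bar>)"
  proof (rule sum_mono)
    fix y assume y: "y \<in> I 0"
    have "\<phi> (h 0 (y, y)) = M * \<phi> (g 0 y)"
      unfolding h.simps fst_conv by (rule dual_scale[OF \<phi> partitionD(3)[OF y]])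
    then have "\<bar>\<phi> (h 0 (y, y))\<bar> = \<bar>\<phi> (g 0 y)\<bar> * M" using M by (simp add: abs_mult)
    moreover have "\<bar>\<phi> (g 0 y)\<bar> * q (v y) \<le> \<bar>\<phi> (g 0 y)\<bar> * M"
      by (intro mult_left_mono v_bound partitionD(2)[OF y]) simp
    ultimately show "\<bar>\<phi> (g 0 y)\<bar> * q (v y) \<le> \<bar>\<phi> (h 0 (y, y))\<bar>" by simp
  qed
  also have "\<dots> = (\<Sum>p\<in>J 0. \<bar>\<phi> (h 0 p)\<bar>)"
    unfolding J.simps by (subst sum.reindex) (auto simp: inj_on_def)
  finally show ?case by (simp only: atMost_0 sum.insert[OF finite.emptyI] empty_iff not_False_eq_True sum.empty add_0_right)
next
  case (Suc m)
  have "smoothing \<phi> (Suc m) = smoothing \<phi> m + (smoothing \<phi> (Suc m) - smoothing \<phi> m)" by simp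
  then have "q (smoothing \<phi> (Suc m)) \<le> q (smoothing \<phi> m) + q (smoothing \<phi> (Suc m) - smoothing \<phi> m)"
    using q_add[OF smoothing_V subspace_diff[OF sub smoothing_V smoothing_V]] by metis
  then show ?case using Suc smoothing_step[OF \<phi>, of m] by (simp del: J.simps h.simps)
qed

text \<open>Telescoping of the previous estimate.\<close>
lemma dominated:
  assumes \<phi>: "\<phi> \<in> dualK" and \<Phi>: "\<Phi> \<in> V"
    and lim: "(\<lambda>m. q (smoothing \<phi> m - \<Phi>)) \<longlonglongrightarrow> 0"
  shows "q \<Phi> \<le> N \<phi>"
proof (rule LIMSEQ_le_const[where X = "\<lambda>m. q (smoothing \<phi> m - \<Phi>) + N \<phi>"])
  show "(\<lambda>m. q (smoothing \<phi> m - \<Phi>) + N \<phi>) \<longlonglongrightarrow> N \<phi>"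
    using tendsto_add[OF lim tendsto_const, of "N \<phi>"] by simp
  show "\<exists>n0. \<forall>m\<ge>n0. q \<Phi> \<le> q (smoothing \<phi> m - \<Phi>) + N \<phi>"
  proof (intro exI[of _ 0] allI impI)
    fix m
    have D: "smoothing \<phi> m - \<Phi> \<in> V" by (rule subspace_diff[OF sub smoothing_V \<Phi>])
    have "\<Phi> = s (-1) (smoothing \<phi> m - \<Phi>) + smoothing \<phi> m" by simp
    then have "q \<Phi> \<le> q (s (-1) (smoothing \<phi> m - \<Phi>)) + q (smoothing \<phi> m)"
      using q_add[OF subspace_scale[OF sub D] smoothing_V] by metis
    also have "q (s (-1) (smoothing \<phi> m - \<Phi>)) = q (smoothing \<phi> m - \<Phi>)"
      using q_scale[OF D, of "-1"] by simp
    also have "q (smoothing \<phi> m) \<le> (\<Sum>n\<le>m. \<Sum>p\<in>J n. \<bar>\<phi> (h n p)\<bar>)" by (rule smoothing_le[OF \<phi>])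
    also have "\<dots> \<le> N \<phi>"
      unfolding family_norm_def
      by (intro sum_le_suminf summable_levels[OF geometric_J_h \<phi>] ballI sum_nonneg) auto
    finally show "q \<Phi> \<le> q (smoothing \<phi> m - \<Phi>) + N \<phi>" by simp
  qed
qed

end

text \<open>Here the Riemann sums converge to \<open>\<phi> f\<close> because the functions \<open>(\<Sum>y. f y * g m y x)\<close> converge
  uniformly to \<open>f\<close>.\<close>
lemma Lipschitz_dominated:
  assumes \<phi>: "\<phi> \<in> dualK" and f: "f \<in> CK"
    and Lip: "\<And>x y. x \<in> topspace K \<Longrightarrow> y \<in> topspace K \<Longrightarrow> \<bar>f x - f y\<bar> \<le> d x y"
    and bd: "\<And>x. x \<in> topspace K \<Longrightarrow> \<bar>f x\<bar> \<le> M"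
  shows "\<bar>\<phi> f\<bar> \<le> N \<phi>"
proof -
  have "module.subspace ((*) :: real \<Rightarrow> real \<Rightarrow> real) UNIV" by (rule vector_space_over_itself.subspace_UNIV)
  note facts = vector_space_over_itself.vector_space_axioms this abs_triangle_ineq abs_mult _ Lip bd
  obtain B where B: "B \<ge> 0" "\<And>f r. f \<in> CK \<Longrightarrow> 0 \<le> r \<Longrightarrow> (\<And>x. x \<in> topspace K \<Longrightarrow> \<bar>f x\<bar> \<le> r) \<Longrightarrow> \<bar>\<phi> f\<bar> \<le> B * r"
    using dual_bounded[OF \<phi>] by blast
  have le: "\<bar>(\<Sum>y\<in>I m. \<phi> (g m y) * f y) - \<phi> f\<bar> \<le> B * (1 / 4 ^ m)" for m
  proof -
    let ?P = "\<lambda>x\<in>topspace K. \<Sum>y\<in>I m. f y * g m y x"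
    have P: "?P \<in> CK" by (rule CK_sum) (auto simp: partitionD)
    have "(\<Sum>y\<in>I m. \<phi> (g m y) * f y) = \<phi> ?P"
      by (subst dual_sum[OF \<phi> partitionD(1,3)]) (auto simp: mult.commute)
    then have "(\<Sum>y\<in>I m. \<phi> (g m y) * f y) - \<phi> f = \<phi> (\<lambda>x\<in>topspace K. 1 * ?P x + (-1) * f x)"
      by (simp only: dual_lin[OF \<phi> P f])
    also have "\<bar>\<dots>\<bar> \<le> B * (1 / 4 ^ m)"
    proof (rule B(2)[OF CK_lin[OF P f]])
      fix x assume x: "x \<in> topspace K"
      have "(\<lambda>x\<in>topspace K. 1 * ?P x + (-1) * f x) x = (\<Sum>y\<in>I m. f y * g m y x) - f x * (\<Sum>y\<in>I m. g m y x)"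
        using x partitionD(6)[OF x, of m] by simp
      also have "\<dots> = (\<Sum>y\<in>I m. (f y - f x) * g m y x)"
        by (simp add: left_diff_distrib sum_subtractf sum_distrib_left)
      also have "\<bar>\<dots>\<bar> \<le> (\<Sum>y\<in>I m. 1 / 4 ^ m * g m y x)"
      proof (rule order_trans[OF sum_abs sum_mono])
        fix y assume y: "y \<in> I m"
        note yK = partitionD(2)[OF y] and nn = partitionD(4)[OF y x]
        show "\<bar>(f y - f x) * g m y x\<bar> \<le> 1 / 4 ^ m * g m y x"
        proof (cases "g m y x = 0")
          case False
          have "\<bar>f y - f x\<bar> \<le> 1 / 4 ^ m"
            using partitionD(5)[OF y x False] Lip[OF x yK] by (simp add: abs_minus_commute)
          then have "\<bar>f y - f x\<bar> * g m y x \<le> 1 / 4 ^ m * g m y x" using nn by (rule mult_right_mono)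
          then show ?thesis using nn by (simp only: abs_mult abs_of_nonneg)
        qed simp
      qed
      also have "\<dots> = 1 / 4 ^ m" using partitionD(6)[OF x, of m] by (simp flip: sum_distrib_left sum_divide_distrib)
      finally show "\<bar>(\<lambda>x\<in>topspace K. 1 * ?P x + (-1) * f x) x\<bar> \<le> 1 / 4 ^ m" .
    qed simp
    finally show ?thesis .
  qed
  have "(\<lambda>m. B * (1 / 4) ^ m) \<longlonglongrightarrow> B * 0"
    by (intro tendsto_mult_left LIMSEQ_power_zero) simp
  then have z: "(\<lambda>m. B * (1 / 4 ^ m)) \<longlonglongrightarrow> 0" by (simp add: power_divide)
  have "(\<lambda>m. \<bar>(\<Sum>y\<in>I m. \<phi> (g m y) * f y) - \<phi> f\<bar>) \<longlonglongrightarrow> 0"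
    by (rule tendsto_sandwich[OF _ _ tendsto_const z]) (use le in auto)
  then show ?thesis
    using dominated[OF facts \<phi>, of "\<phi> f"] smoothing_def[OF facts] by simp
qed

end

context compact_K
begin

text \<open>A compact set \<open>A\<close> in \<open>C(K)\<close> is bounded and equicontinuous, so it consists of functions that are 1-Lipschitz
  for the pseudometric \<open>sup\<^bsub>f \<in> A\<^esub> \<bar>f x - f y\<bar>\<close>.  The norm of that pseudometric dominates evaluation at
  every \<open>f\<close> in \<open>A\<close>.\<close>
theorem Mc_pd_separated: "pd_separated Mc Mct"
  unfolding pd_separated_def
proof (intro allI impI, elim conjE)
  fix W \<phi> assume W: "openin Mct W" "\<phi> \<in> W"
  have \<phi>: "\<phi> \<in> dualK" using W openin_subset Mc_topspace by blast
  obtain A e where A: "compactin C.mtopology A" and e: "e > 0" and AW: "nbhd \<phi> A e \<subseteq> W"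
    using openin_Mc_nbhd[OF W] by blast
  obtain B where B: "B > 0" "\<And>f x. f \<in> A \<Longrightarrow> x \<in> topspace K \<Longrightarrow> \<bar>f x\<bar> \<le> B"
    using compactin_bounded[OF A] by blast
  have AC: "A \<subseteq> CK" using compactin_subset_topspace[OF A] by simp
  \<comment> \<open>the zero function is added to have a nonempty index set\<close>
  define d where "d x y = (SUP f\<in>insert (\<lambda>_. 0) A. \<bar>f x - f y\<bar>)" for x y
  have bdd: "bdd_above ((\<lambda>f. \<bar>f x - f y\<bar>) ` insert (\<lambda>_. 0) A)" if "x \<in> topspace K" "y \<in> topspace K" for x y
  proof (rule bdd_aboveI2[where M = "2 * B"])
    fix f assume "f \<in> insert (\<lambda>_. 0) A"
    then show "\<bar>f x - f y\<bar> \<le> 2 * B"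
      using B(1) B(2)[of f x] B(2)[of f y] that by (cases "f \<in> A") auto
  qed
  have upper: "\<bar>f x - f y\<bar> \<le> d x y" if "f \<in> A" "x \<in> topspace K" "y \<in> topspace K" for f x y
    unfolding d_def by (rule cSUP_upper[OF _ bdd]) (use that in auto)
  have least: "d x y \<le> r" if "0 \<le> r" "\<And>f. f \<in> A \<Longrightarrow> \<bar>f x - f y\<bar> \<le> r" for x y r
    unfolding d_def by (rule cSUP_least) (use that in auto)
  have nonneg: "0 \<le> d x y" if "x \<in> topspace K" "y \<in> topspace K" for x y
    unfolding d_def using cSUP_upper[OF insertI1 bdd[OF that]] by simp
  have pm: "continuous_pseudometric d"
    unfolding continuous_pseudometric_def
  proof (intro conjI ballI allI impI)
    show "d x x = 0" if "x \<in> topspace K" for x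
      using least[of 0 x x] nonneg[OF that that] by (intro antisym) auto
    show "d x y = d y x" for x y unfolding d_def by (simp add: abs_minus_commute)
    show "d x z \<le> d x y + d y z" if xyz: "x \<in> topspace K" "y \<in> topspace K" "z \<in> topspace K" for x y z
    proof (rule least)
      show "0 \<le> d x y + d y z" using nonneg xyz by (intro add_nonneg_nonneg)
      show "\<bar>f x - f z\<bar> \<le> d x y + d y z" if "f \<in> A" for f
        using upper[OF that xyz(1,2)] upper[OF that xyz(2,3)] by linarith
    qed
    fix x and r :: real assume x: "x \<in> topspace K" and r: "r > 0"
    obtain V where V: "openin K V" "x \<in> V" "\<forall>y\<in>V. \<forall>f\<in>A. \<bar>f x - f y\<bar> < r / 2"
      using compactin_equicontinuous[OF A x, of "r / 2"] r by auto
    have "d x y < r" if "y \<in> V" for y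
    proof -
      have "d x y \<le> r / 2" by (rule least) (use V(3) that r in \<open>auto intro: less_imp_le\<close>)
      then show ?thesis using r by simp
    qed
    with V show "\<exists>V. openin K V \<and> x \<in> V \<and> (\<forall>y\<in>V. d x y < r)" by blast
  qed
  interpret P: pseudometric_K K d B by unfold_locales (use pm B in auto)
  \<comment> \<open>the threshold 1 - exp (- e) for the positive definite function amounts to N < e\<close>
  have "\<psi> \<in> W" if \<psi>: "\<psi> \<in> carrier Mc" "1 - (1 - exp (- e)) < exp (- P.N (\<psi> \<otimes>\<^bsub>Mc\<^esub> inv\<^bsub>Mc\<^esub> \<phi>))" for \<psi>
  proof -
    have \<psi>d: "\<psi> \<in> dualK" using \<psi> by (simp add: Mc_simps)
    have N: "P.N (\<psi> \<otimes>\<^bsub>Mc\<^esub> inv\<^bsub>Mc\<^esub> \<phi>) < e" using \<psi>(2) by simp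
    have "\<bar>\<psi> f - \<phi> f\<bar> < e" if f: "f \<in> A" for f
    proof -
      have fC: "f \<in> CK" using f AC by blast
      have "\<bar>(\<psi> \<otimes>\<^bsub>Mc\<^esub> inv\<^bsub>Mc\<^esub> \<phi>) f\<bar> \<le> P.N (\<psi> \<otimes>\<^bsub>Mc\<^esub> inv\<^bsub>Mc\<^esub> \<phi>)"
        by (rule P.Lipschitz_dominated[OF Mc_diff_dual[OF P.geometric_J_h \<psi>d \<phi>] fC]) (use upper B f in auto)
      then show ?thesis using N fC by (simp add: Mc_diff[OF P.geometric_J_h \<psi>d \<phi>])
    qed
    then show ?thesis using AW \<psi>d by (auto simp: nbhd_def)
  qed
  moreover have "1 - exp (- e) > 0" using e by simp
  ultimately show "\<exists>p. pd_function Mc p \<and> continuous_at_shifts Mc Mct p \<and>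
       (\<exists>e>0. \<forall>\<psi>\<in>carrier Mc. p (\<psi> \<otimes>\<^bsub>Mc\<^esub> inv\<^bsub>Mc\<^esub> \<phi>) > 1 - e \<longrightarrow> \<psi> \<in> W)"
    using pd_function_family_norm[OF P.geometric_J_h] continuous_at_shifts_family_norm[OF P.geometric_J_h]
    by blast
qed

end

section \<open>Groups with a pulled back topology\<close>

lemma topological_abelian_group_pullback:
  assumes G: "comm_group G" and h: "h \<in> hom G H" and inj: "inj_on h (carrier G)"
    and H: "topological_abelian_group H T"
  shows "topological_abelian_group G (pullback_topology (carrier G) h T)"
proof -
  let ?S = "pullback_topology (carrier G) h T"
  have Hc: "comm_group H" "topspace T = carrier H" "Hausdorff_space T"
    "continuous_map (prod_topology T T) T (\<lambda>(x, y). x \<otimes>\<^bsub>H\<^esub> y)"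
    "continuous_map T T (\<lambda>x. inv\<^bsub>H\<^esub> x)"
    using H by (auto simp: topological_abelian_group_def)
  interpret group_hom G H h
    using h comm_group.axioms(2)[OF G] comm_group.axioms(2)[OF Hc(1)]
    by (simp add: group_hom_def group_hom_axioms_def)
  have top: "topspace ?S = carrier G"
    using hom_closed Hc(2) by (auto simp: topspace_pullback_topology)
  have hc: "continuous_map ?S T h"
    using continuous_map_pullback[OF continuous_map_id, of "carrier G" h] by simp
  have into: "continuous_map X ?S f" if "continuous_map X T (\<lambda>x. h (f x))" "f ` topspace X \<subseteq> carrier G"
    for X :: "('a \<times> 'a) topology" and f
    using that by (intro continuous_map_pullback') (auto simp: comp_def)
  have "continuous_map (prod_topology ?S ?S) ?S (\<lambda>(x, y). x \<otimes>\<^bsub>G\<^esub> y)"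
  proof (rule into)
    have "continuous_map (prod_topology ?S ?S) (prod_topology T T) (\<lambda>p. (h (fst p), h (snd p)))"
      by (intro continuous_map_pairedI continuous_map_compose[OF continuous_map_fst hc, unfolded comp_def]
          continuous_map_compose[OF continuous_map_snd hc, unfolded comp_def])
    from continuous_map_compose[OF this Hc(4)]
    show "continuous_map (prod_topology ?S ?S) T (\<lambda>p. h (case p of (x, y) \<Rightarrow> x \<otimes>\<^bsub>G\<^esub> y))"
      by (rule continuous_map_eq) (auto simp: top)
    show "(\<lambda>(x, y). x \<otimes>\<^bsub>G\<^esub> y) ` topspace (prod_topology ?S ?S) \<subseteq> carrier G"
      by (auto simp: top)
  qed
  moreover have "continuous_map ?S ?S (\<lambda>x. inv\<^bsub>G\<^esub> x)"
  proof (rule continuous_map_pullback')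
    have "continuous_map ?S T (\<lambda>x. inv\<^bsub>H\<^esub> (h x))"
      using continuous_map_compose[OF hc Hc(5)] by (simp add: comp_def)
    then show "continuous_map ?S T (h \<circ> (\<lambda>x. inv\<^bsub>G\<^esub> x))"
      by (rule continuous_map_eq) (auto simp: top)
    show "topspace ?S \<subseteq> (\<lambda>x. inv\<^bsub>G\<^esub> x) -` carrier G" by (auto simp: top)
  qed
  moreover have "Hausdorff_space ?S"
    by (rule Hausdorff_space_injective_preimage[OF Hc(3) hc]) (simp add: top inj)
  ultimately show ?thesis
    using G top by (simp add: topological_abelian_group_def)
qed

lemma topological_abelian_group_continuous_mult:
  assumes "topological_abelian_group G T" "continuous_map X T f" "continuous_map X T g"
  shows "continuous_map X T (\<lambda>x. f x \<otimes>\<^bsub>G\<^esub> g x)"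
proof -
  have "continuous_map X (prod_topology T T) (\<lambda>x. (f x, g x))"
    using assms by (intro continuous_map_pairedI)
  from continuous_map_compose[OF this, of T "\<lambda>(x, y). x \<otimes>\<^bsub>G\<^esub> y"] assms(1)
  show ?thesis by (simp add: topological_abelian_group_def comp_def)
qed

lemma topological_abelian_group_continuous_inv:
  assumes "topological_abelian_group G T" "continuous_map X T f"
  shows "continuous_map X T (\<lambda>x. inv\<^bsub>G\<^esub> (f x))"
  using continuous_map_compose[OF assms(2), of T "\<lambda>x. inv\<^bsub>G\<^esub> x"] assms(1)
  by (simp add: topological_abelian_group_def comp_def)

text \<open>The witness is the Minkowski functional \<open>Inf {t. t > 0 \<and> s (1 / t) a \<in> W}\<close>.  Convexity of \<open>W\<close> makes it
  subadditive and symmetry makes it absolutely homogeneous.\<close>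
lemma gauge_exists:
  fixes s :: "real \<Rightarrow> 'e::ab_group_add \<Rightarrow> 'e"
  assumes vs: "vector_space s" and sub: "module.subspace s V"
    and W0: "0 \<in> W" and sym: "\<And>a. a \<in> W \<Longrightarrow> - a \<in> W"
    and conv: "\<And>a b t. a \<in> W \<Longrightarrow> b \<in> W \<Longrightarrow> t \<in> {0..1} \<Longrightarrow> s (1 - t) a + s t b \<in> W"
    and absorb: "\<And>a. a \<in> V \<Longrightarrow> \<exists>t>0. s (1 / t) a \<in> W"
  obtains q :: "'e \<Rightarrow> real" where
    "\<And>a b. a \<in> V \<Longrightarrow> b \<in> V \<Longrightarrow> q (a + b) \<le> q a + q b"
    "\<And>a c. a \<in> V \<Longrightarrow> q (s c a) = \<bar>c\<bar> * q a"
    "\<And>a. a \<in> V \<Longrightarrow> q a < 1 \<Longrightarrow> a \<in> W"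
    "\<And>a. a \<in> W \<Longrightarrow> q a \<le> 1"
proof -
  interpret vector_space s by (rule vs)
  define T where "T a = {t. t > 0 \<and> s (1 / t) a \<in> W}" for a
  define q where "q a = Inf (T a)" for a
  have T_ne: "T a \<noteq> {}" if "a \<in> V" for a using absorb[OF that] by (auto simp: T_def)
  have bdd: "bdd_below (T a)" for a by (rule bdd_belowI[of _ 0]) (auto simp: T_def)
  have q_le: "q a \<le> t" if "t \<in> T a" for a t unfolding q_def by (rule cInf_lower[OF that bdd])
  have q_less: "\<exists>t\<in>T a. t < r" if "a \<in> V" "q a < r" for a r
    using that cInf_less_iff[OF T_ne bdd] by (auto simp: q_def)
  have le_q: "r \<le> q a" if "a \<in> V" "\<And>t. t \<in> T a \<Longrightarrow> r \<le> t" for a r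
    unfolding q_def by (rule cInf_greatest[OF T_ne[OF that(1)] that(2)])
  have q_nonneg: "0 \<le> q a" if "a \<in> V" for a
    by (rule le_q[OF that]) (auto simp: T_def)
  have T_add: "t + u \<in> T (a + b)" if "t \<in> T a" "u \<in> T b" for t u a b
  proof -
    have tu: "t > 0" "u > 0" "s (1 / t) a \<in> W" "s (1 / u) b \<in> W" using that by (auto simp: T_def)
    have "s (1 - u / (t + u)) (s (1 / t) a) + s (u / (t + u)) (s (1 / u) b) \<in> W"
      using tu by (intro conv) (auto simp: field_simps)
    also have "1 - u / (t + u) = t / (t + u)" using tu by (simp add: field_simps)
    also have "s (t / (t + u)) (s (1 / t) a) + s (u / (t + u)) (s (1 / u) b) = s (1 / (t + u)) (a + b)"
      using tu by (simp add: scale_right_distrib)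
    finally show ?thesis using tu by (simp add: T_def)
  qed
  have T_scale: "\<bar>c\<bar> * t \<in> T (s c a)" if "t \<in> T a" "c \<noteq> 0" for t c a
  proof -
    have t: "t > 0" "s (1 / t) a \<in> W" using that by (auto simp: T_def)
    have "s (1 / (\<bar>c\<bar> * t)) (s c a) = s (sgn c) (s (1 / t) a)"
      using that(2) by (simp add: sgn_real_def abs_if)
    also have "\<dots> \<in> W" using sym[OF t(2)] t(2) that(2) by (auto simp: sgn_real_def)
    finally show ?thesis using t that(2) by (simp add: T_def)
  qed
  have q_scale_le: "q (s c a) \<le> \<bar>c\<bar> * q a" if a: "a \<in> V" and c: "c \<noteq> 0" for a c
  proof (rule field_le_epsilon)
    fix e :: real assume e: "e > 0"
    obtain t where t: "t \<in> T a" "t < q a + e / \<bar>c\<bar>"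
      using q_less[OF a, of "q a + e / \<bar>c\<bar>"] e c by auto
    have "q (s c a) \<le> \<bar>c\<bar> * t" by (rule q_le[OF T_scale[OF t(1) c]])
    also have "\<dots> \<le> \<bar>c\<bar> * (q a + e / \<bar>c\<bar>)" using t(2) by (intro mult_left_mono) auto
    also have "\<dots> = \<bar>c\<bar> * q a + e" using c by (simp add: distrib_left)
    finally show "q (s c a) \<le> \<bar>c\<bar> * q a + e" .
  qed
  show ?thesis
  proof (rule that[of q])
    show "q (a + b) \<le> q a + q b" if ab: "a \<in> V" "b \<in> V" for a b
    proof (rule field_le_epsilon)
      fix e :: real assume e: "e > 0"
      obtain t where t: "t \<in> T a" "t < q a + e / 2" using q_less[OF ab(1), of "q a + e / 2"] e by auto
      obtain u where u: "u \<in> T b" "u < q b + e / 2" using q_less[OF ab(2), of "q b + e / 2"] e by auto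
      have "q (a + b) \<le> t + u" by (rule q_le[OF T_add[OF t(1) u(1)]])
      then show "q (a + b) \<le> q a + q b + e" using t u by linarith
    qed
    show "q (s c a) = \<bar>c\<bar> * q a" if a: "a \<in> V" for a c
    proof (cases "c = 0")
      case True
      have "q 0 \<le> 0"
      proof (rule field_le_epsilon)
        fix e :: real assume "e > 0"
        then show "q 0 \<le> 0 + e" using q_le[of e 0] W0 by (simp add: T_def)
      qed
      then have "q 0 = 0" using q_nonneg[OF subspace_0[OF sub]] by simp
      then show ?thesis using True by simp
    next
      case False
      have "q a = q (s (1 / c) (s c a))" using False by simp
      also have "\<dots> \<le> \<bar>1 / c\<bar> * q (s c a)" using False a by (intro q_scale_le subspace_scale[OF sub]) auto
      finally have "\<bar>c\<bar> * q a \<le> q (s c a)" using False by (simp add: field_simps)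
      then show ?thesis using q_scale_le[OF a False] by simp
    qed
    show "a \<in> W" if a: "a \<in> V" "q a < 1" for a
    proof -
      obtain t where t: "t \<in> T a" "t < 1" using q_less[OF a] by auto
      then have tt: "t > 0" "s (1 / t) a \<in> W" by (auto simp: T_def)
      have "s (1 - t) 0 + s t (s (1 / t) a) \<in> W" using tt t W0 by (intro conv) auto
      then show ?thesis using tt by simp
    qed
    show "q a \<le> 1" if "a \<in> W" for a
      by (rule q_le) (use that in \<open>simp add: T_def\<close>)
  qed
qed

abbreviation pscale :: "real \<Rightarrow> ('k \<Rightarrow>\<^sub>0 real) \<Rightarrow> 'k \<Rightarrow>\<^sub>0 real" where
  "pscale c \<equiv> Poly_Mapping.map ((*) c)"

lemma lookup_map_zero: "f 0 = 0 \<Longrightarrow> Poly_Mapping.lookup (Poly_Mapping.map f a) x = f (Poly_Mapping.lookup a x)"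
  by (simp add: Poly_Mapping.map.rep_eq when_def)

lemma lookup_pscale: "Poly_Mapping.lookup (pscale c a) x = c * Poly_Mapping.lookup a x"
  by (simp add: lookup_map_zero)

lemma vector_space_pscale: "vector_space (pscale :: real \<Rightarrow> ('k \<Rightarrow>\<^sub>0 real) \<Rightarrow> _)"
  by unfold_locales (auto intro!: poly_mapping_eqI simp: lookup_pscale lookup_add algebra_simps)

lemma keys_pscale: "Poly_Mapping.keys (pscale c a) \<subseteq> Poly_Mapping.keys a"
  by (auto simp: in_keys_iff lookup_pscale)

abbreviation delta :: "'k \<Rightarrow> 'k \<Rightarrow>\<^sub>0 real" where "delta x \<equiv> Poly_Mapping.single x 1"

lemma FV_simps: "carrier (free_vector_space S) = {a. Poly_Mapping.keys a \<subseteq> S}"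
  "ring.zero (free_vector_space S) = 0" "ring.add (free_vector_space S) = (+)"
  "smult (free_vector_space S) = pscale"
  by (simp_all add: free_vector_space_def)

lemma subspace_FV: "module.subspace pscale {a :: 'k \<Rightarrow>\<^sub>0 real. Poly_Mapping.keys a \<subseteq> S}"
proof -
  interpret vector_space "pscale :: real \<Rightarrow> ('k \<Rightarrow>\<^sub>0 real) \<Rightarrow> _" by (rule vector_space_pscale)
  show ?thesis
  proof (rule subspaceI)
    show "a + b \<in> {a. Poly_Mapping.keys a \<subseteq> S}" if "a \<in> {a. Poly_Mapping.keys a \<subseteq> S}" "b \<in> {a. Poly_Mapping.keys a \<subseteq> S}"
      for a b :: "'k \<Rightarrow>\<^sub>0 real"
      using that order_trans[OF keys_add[of a b], of S] by simp
    show "pscale c a \<in> {a. Poly_Mapping.keys a \<subseteq> S}" if "a \<in> {a. Poly_Mapping.keys a \<subseteq> S}"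
      for c and a :: "'k \<Rightarrow>\<^sub>0 real"
      using that order_trans[OF keys_pscale[of c a], of S] by simp
  qed simp
qed

text \<open>Induction over the number of points in the support.\<close>
lemma FV_induct [consumes 1, case_names zero add]:
  fixes a :: "'k \<Rightarrow>\<^sub>0 real"
  assumes "Poly_Mapping.keys a \<subseteq> S" and P0: "P 0"
    and step: "\<And>c x a. x \<in> S \<Longrightarrow> Poly_Mapping.keys a \<subseteq> S \<Longrightarrow> P a \<Longrightarrow> P (pscale c (delta x) + a)"
  shows "P a"
proof -
  have "\<forall>a. Poly_Mapping.keys a \<subseteq> T \<longrightarrow> P a" if "finite T" "T \<subseteq> S" for T
    using that
  proof (induction T rule: finite_induct)
    case empty
    then show ?case using P0 by simp
  next
    case (insert x T)
    show ?case
    proof (intro allI impI)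
      fix a :: "'k \<Rightarrow>\<^sub>0 real" assume a: "Poly_Mapping.keys a \<subseteq> insert x T"
      define b where "b = a - pscale (Poly_Mapping.lookup a x) (delta x)"
      have lb: "Poly_Mapping.lookup b y = (if y = x then 0 else Poly_Mapping.lookup a y)" for y
        by (simp add: b_def lookup_minus lookup_pscale lookup_single when_def)
      have bT: "Poly_Mapping.keys b \<subseteq> T" using a by (auto simp: in_keys_iff lb split: if_splits)
      then have "P b" using insert by blast
      moreover have "Poly_Mapping.keys b \<subseteq> S" using bT insert.prems by blast
      ultimately have "P (pscale (Poly_Mapping.lookup a x) (delta x) + b)"
        using step insert.prems by blast
      then show "P a" by (simp add: b_def)
    qed
  qed
  from this[OF finite_keys assms(1)] show ?thesis by blast
qed

lemma module_FV: "Module.module (scalars :: real ring) (free_vector_space S)"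
proof -
  interpret vector_space "pscale :: real \<Rightarrow> ('a \<Rightarrow>\<^sub>0 real) \<Rightarrow> _" by (rule vector_space_pscale)
  note sub = subspace_FV[of S]
  show ?thesis
    by (rule module_scalarsI)
      (use subspace_add[OF sub] subspace_neg[OF sub] subspace_scale[OF sub] in
        \<open>auto simp: FV_simps scale_left_distrib scale_right_distrib\<close>)
qed

lemma comm_group_FV: "comm_group (add_monoid (free_vector_space S))"
proof -
  interpret Module.module "scalars :: real ring" "free_vector_space S" by (rule module_FV)
  show ?thesis by (rule a_comm_group)
qed

context compact_K
begin

lemma Mc_topological_abelian_group: "topological_abelian_group Mc Mct"
  unfolding topological_abelian_group_def
proof (intro conjI Mc_comm_group)
  show "topspace Mct = carrier Mc" by (simp add: Mc_topspace Mc_simps)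
  show "Hausdorff_space Mct"
    unfolding Hausdorff_space_def
  proof (intro allI impI, elim conjE)
    fix \<phi> \<psi> assume "\<phi> \<in> topspace Mct" "\<psi> \<in> topspace Mct" and ne: "\<phi> \<noteq> \<psi>"
    then have d: "\<phi> \<in> dualK" "\<psi> \<in> dualK" by (auto simp: Mc_topspace)
    then obtain f where f: "f \<in> CK" "\<phi> f \<noteq> \<psi> f" using dual_eqI ne by blast
    let ?e = "\<bar>\<phi> f - \<psi> f\<bar> / 2"
    have A: "compactin C.mtopology {f}" using f by simp
    have "\<theta> \<notin> nbhd \<psi> {f} ?e" if "\<theta> \<in> nbhd \<phi> {f} ?e" for \<theta>
    proof
      assume "\<theta> \<in> nbhd \<psi> {f} ?e"
      then have "\<bar>\<theta> f - \<psi> f\<bar> < ?e" "\<bar>\<theta> f - \<phi> f\<bar> < ?e" using that by (auto simp: nbhd_def)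
      moreover have "\<bar>\<phi> f - \<psi> f\<bar> \<le> \<bar>\<theta> f - \<psi> f\<bar> + \<bar>\<theta> f - \<phi> f\<bar>"
        using abs_triangle_ineq4[of "\<theta> f - \<psi> f" "\<theta> f - \<phi> f"] by simp
      ultimately show False by simp
    qed
    then have "disjnt (nbhd \<phi> {f} ?e) (nbhd \<psi> {f} ?e)" by (auto simp: disjnt_iff)
    moreover have "?e > 0" using f by simp
    ultimately show "\<exists>U V. openin Mct U \<and> openin Mct V \<and> \<phi> \<in> U \<and> \<psi> \<in> V \<and> disjnt U V"
      by (intro exI[of _ "nbhd \<phi> {f} ?e"] exI[of _ "nbhd \<psi> {f} ?e"] conjI
          openin_nbhd[OF d(1) A] openin_nbhd[OF d(2) A] nbhd_self[OF d(1)] nbhd_self[OF d(2)])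
  qed
  show "continuous_map (prod_topology Mct Mct) Mct (\<lambda>(x, y). x \<otimes>\<^bsub>Mc\<^esub> y)"
  proof (rule continuous_map_to_Mc)
    show "(case p of (x, y) \<Rightarrow> x \<otimes>\<^bsub>Mc\<^esub> y) \<in> dualK" if "p \<in> topspace (prod_topology Mct Mct)" for p
      using that dual_comb[of "fst p" "snd p" 1 1] by (auto simp: Mc_topspace Mc_simps)
    fix p A and e :: real assume p: "p \<in> topspace (prod_topology Mct Mct)" and A: "compactin C.mtopology A" and e: "e > 0"
    obtain \<phi> \<psi> where p': "p = (\<phi>, \<psi>)" "\<phi> \<in> dualK" "\<psi> \<in> dualK" using p by (auto simp: Mc_topspace)
    have AC: "A \<subseteq> CK" using compactin_subset_topspace[OF A] by simp
    let ?V = "nbhd \<phi> A (e / 2) \<times> nbhd \<psi> A (e / 2)"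
    have "\<bar>(case r of (x, y) \<Rightarrow> x \<otimes>\<^bsub>Mc\<^esub> y) f - (case p of (x, y) \<Rightarrow> x \<otimes>\<^bsub>Mc\<^esub> y) f\<bar> < e"
      if r: "r \<in> ?V" and f: "f \<in> A" for r f
    proof -
      obtain \<phi>' \<psi>' where r': "r = (\<phi>', \<psi>')" by (cases r)
      have "\<bar>\<phi>' f - \<phi> f\<bar> < e / 2" "\<bar>\<psi>' f - \<psi> f\<bar> < e / 2" using r r' f by (auto simp: nbhd_def)
      then have "\<bar>\<phi>' f + \<psi>' f - (\<phi> f + \<psi> f)\<bar> < e" by linarith
      then show ?thesis using subsetD[OF AC f] by (simp add: r' p' Mc_simps)
    qed
    moreover have "openin (prod_topology Mct Mct) ?V"
      using openin_nbhd[OF p'(2) A, of "e / 2"] openin_nbhd[OF p'(3) A, of "e / 2"] e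
      by (simp add: openin_prod_Times_iff)
    moreover have "p \<in> ?V" using nbhd_self p' e by simp
    ultimately show "\<exists>V. openin (prod_topology Mct Mct) V \<and> p \<in> V \<and>
       (\<forall>r\<in>V. \<forall>f\<in>A. \<bar>(case r of (x, y) \<Rightarrow> x \<otimes>\<^bsub>Mc\<^esub> y) f - (case p of (x, y) \<Rightarrow> x \<otimes>\<^bsub>Mc\<^esub> y) f\<bar> < e)"
      by (intro exI[of _ ?V] conjI ballI)
  qed
  show "continuous_map Mct Mct (\<lambda>x. inv\<^bsub>Mc\<^esub> x)"
  proof (rule continuous_map_to_Mc)
    show "inv\<^bsub>Mc\<^esub> \<phi> \<in> dualK" if "\<phi> \<in> topspace Mct" for \<phi>
      using that dual_comb[of \<phi> \<phi> "-1" 0] by (simp add: Mc_topspace Mc_inv)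
    fix \<phi> A and e :: real assume "\<phi> \<in> topspace Mct" and A: "compactin C.mtopology A" and e: "e > 0"
    then have \<phi>: "\<phi> \<in> dualK" by (simp add: Mc_topspace)
    have AC: "A \<subseteq> CK" using compactin_subset_topspace[OF A] by simp
    have "\<bar>(inv\<^bsub>Mc\<^esub> \<psi>) f - (inv\<^bsub>Mc\<^esub> \<phi>) f\<bar> < e" if \<psi>: "\<psi> \<in> nbhd \<phi> A e" and f: "f \<in> A" for \<psi> f
    proof -
      have d: "\<psi> \<in> dualK" "\<bar>\<psi> f - \<phi> f\<bar> < e" using \<psi> f by (auto simp: nbhd_def)
      have "f \<in> CK" using AC f by blast
      then have "(inv\<^bsub>Mc\<^esub> \<psi>) f - (inv\<^bsub>Mc\<^esub> \<phi>) f = - (\<psi> f - \<phi> f)" using d \<phi> by (simp add: Mc_inv)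
      then show ?thesis using d by simp
    qed
    then show "\<exists>V. openin Mct V \<and> \<phi> \<in> V \<and> (\<forall>\<psi>\<in>V. \<forall>f\<in>A. \<bar>(inv\<^bsub>Mc\<^esub> \<psi>) f - (inv\<^bsub>Mc\<^esub> \<phi>) f\<bar> < e)"
      using openin_nbhd[OF \<phi> A e] nbhd_self[OF \<phi> e] by blast
  qed
qed

abbreviation "ev \<equiv> evaluation K"
abbreviation "LV \<equiv> {a :: 'k \<Rightarrow>\<^sub>0 real. Poly_Mapping.keys a \<subseteq> topspace K}"

lemma pscale_LV: "a \<in> LV \<Longrightarrow> pscale c a \<in> LV"
  using order_trans[OF keys_pscale[of c a]] by simp

lemma ev_ext: "ev a = (\<lambda>f\<in>CK. \<Sum>x\<in>Poly_Mapping.keys a. Poly_Mapping.lookup a x * f x)"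
  by (simp add: evaluation_def CK_def)

lemma ev_sum:
  assumes "finite S" "Poly_Mapping.keys a \<subseteq> S" "f \<in> CK"
  shows "ev a f = (\<Sum>x\<in>S. Poly_Mapping.lookup a x * f x)"
proof -
  have "ev a f = (\<Sum>x\<in>Poly_Mapping.keys a. Poly_Mapping.lookup a x * f x)" using assms(3) by (simp add: ev_ext)
  also have "\<dots> = (\<Sum>x\<in>S. Poly_Mapping.lookup a x * f x)"
    using assms by (intro sum.mono_neutral_left) (auto simp: in_keys_iff)
  finally show ?thesis .
qed

lemma ev_add: "f \<in> CK \<Longrightarrow> ev (a + b) f = ev a f + ev b f"
proof -
  assume f: "f \<in> CK"
  let ?S = "Poly_Mapping.keys a \<union> Poly_Mapping.keys b"
  have "ev (a + b) f = (\<Sum>x\<in>?S. Poly_Mapping.lookup (a + b) x * f x)"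
    by (rule ev_sum[OF _ keys_add f]) simp
  also have "\<dots> = (\<Sum>x\<in>?S. Poly_Mapping.lookup a x * f x) + (\<Sum>x\<in>?S. Poly_Mapping.lookup b x * f x)"
    by (simp add: lookup_add distrib_right sum.distrib)
  also have "\<dots> = ev a f + ev b f"
    by (intro arg_cong2[of _ _ _ _ "(+)"] ev_sum[symmetric] f) auto
  finally show ?thesis .
qed

lemma ev_pscale: "f \<in> CK \<Longrightarrow> ev (pscale c a) f = c * ev a f"
  using ev_sum[OF finite_keys keys_pscale, of f c a] by (simp add: ev_ext lookup_pscale sum_distrib_left mult_ac)

lemma ev_minus: "f \<in> CK \<Longrightarrow> ev (- a) f = - ev a f"
  using ev_add[of f a "- a"] by (simp add: ev_ext)

lemma ev_diff: "f \<in> CK \<Longrightarrow> ev (a - b) f = ev a f - ev b f"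
  using ev_add[of f a "- b"] ev_minus[of f b] by simp

lemma ev_delta: "f \<in> CK \<Longrightarrow> ev (delta x) f = f x"
  by (simp add: ev_ext)

lemma ev_dual: "a \<in> LV \<Longrightarrow> ev a \<in> dualK"
proof -
  assume a: "a \<in> LV"
  show ?thesis
  proof (rule dualI[of _ "\<Sum>x\<in>Poly_Mapping.keys a. \<bar>Poly_Mapping.lookup a x\<bar>"])
    show "ev a \<in> extensional CK" by (simp add: ev_ext)
    fix f g and s t :: real assume fg: "f \<in> CK" "g \<in> CK"
    have "ev a (\<lambda>x\<in>topspace K. s * f x + t * g x) =
      (\<Sum>x\<in>Poly_Mapping.keys a. Poly_Mapping.lookup a x * (s * f x + t * g x))"
      using CK_lin[OF fg] a unfolding ev_ext by (simp only: restrict_apply' refl) (intro sum.cong refl, auto)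
    also have "\<dots> = s * ev a f + t * ev a g"
      using fg by (simp add: ev_ext sum_distrib_left algebra_simps sum.distrib)
    finally show "ev a (\<lambda>x\<in>topspace K. s * f x + t * g x) = s * ev a f + t * ev a g" .
  next
    fix f and r :: real assume f: "f \<in> CK" "0 \<le> r" "\<And>x. x \<in> topspace K \<Longrightarrow> \<bar>f x\<bar> \<le> r"
    have "\<bar>ev a f\<bar> \<le> (\<Sum>x\<in>Poly_Mapping.keys a. \<bar>Poly_Mapping.lookup a x * f x\<bar>)"
      using f(1) by (simp add: ev_ext sum_abs)
    also have "\<dots> \<le> (\<Sum>x\<in>Poly_Mapping.keys a. \<bar>Poly_Mapping.lookup a x\<bar> * r)"
      using a f(3) by (intro sum_mono) (auto simp: abs_mult intro!: mult_left_mono)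
    finally show "\<bar>ev a f\<bar> \<le> (\<Sum>x\<in>Poly_Mapping.keys a. \<bar>Poly_Mapping.lookup a x\<bar>) * r"
      by (simp add: sum_distrib_right)
  qed (simp add: sum_nonneg)
qed

lemma ev_hom: "ev \<in> hom (add_monoid (free_vector_space (topspace K))) Mc"
proof (rule homI)
  fix a b assume "a \<in> carrier (add_monoid (free_vector_space (topspace K)))"
    "b \<in> carrier (add_monoid (free_vector_space (topspace K)))"
  have "ev (a + b) = (\<lambda>f\<in>CK. ev a f + ev b f)"
    by (rule extensionalityI[of _ CK]) (simp_all add: ev_add, simp add: ev_ext)
  then show "ev (a \<otimes>\<^bsub>add_monoid (free_vector_space (topspace K))\<^esub> b) = ev a \<otimes>\<^bsub>Mc\<^esub> ev b"
    by (simp add: FV_simps Mc_simps)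
qed (simp add: FV_simps Mc_simps ev_dual)

lemma continuous_delta_Mc: "continuous_map K Mct (\<lambda>x. ev (delta x))"
proof (rule continuous_map_to_Mc)
  show "ev (delta x) \<in> dualK" if "x \<in> topspace K" for x using that by (intro ev_dual) simp
  fix x A and e :: real assume x: "x \<in> topspace K" and A: "compactin C.mtopology A" and e: "e > 0"
  have AC: "A \<subseteq> CK" using compactin_subset_topspace[OF A] by simp
  obtain V where V: "openin K V" "x \<in> V" "\<forall>y\<in>V. \<forall>f\<in>A. \<bar>f x - f y\<bar> < e"
    using compactin_equicontinuous[OF A x e] by blast
  have "\<bar>ev (delta y) f - ev (delta x) f\<bar> < e" if "y \<in> V" "f \<in> A" for y f
  proof -
    have "\<bar>f x - f y\<bar> < e" using V(3) that by blast
    then show ?thesis using subsetD[OF AC that(2)] by (simp add: ev_delta abs_minus_commute[of "f y"])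
  qed
  with V show "\<exists>V. openin K V \<and> x \<in> V \<and> (\<forall>y\<in>V. \<forall>f\<in>A. \<bar>ev (delta y) f - ev (delta x) f\<bar> < e)"
    by blast
qed

lemma continuous_pscale_Mc:
  "continuous_map (prod_topology euclideanreal (pullback_topology LV ev Mct)) Mct (\<lambda>p. ev (pscale (fst p) (snd p)))"
    (is "continuous_map (prod_topology _ ?S) _ _")
proof (rule continuous_map_to_Mc)
  interpret vector_space "pscale :: real \<Rightarrow> ('k \<Rightarrow>\<^sub>0 real) \<Rightarrow> _" by (rule vector_space_pscale)
  have top: "topspace ?S = LV" using ev_dual by (auto simp: topspace_pullback_topology Mc_topspace)
  show "ev (pscale (fst p) (snd p)) \<in> dualK" if "p \<in> topspace (prod_topology euclideanreal ?S)" for p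
    using that by (intro ev_dual pscale_LV) (auto simp: top)
  fix p A and e :: real
  assume p: "p \<in> topspace (prod_topology euclideanreal ?S)" and A: "compactin C.mtopology A" and e: "e > 0"
  obtain c a where ca: "p = (c, a)" "a \<in> LV" using p by (auto simp: top)
  have AC: "A \<subseteq> CK" using compactin_subset_topspace[OF A] by simp
  obtain B where B: "B > 0" "\<And>f x. f \<in> A \<Longrightarrow> x \<in> topspace K \<Longrightarrow> \<bar>f x\<bar> \<le> B"
    using compactin_bounded[OF A] by blast
  obtain D where D: "D \<ge> 0" "\<And>f r. f \<in> CK \<Longrightarrow> 0 \<le> r \<Longrightarrow> (\<And>x. x \<in> topspace K \<Longrightarrow> \<bar>f x\<bar> \<le> r) \<Longrightarrow> \<bar>ev a f\<bar> \<le> D * r"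
    using dual_bounded[OF ev_dual[OF ca(2)]] by blast
  \<comment> \<open>r and d make each of the two error terms below at most e/2\<close>
  define r where "r = e / (2 * (D * B + 1))"
  define d where "d = e / (2 * (\<bar>c\<bar> + r + 1))"
  have DB: "D * B \<ge> 0" using B(1) D(1) by simp
  then have r: "r > 0" using e by (simp add: r_def)
  then have dpos: "d > 0" using e by (simp add: d_def)
  let ?V = "ball c r \<times> (ev -` nbhd (ev a) A d \<inter> LV)"
  have op: "openin ?S (ev -` nbhd (ev a) A d \<inter> LV)"
    unfolding openin_pullback_topology using openin_nbhd[OF ev_dual[OF ca(2)] A dpos] by blast
  have "openin (prod_topology euclideanreal ?S) ?V"
    using op unfolding openin_prod_Times_iff by simp
  moreover have "p \<in> ?V" using ca r nbhd_self[OF ev_dual[OF ca(2)] dpos] by simp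
  moreover have "\<bar>ev (pscale (fst p') (snd p')) f - ev (pscale (fst p) (snd p)) f\<bar> < e"
    if p': "p' \<in> ?V" and f: "f \<in> A" for p' f
  proof -
    obtain c' a' where ca': "p' = (c', a')" "\<bar>c - c'\<bar> < r" "ev a' \<in> nbhd (ev a) A d"
      using p' by (cases p') (auto simp: dist_real_def)
    have fC: "f \<in> CK" using AC f by blast
    have ad: "\<bar>ev a' f - ev a f\<bar> < d" using ca'(3) f by (simp add: nbhd_def)
    have bd: "\<bar>ev a f\<bar> \<le> D * B" by (rule D(2)[OF fC]) (use B f in auto)
    have "ev (pscale (fst p') (snd p')) f - ev (pscale (fst p) (snd p)) f
        = c' * (ev a' f - ev a f) + (c' - c) * ev a f"
      using fC by (simp add: ca ca' ev_pscale algebra_simps)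
    also have "\<bar>\<dots>\<bar> \<le> \<bar>c'\<bar> * \<bar>ev a' f - ev a f\<bar> + \<bar>c' - c\<bar> * \<bar>ev a f\<bar>"
      using abs_triangle_ineq[of "c' * (ev a' f - ev a f)" "(c' - c) * ev a f"] by (simp add: abs_mult)
    also have "\<dots> \<le> (\<bar>c\<bar> + r + 1) * \<bar>ev a' f - ev a f\<bar> + r * (D * B)"
      using ca'(2) bd r by (intro add_mono mult_mono) auto
    also have "\<dots> < (\<bar>c\<bar> + r + 1) * d + r * (D * B + 1)"
      using ad r by (intro add_strict_mono mult_strict_left_mono) auto
    also have "\<dots> = e"
    proof -
      have "\<bar>c\<bar> + r + 1 > 0" "D * B + 1 > 0" using r DB by auto
      moreover have half: "x * (e / (2 * x)) = e / 2" if "x > 0" for x using that by simp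
      ultimately have "(\<bar>c\<bar> + r + 1) * d = e / 2" "(D * B + 1) * r = e / 2"
        unfolding d_def by (auto simp only: r_def)
      then show ?thesis by (simp add: mult.commute)
    qed
    finally show ?thesis .
  qed
  ultimately show "\<exists>V. openin (prod_topology euclideanreal ?S) V \<and> p \<in> V \<and>
      (\<forall>p'\<in>V. \<forall>f\<in>A. \<bar>ev (pscale (fst p') (snd p')) f - ev (pscale (fst p) (snd p)) f\<bar> < e)"
    by (intro exI[of _ ?V] conjI ballI)
qed

end

locale compact_Hausdorff_K = compact_K +
  assumes Hausdorff_K: "Hausdorff_space K"
begin

text \<open>Distinct combinations are separated by a continuous function that is 1 at one point of the support
  of the difference and 0 at the others, by Urysohn's lemma.\<close>
lemma ev_inj: "inj_on ev LV"
proof (rule inj_onI)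
  fix a b assume a: "a \<in> LV" and b: "b \<in> LV" and eq: "ev a = ev b"
  have "Poly_Mapping.lookup (a - b) x = 0" for x
  proof (rule ccontr)
    assume nz: "Poly_Mapping.lookup (a - b) x \<noteq> 0"
    have kS: "Poly_Mapping.keys (a - b) \<subseteq> topspace K" 
      using a b order_trans[OF keys_diff[of a b], of "topspace K"] by simp
    then have x: "x \<in> topspace K" using nz by (auto simp: in_keys_iff)
    have T1: "t1_space K" by (rule Hausdorff_imp_t1_space[OF Hausdorff_K])
    have norm: "normal_space K" using compact_K Hausdorff_K by (simp add: compact_Hausdorff_or_regular_imp_normal_space)
    let ?R = "Poly_Mapping.keys (a - b) - {x}"
    have "closedin K ?R" "closedin K {x}"
      by (intro T1[unfolded t1_space_closedin_finite, rule_format] conjI, use kS x in auto)+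
    then obtain f where f: "continuous_map K (top_of_set {0..1::real}) f" "f ` ?R \<subseteq> {0}" "f ` {x} \<subseteq> {1}"
      using Urysohn_lemma[OF norm, of ?R "{x}" 0 1] by (auto simp: disjnt_iff)
    let ?f = "restrict f (topspace K)"
    have fC: "?f \<in> CK" using f(1) by (intro CK_restrict) (auto simp: continuous_map_in_subtopology)
    have "ev (a - b) ?f = (\<Sum>y\<in>Poly_Mapping.keys (a - b). Poly_Mapping.lookup (a - b) y * ?f y)"
      using fC by (simp only: ev_ext restrict_apply')
    also have "\<dots> = (\<Sum>y\<in>{x}. Poly_Mapping.lookup (a - b) y * ?f y)"
      using f(2) kS nz by (intro sum.mono_neutral_right) (auto simp: in_keys_iff)
    also have "\<dots> = Poly_Mapping.lookup (a - b) x" using x f(3) by simp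
    finally show False using nz ev_diff[OF fC, of a b] eq by simp
  qed
  then have "a - b = 0" by (intro poly_mapping_eqI) simp
  then show "a = b" by simp
qed

abbreviation "FL \<equiv> free_vector_space (topspace K)"
abbreviation "Lpull \<equiv> pullback_topology LV ev Mct"

lemma carrier_FL: "carrier (add_monoid FL) = LV" "carrier FL = LV"
  by (simp_all add: FV_simps)

lemma topspace_Lpull: "topspace Lpull = LV"
  using ev_dual by (auto simp: topspace_pullback_topology Mc_topspace)

text \<open>Needed in order to apply the universal property of \<open>L(K)\<close> to the topology induced from \<open>M\<^sub>c(K)\<close>.\<close>
lemma locally_convex_Lpull: "locally_convex_space FL Lpull"
  unfolding locally_convex_space_def
proof (intro conjI module_FV allI impI)
  interpret vector_space "pscale :: real \<Rightarrow> ('a \<Rightarrow>\<^sub>0 real) \<Rightarrow> _" by (rule vector_space_pscale)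
  show "topological_abelian_group (add_monoid FL) Lpull"
    using topological_abelian_group_pullback[OF comm_group_FV ev_hom _ Mc_topological_abelian_group]
      ev_inj by (simp add: carrier_FL FV_simps)
  show "continuous_map (prod_topology euclideanreal Lpull) Lpull (\<lambda>(c, x). c \<odot>\<^bsub>FL\<^esub> x)"
  proof (rule continuous_map_pullback')
    show "continuous_map (prod_topology euclideanreal Lpull) Mct (ev \<circ> (\<lambda>(c, x). c \<odot>\<^bsub>FL\<^esub> x))"
      by (rule continuous_map_eq[OF continuous_pscale_Mc]) (auto simp: FV_simps)
    show "topspace (prod_topology euclideanreal Lpull) \<subseteq> (\<lambda>(c, x). c \<odot>\<^bsub>FL\<^esub> x) -` LV"
      using pscale_LV by (auto simp: FV_simps topspace_Lpull)
  qed
  fix U assume "openin Lpull U \<and> \<zero>\<^bsub>FL\<^esub> \<in> U"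
  then obtain U' where U': "openin Mct U'" "U = ev -` U' \<inter> LV" and U0: "0 \<in> U"
    by (auto simp: openin_pullback_topology FV_simps)
  have ev0: "ev 0 \<in> U'" "ev 0 \<in> dualK" using U' U0 ev_dual by auto
  obtain A e where A: "compactin C.mtopology A" "e > 0" "nbhd (ev 0) A e \<subseteq> U'"
    using openin_Mc_nbhd[OF U'(1) ev0(1)] by blast
  have AC: "A \<subseteq> CK" using compactin_subset_topspace[OF A(1)] by simp
  define W where "W = ev -` nbhd (ev 0) A e \<inter> LV"
  have W_iff: "a \<in> W \<longleftrightarrow> a \<in> LV \<and> (\<forall>f\<in>A. \<bar>ev a f\<bar> < e)" for a
  proof -
    have "ev 0 f = 0" if "f \<in> A" for f using AC that by (auto simp: ev_ext)
    then show ?thesis using ev_dual by (auto simp: W_def nbhd_def)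
  qed
  have "((1 - t) \<odot>\<^bsub>FL\<^esub> a) \<oplus>\<^bsub>FL\<^esub> (t \<odot>\<^bsub>FL\<^esub> b) \<in> W" if ab: "a \<in> W" "b \<in> W" and t: "t \<in> {0..1}" for a b t
    unfolding W_iff
  proof (intro conjI ballI)
    show "(1 - t) \<odot>\<^bsub>FL\<^esub> a \<oplus>\<^bsub>FL\<^esub> t \<odot>\<^bsub>FL\<^esub> b \<in> LV"
      unfolding FV_simps using ab W_iff by (intro subspace_add[OF subspace_FV] subspace_scale[OF subspace_FV]) auto
    fix f assume f: "f \<in> A"
    then have fC: "f \<in> CK" using AC by blast
    have lt: "\<bar>ev a f\<bar> < e" "\<bar>ev b f\<bar> < e" using ab f W_iff by auto
    have "ev ((1 - t) \<odot>\<^bsub>FL\<^esub> a \<oplus>\<^bsub>FL\<^esub> t \<odot>\<^bsub>FL\<^esub> b) f = (1 - t) * ev a f + t * ev b f"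
      unfolding FV_simps using fC by (simp add: ev_add ev_pscale)
    also have "\<bar>\<dots>\<bar> \<le> (1 - t) * \<bar>ev a f\<bar> + t * \<bar>ev b f\<bar>"
      using abs_triangle_ineq[of "(1 - t) * ev a f" "t * ev b f"] t by (simp add: abs_mult)
    also have "\<dots> < e" using lt t by (intro convex_bound_lt) auto
    finally show "\<bar>ev ((1 - t) \<odot>\<^bsub>FL\<^esub> a \<oplus>\<^bsub>FL\<^esub> t \<odot>\<^bsub>FL\<^esub> b) f\<bar> < e" .
  qed
  moreover have "openin Lpull W"
    unfolding W_def openin_pullback_topology using openin_nbhd[OF ev0(2) A(1,2)] by blast
  moreover have "0 \<in> W" using nbhd_self[OF ev0(2) A(2)] by (simp add: W_def)
  moreover have "W \<subseteq> U" using A(3) U' by (auto simp: W_def)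
  ultimately show "\<exists>W. openin Lpull W \<and> \<zero>\<^bsub>FL\<^esub> \<in> W \<and> W \<subseteq> U \<and>
       (\<forall>x\<in>W. \<forall>y\<in>W. \<forall>t\<in>{0..1}. (1 - t) \<odot>\<^bsub>FL\<^esub> x \<oplus>\<^bsub>FL\<^esub> t \<odot>\<^bsub>FL\<^esub> y \<in> W)"
    by (intro exI[of _ W]) (simp add: FV_simps)
qed

text \<open>The universal property yields a continuous linear map from \<open>\<tau>\<close> to the induced topology that fixes
  the points of \<open>K\<close>; it is the identity.\<close>
lemma free_lcs_ev_continuous:
  assumes \<tau>: "free_lcs_topology K \<tau>"
  shows "continuous_map \<tau> Mct ev"
proof -
  have lc: "locally_convex_space FL \<tau>" using \<tau> by (simp add: free_lcs_topology_def)
  then have top: "topspace \<tau> = LV"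
    by (simp add: locally_convex_space_def topological_abelian_group_def carrier_FL FV_simps)
  have "continuous_map K Lpull delta"
    by (rule continuous_map_pullback') (use continuous_delta_Mc in \<open>auto simp: comp_def\<close>)
  then obtain h where h: "linear_between FL FL h" "continuous_map \<tau> Lpull h"
    "\<And>x. x \<in> topspace K \<Longrightarrow> h (delta x) = delta x"
    using \<tau> locally_convex_Lpull unfolding free_lcs_topology_def by blast
  have h_add: "h (a + b) = h a + h b" if "a \<in> LV" "b \<in> LV" for a b
    using h(1) that by (simp add: linear_between_def FV_simps)
  have h_scale: "h (pscale c a) = pscale c (h a)" if "a \<in> LV" for a c
    using h(1) that by (simp add: linear_between_def FV_simps)
  have "h a = a" if "Poly_Mapping.keys a \<subseteq> topspace K" for a
    using that
  proof (induction rule: FV_induct)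
    case zero
    show ?case using h_add[of 0 0] by simp
  next
    case (add c x a)
    have "h (pscale c (delta x) + a) = h (pscale c (delta x)) + h a"
      by (rule h_add) (use add keys_pscale[of c "delta x"] in auto)
    also have "h (pscale c (delta x)) = pscale c (h (delta x))" by (rule h_scale) (use add in simp)
    finally show ?case using add h(3) by simp
  qed
  moreover have "continuous_map Lpull Mct ev"
    using continuous_map_pullback[OF continuous_map_id, of LV ev] by simp
  ultimately show ?thesis
    using continuous_map_compose[OF h(2)] by (metis (no_types, lifting) comp_apply continuous_map_eq mem_Collect_eq top)
qed

end

section \<open>The free locally convex space\<close>

context compact_Hausdorff_K
begin

context
  fixes \<tau> :: "('a \<Rightarrow>\<^sub>0 real) topology"
  assumes lc: "locally_convex_space FL \<tau>"
begin

lemma lcs_topspace: "topspace \<tau> = LV"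
  using lc by (simp add: locally_convex_space_def topological_abelian_group_def carrier_FL FV_simps)

lemma lcs_group: "topological_abelian_group (add_monoid FL) \<tau>"
  using lc by (simp add: locally_convex_space_def)

lemma lcs_continuous_add:
  "continuous_map X \<tau> f \<Longrightarrow> continuous_map X \<tau> g \<Longrightarrow> continuous_map X \<tau> (\<lambda>x. f x + g x)"
  using topological_abelian_group_continuous_mult[OF lcs_group] by (simp add: FV_simps)

lemma lcs_continuous_scale:
  assumes "continuous_map X euclideanreal c" "continuous_map X \<tau> f"
  shows "continuous_map X \<tau> (\<lambda>x. pscale (c x) (f x))"
proof -
  have "continuous_map X (prod_topology euclideanreal \<tau>) (\<lambda>x. (c x, f x))"
    using assms by (intro continuous_map_pairedI)
  from continuous_map_compose[OF this, of \<tau> "\<lambda>(c, x). c \<odot>\<^bsub>FL\<^esub> x"] lc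
  show ?thesis by (simp add: locally_convex_space_def comp_def FV_simps)
qed

lemma lcs_continuous_diff:
  assumes "continuous_map X \<tau> f" "continuous_map X \<tau> g"
  shows "continuous_map X \<tau> (\<lambda>x. f x - g x)"
proof -
  interpret vector_space "pscale :: real \<Rightarrow> ('a \<Rightarrow>\<^sub>0 real) \<Rightarrow> _" by (rule vector_space_pscale)
  have "continuous_map X \<tau> (\<lambda>x. f x + pscale (-1) (g x))"
    using assms by (intro lcs_continuous_add lcs_continuous_scale) auto
  then show ?thesis by simp
qed

text \<open>A convex neighbourhood is made symmetric; its gauge is continuous because scalar multiplication
  is.\<close>
lemma continuous_seminorm_exists:
  assumes U: "openin \<tau> U" "0 \<in> U"
  obtains q where
    "\<And>a b. a \<in> LV \<Longrightarrow> b \<in> LV \<Longrightarrow> q (a + b) \<le> q a + q b"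
    "\<And>a c. a \<in> LV \<Longrightarrow> q (pscale c a) = \<bar>c\<bar> * q a"
    "\<And>a. a \<in> LV \<Longrightarrow> q a < 1 \<Longrightarrow> a \<in> U"
    "\<And>e. e > 0 \<Longrightarrow> \<exists>B. openin \<tau> B \<and> 0 \<in> B \<and> (\<forall>a\<in>B. q a < e)"
proof -
  interpret vector_space "pscale :: real \<Rightarrow> ('a \<Rightarrow>\<^sub>0 real) \<Rightarrow> _" by (rule vector_space_pscale)
  have "\<exists>W. openin \<tau> W \<and> \<zero>\<^bsub>FL\<^esub> \<in> W \<and> W \<subseteq> U \<and>
          (\<forall>x\<in>W. \<forall>y\<in>W. \<forall>t\<in>{0..1}. ((1 - t) \<odot>\<^bsub>FL\<^esub> x) \<oplus>\<^bsub>FL\<^esub> (t \<odot>\<^bsub>FL\<^esub> y) \<in> W)"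
    using lc[unfolded locally_convex_space_def, THEN conjunct2, THEN conjunct2, THEN conjunct2, rule_format, of U] U
    by (simp add: FV_simps)
  then obtain C where C: "openin \<tau> C" "0 \<in> C" "C \<subseteq> U"
    "\<forall>x\<in>C. \<forall>y\<in>C. \<forall>t\<in>{0..1}. pscale (1 - t) x + pscale t y \<in> C"
    unfolding FV_simps by blast
  define W where "W = C \<inter> {a \<in> topspace \<tau>. pscale (-1) a \<in> C}"
  have contc: "continuous_map \<tau> \<tau> (pscale c)" for c
    using lcs_continuous_scale[OF _ continuous_map_id, of "\<lambda>_. c"] by simp
  have WO: "openin \<tau> W"
    unfolding W_def by (intro openin_Int C openin_continuous_map_preimage[OF contc])
  have W0: "0 \<in> W" using C by (simp add: W_def lcs_topspace)
  have WLV: "a \<in> LV" if "a \<in> W" for a using that by (simp add: W_def lcs_topspace)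
  have W_sym: "- a \<in> W" if "a \<in> W" for a
    using that by (simp add: W_def lcs_topspace)
  have W_conv: "pscale (1 - t) a + pscale t b \<in> W" if "a \<in> W" "b \<in> W" "t \<in> {0..1}" for a b t
  proof -
    have ab: "a \<in> C" "b \<in> C" "pscale (-1) a \<in> C" "pscale (-1) b \<in> C" "a \<in> LV" "b \<in> LV"
      using that by (auto simp: W_def lcs_topspace)
    have "pscale (-1) (pscale (1 - t) a + pscale t b) = pscale (1 - t) (pscale (-1) a) + pscale t (pscale (-1) b)"
      unfolding scale_right_distrib scale_scale by (simp only: mult.commute)
    moreover have "pscale (1 - t) (pscale (-1) a) + pscale t (pscale (-1) b) \<in> C"
      by (rule C(4)[rule_format, OF ab(3,4) that(3)])
    moreover have "pscale (1 - t) a + pscale t b \<in> C" by (rule C(4)[rule_format, OF ab(1,2) that(3)])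
    moreover have "pscale (1 - t) a + pscale t b \<in> LV"
      by (intro subspace_add[OF subspace_FV] pscale_LV ab(5,6))
    ultimately show ?thesis by (simp only: W_def lcs_topspace Int_iff mem_Collect_eq)
  qed
  have W_absorb: "\<exists>t>0. pscale (1 / t) a \<in> W" if a: "a \<in> LV" for a
  proof -
    have "continuous_map euclideanreal \<tau> (\<lambda>c. pscale c a)"
      using a by (intro lcs_continuous_scale) (auto simp: lcs_topspace)
    then have "openin euclideanreal {c \<in> topspace euclideanreal. pscale c a \<in> W}"
      by (rule openin_continuous_map_preimage[OF _ WO])
    then have "open {c. pscale c a \<in> W}" by simp
    then obtain r where r: "r > 0" "ball 0 r \<subseteq> {c. pscale c a \<in> W}"
      using W0 open_contains_ball by (metis (mono_tags) mem_Collect_eq scale_zero_left)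
    have "r / 2 \<in> ball 0 r" using r(1) by (simp add: dist_real_def)
    then have "pscale (r / 2) a \<in> W" using r(2) by blast
    then show ?thesis using r(1) by (intro exI[of _ "2 / r"]) simp
  qed
  obtain q where q: "\<And>a b. a \<in> LV \<Longrightarrow> b \<in> LV \<Longrightarrow> q (a + b) \<le> q a + q b"
    "\<And>a c. a \<in> LV \<Longrightarrow> q (pscale c a) = \<bar>c\<bar> * q a"
    "\<And>a. a \<in> LV \<Longrightarrow> q a < 1 \<Longrightarrow> a \<in> W" "\<And>a. a \<in> W \<Longrightarrow> q a \<le> 1"
    by (rule gauge_exists[OF vector_space_pscale subspace_FV W0 W_sym W_conv W_absorb]) blast+
  show ?thesis
  proof (rule that[of q, OF q(1,2)])
    show "a \<in> U" if "a \<in> LV" "q a < 1" for a using q(3)[OF that] C(3) by (auto simp: W_def)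
    fix e :: real assume e: "e > 0"
    \<comment> \<open>q is at most 1 on W, hence at most e/2 on (e/2) W\<close>
    let ?B = "{a \<in> topspace \<tau>. pscale (2 / e) a \<in> W}"
    have "q a < e" if a: "a \<in> ?B" for a
    proof -
      have "a \<in> LV" "q (pscale (2 / e) a) \<le> 1" using a q(4) by (auto simp: lcs_topspace)
      then have "2 / e * q a \<le> 1" using q(2)[of a "2 / e"] e by simp
      then have "q a \<le> e / 2" using e by (simp add: field_simps)
      then show ?thesis using e by simp
    qed
    moreover have "openin \<tau> ?B" by (rule openin_continuous_map_preimage[OF contc WO])
    moreover have "0 \<in> ?B" using W0 by (simp add: lcs_topspace)
    ultimately show "\<exists>B. openin \<tau> B \<and> 0 \<in> B \<and> (\<forall>a\<in>B. q a < e)"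
      by (intro exI[of _ ?B] conjI ballI)
  qed
qed

context
  fixes q :: "('a \<Rightarrow>\<^sub>0 real) \<Rightarrow> real"
  assumes q_add: "\<And>a b. a \<in> LV \<Longrightarrow> b \<in> LV \<Longrightarrow> q (a + b) \<le> q a + q b"
    and q_scale: "\<And>a c. a \<in> LV \<Longrightarrow> q (pscale c a) = \<bar>c\<bar> * q a"
    and q_small: "\<And>e. e > 0 \<Longrightarrow> \<exists>B. openin \<tau> B \<and> 0 \<in> B \<and> (\<forall>a\<in>B. q a < e)"
    and delta_cont: "continuous_map K \<tau> delta"
begin

interpretation vector_space "pscale :: real \<Rightarrow> ('a \<Rightarrow>\<^sub>0 real) \<Rightarrow> _" by (rule vector_space_pscale)

lemma delta_diff_LV: "x \<in> topspace K \<Longrightarrow> y \<in> topspace K \<Longrightarrow> delta x - delta y \<in> LV"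
  by (intro subspace_diff[OF subspace_FV]) auto

lemma q_minus: "x \<in> topspace K \<Longrightarrow> y \<in> topspace K \<Longrightarrow> q (delta x - delta y) = q (delta y - delta x)"
  using q_scale[OF delta_diff_LV, of y x "-1"] by simp

lemma seminorm_pseudometric: "continuous_pseudometric (\<lambda>x y. q (delta x - delta y))"
  unfolding continuous_pseudometric_def
proof (intro conjI ballI allI impI)
  show "q (delta x - delta x) = 0" for x :: 'a
    using q_scale[of 0 0] by simp
  show "q (delta x - delta y) = q (delta y - delta x)" if "x \<in> topspace K" "y \<in> topspace K" for x y
    by (rule q_minus[OF that])
  show "q (delta x - delta z) \<le> q (delta x - delta y) + q (delta y - delta z)"
    if "x \<in> topspace K" "y \<in> topspace K" "z \<in> topspace K" for x y z
    using q_add[OF delta_diff_LV[OF that(1,2)] delta_diff_LV[OF that(2,3)]] by simp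
  fix x and e :: real assume x: "x \<in> topspace K" and e: "e > 0"
  obtain O' where O1: "openin \<tau> O'" "0 \<in> O'" "\<forall>a\<in>O'. q a < e" using q_small[OF e] by blast
  have cont: "continuous_map K \<tau> (\<lambda>y. delta x - delta y)"
    by (intro lcs_continuous_diff delta_cont) (use x in \<open>simp add: lcs_topspace\<close>)
  have "openin K {y \<in> topspace K. delta x - delta y \<in> O'}"
    by (rule openin_continuous_map_preimage[OF cont O1(1)])
  then show "\<exists>V. openin K V \<and> x \<in> V \<and> (\<forall>y\<in>V. q (delta x - delta y) < e)"
    using x O1(2,3) by (intro exI[of _ "{y \<in> topspace K. delta x - delta y \<in> O'}"]) auto
qed

lemma seminorm_bounded:
  obtains M where "M \<ge> 0" "\<And>x. x \<in> topspace K \<Longrightarrow> q (delta x) \<le> M"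
proof -
  obtain I g where Ig: "partition_of_unity (\<lambda>x y. q (delta x - delta y)) 1 I g"
    using partition_of_unity_exists[OF seminorm_pseudometric zero_less_one] by blast
  have fin: "finite I" "I \<subseteq> topspace K" using Ig by (auto simp: partition_of_unity_def)
  let ?M = "1 + (\<Sum>y\<in>I. \<bar>q (delta y)\<bar>)"
  have "q (delta x) \<le> ?M" if x: "x \<in> topspace K" for x
  proof -
    have "(\<Sum>y\<in>I. g y x) = 1" using Ig x by (simp add: partition_of_unity_def)
    then obtain y where y: "y \<in> I" "g y x \<noteq> 0" by (metis sum.neutral zero_neq_one)
    then have lt: "q (delta x - delta y) < 1" using Ig x unfolding partition_of_unity_def by blast
    have yK: "y \<in> topspace K" using y fin by blast
    have "q (delta x) \<le> q (delta x - delta y) + q (delta y)"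
      using q_add[OF delta_diff_LV[OF x yK], of "delta y"] yK by simp
    moreover have "\<bar>q (delta y)\<bar> \<le> (\<Sum>y\<in>I. \<bar>q (delta y)\<bar>)"
      by (rule member_le_sum[OF y(1)]) (use fin in auto)
    ultimately show ?thesis using lt by linarith
  qed
  moreover have "?M \<ge> 0" by (intro add_nonneg_nonneg sum_nonneg) auto
  ultimately show ?thesis using that by blast
qed

text \<open>For a point \<open>x\<close> the Riemann sum is a convex combination of centres at distance at most \<open>4\<^sup>-\<^sup>m\<close> from \<open>x\<close>.
  By linearity the Riemann sums of every combination of points converge to it.\<close>
lemma seminorm_dominated:
  obtains J h where "geometric_family (J :: nat \<Rightarrow> ('a \<times> 'a) set) h" "\<And>a. a \<in> LV \<Longrightarrow> q a \<le> family_norm J h (ev a)"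
proof -
  obtain M where M: "M \<ge> 0" "\<And>x. x \<in> topspace K \<Longrightarrow> q (delta x) \<le> M" using seminorm_bounded by blast
  define d where "d x y = q (delta x - delta y)" for x y :: 'a
  interpret P: pseudometric_K K d M
    by unfold_locales (use M(1) seminorm_pseudometric in \<open>simp_all add: d_def[abs_def]\<close>)
  have LVd: "delta x \<in> LV" if "x \<in> topspace K" for x using that by simp
  have dle: "q (delta x - delta y) \<le> d x y" for x y by (simp add: d_def)
  note facts = vector_space_pscale subspace_FV q_add q_scale LVd dle M(2)
  define R where "R m a = P.smoothing pscale delta (ev a) m - a" for m a
  have smooth: "P.smoothing pscale delta (ev a) m = (\<Sum>y\<in>P.I m. pscale (ev a (P.g m y)) (delta y))" for a m
    by (rule P.smoothing_def[OF facts])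
  have R_LV: "R m a \<in> LV" if "a \<in> LV" for m a
    unfolding R_def by (rule subspace_diff[OF subspace_FV P.smoothing_V[OF facts] that])
  have R_add: "R m (pscale c (delta x) + a) = pscale c (R m (delta x)) + R m a" for m c x a
  proof -
    have "P.smoothing pscale delta (ev (pscale c (delta x) + a)) m
        = (\<Sum>y\<in>P.I m. pscale c (pscale (ev (delta x) (P.g m y)) (delta y)) + pscale (ev a (P.g m y)) (delta y))"
      unfolding smooth
    proof (rule sum.cong[OF refl])
      fix y assume "y \<in> P.I m"
      then have "P.g m y \<in> CK" by (rule P.partitionD)
      then have "ev (pscale c (delta x) + a) (P.g m y) = c * ev (delta x) (P.g m y) + ev a (P.g m y)"
        by (simp only: ev_add ev_pscale)
      then show "pscale (ev (pscale c (delta x) + a) (P.g m y)) (delta y)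
          = pscale c (pscale (ev (delta x) (P.g m y)) (delta y)) + pscale (ev a (P.g m y)) (delta y)"
        by (simp only: scale_left_distrib scale_scale)
    qed
    also have "\<dots> = pscale c (P.smoothing pscale delta (ev (delta x)) m) + P.smoothing pscale delta (ev a) m"
      unfolding smooth by (simp only: sum.distrib scale_sum_right)
    finally show ?thesis unfolding R_def by (simp only: scale_right_diff_distrib) simp
  qed
  have R_delta: "q (R m (delta x)) \<le> 1 / 4 ^ m" if x: "x \<in> topspace K" for m x
  proof -
    have "R m (delta x) = (\<Sum>y\<in>P.I m. pscale (P.g m y x) (delta y)) - pscale (\<Sum>y\<in>P.I m. P.g m y x) (delta x)"
      unfolding R_def smooth using P.partitionD(6)[OF x, of m] P.partitionD(3)[of _ m] by (simp add: ev_delta)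
    also have "\<dots> = (\<Sum>y\<in>P.I m. pscale (P.g m y x) (delta y - delta x))"
      by (simp only: scale_sum_left scale_right_diff_distrib sum_subtractf)
    finally have "q (R m (delta x)) \<le> (\<Sum>y\<in>P.I m. \<bar>P.g m y x\<bar> * q (delta y - delta x))"
      using P.q_sum[OF facts P.partitionD(1), of m "\<lambda>y. delta y - delta x" "\<lambda>y. P.g m y x"]
        delta_diff_LV[OF P.partitionD(2) x] by simp
    also have "\<dots> \<le> (\<Sum>y\<in>P.I m. P.g m y x * (1 / 4 ^ m))"
    proof (rule sum_mono)
      fix y assume y: "y \<in> P.I m"
      have nn: "0 \<le> P.g m y x" by (rule P.partitionD(4)[OF y x])
      show "\<bar>P.g m y x\<bar> * q (delta y - delta x) \<le> P.g m y x * (1 / 4 ^ m)"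
      proof (cases "P.g m y x = 0")
        case False
        have "q (delta y - delta x) \<le> 1 / 4 ^ m"
          using P.partitionD(5)[OF y x False] q_minus[OF P.partitionD(2)[OF y] x] by (simp add: d_def)
        then show ?thesis using nn by (simp only: abs_of_nonneg[OF nn] mult_left_mono)
      qed simp
    qed
    also have "\<dots> = 1 / 4 ^ m" unfolding sum_distrib_right[symmetric] P.partitionD(6)[OF x] by simp
    finally show ?thesis .
  qed
  have "\<exists>B. \<forall>m. q (R m a) \<le> B * (1 / 4 ^ m)" if "Poly_Mapping.keys a \<subseteq> topspace K" for a
    using that
  proof (induction rule: FV_induct)
    case zero
    have ev0: "ev 0 f = 0" if "f \<in> CK" for f using that by (simp add: ev_ext)
    have "R m 0 = 0" for m unfolding R_def smooth using ev0 P.partitionD(3) by simp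
    then show ?case using q_scale[of 0 0] by (intro exI[of _ 0]) simp
  next
    case (add c x a)
    obtain B where B: "\<And>m. q (R m a) \<le> B * (1 / 4 ^ m)" using add.IH by blast
    have "q (R m (pscale c (delta x) + a)) \<le> (\<bar>c\<bar> + B) * (1 / 4 ^ m)" for m
    proof -
      have dx: "R m (delta x) \<in> LV" using add.hyps by (intro R_LV) simp
      have aL: "R m a \<in> LV" using add.hyps by (intro R_LV) simp
      have "q (R m (pscale c (delta x) + a)) \<le> q (pscale c (R m (delta x))) + q (R m a)"
        unfolding R_add by (rule q_add[OF pscale_LV[OF dx] aL])
      also have "q (pscale c (R m (delta x))) = \<bar>c\<bar> * q (R m (delta x))" by (rule q_scale[OF dx])
      also have "\<dots> \<le> \<bar>c\<bar> * (1 / 4 ^ m)" by (intro mult_left_mono R_delta add.hyps) simp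
      finally show ?thesis using B[of m] by (simp only: distrib_right) linarith
    qed
    then show ?case by blast
  qed
  then have R_bound: "\<exists>B. \<forall>m. q (R m a) \<le> B * (1 / 4 ^ m)" if "a \<in> LV" for a using that by blast
  have "q a \<le> P.N (ev a)" if a: "a \<in> LV" for a
  proof (rule P.dominated[OF facts ev_dual[OF a] a])
    obtain B where B: "\<And>m. q (R m a) \<le> B * (1 / 4 ^ m)" using R_bound[OF a] by blast
    have "(\<lambda>m. B * (1 / 4) ^ m) \<longlonglongrightarrow> B * 0"
      by (intro tendsto_mult_left LIMSEQ_power_zero) simp
    then have z: "(\<lambda>m. B * (1 / 4 ^ m)) \<longlonglongrightarrow> 0" by (simp add: power_divide)
    have nonneg: "0 \<le> q b" if b: "b \<in> LV" for b
    proof -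
      have "q (b + pscale (-1) b) \<le> q b + q (pscale (-1) b)" by (rule q_add[OF b pscale_LV[OF b]])
      moreover have "q (pscale (-1) b) = q b" using q_scale[OF b, of "-1"] by simp
      moreover have "q (b + pscale (-1) b) = 0" using q_scale[of 0 0] by simp
      ultimately show ?thesis by linarith
    qed
    show "(\<lambda>m. q (P.smoothing pscale delta (ev a) m - a)) \<longlonglongrightarrow> 0"
      using nonneg[OF R_LV[OF a]] B unfolding R_def
      by (intro tendsto_sandwich[OF _ _ tendsto_const z] always_eventually allI)
  qed
  then show ?thesis using that[OF P.geometric_J_h] by blast
qed

end

end

text \<open>The topology \<open>\<tau>\<close> is not coarser than the induced one by the universal property, and not finer
  because every \<open>\<tau>\<close>-continuous seminorm is dominated by the norm of a geometric family.\<close>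
theorem free_lcs_embedding:
  assumes \<tau>: "free_lcs_topology K \<tau>"
  shows "topological_group_embedding (add_monoid FL) \<tau> Mc Mct ev"
proof -
  have lc: "locally_convex_space FL \<tau>" and emb: "embedding_map K \<tau> delta"
    using \<tau> by (auto simp: free_lcs_topology_def)
  note top = lcs_topspace[OF lc]
  interpret vector_space "pscale :: real \<Rightarrow> ('a \<Rightarrow>\<^sub>0 real) \<Rightarrow> _" by (rule vector_space_pscale)
  have delta_cont: "continuous_map K \<tau> delta"
    using homeomorphic_imp_continuous_map[OF emb[unfolded embedding_map_def]]
    by (simp add: continuous_map_in_subtopology)
  have "embedding_map \<tau> Mct ev"
  proof (rule embedding_map_pointwiseI)
    show "continuous_map \<tau> Mct ev" by (rule free_lcs_ev_continuous[OF \<tau>])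
    show "inj_on ev (topspace \<tau>)" unfolding top by (rule ev_inj)
    fix U a assume U: "openin \<tau> U" "a \<in> U"
    then have a: "a \<in> LV" using openin_subset top by blast
    have shift: "continuous_map \<tau> \<tau> (\<lambda>b. a + b)"
      using lcs_continuous_add[OF lc _ continuous_map_id, of "\<lambda>_. a"] a by (simp add: top)
    define U' where "U' = {b \<in> topspace \<tau>. a + b \<in> U}"
    have U': "openin \<tau> U'" unfolding U'_def by (rule openin_continuous_map_preimage[OF shift U(1)])
    have U'0: "0 \<in> U'" using U by (simp add: U'_def top)
    obtain q where q: "\<And>a b. a \<in> LV \<Longrightarrow> b \<in> LV \<Longrightarrow> q (a + b) \<le> q a + q b"
      "\<And>a c. a \<in> LV \<Longrightarrow> q (pscale c a) = \<bar>c\<bar> * q a"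
      "\<And>a. a \<in> LV \<Longrightarrow> q a < 1 \<Longrightarrow> a \<in> U'"
      "\<And>e. e > 0 \<Longrightarrow> \<exists>B. openin \<tau> B \<and> 0 \<in> B \<and> (\<forall>a\<in>B. q a < e)"
      by (rule continuous_seminorm_exists[OF lc U' U'0]) blast
    obtain J h where geo: "geometric_family (J :: nat \<Rightarrow> ('a \<times> 'a) set) h"
      and dom: "\<And>a. a \<in> LV \<Longrightarrow> q a \<le> family_norm J h (ev a)"
      by (rule seminorm_dominated[OF lc q(1,2,4) delta_cont]) (assumption+, rule that)
    obtain V where V: "openin Mct V" "ev a \<in> V"
      "\<And>\<psi>. \<psi> \<in> V \<Longrightarrow> family_norm J h (\<psi> \<otimes>\<^bsub>Mc\<^esub> inv\<^bsub>Mc\<^esub> (ev a)) < 1"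
      by (rule family_norm_nbhd[OF geo ev_dual[OF a] zero_less_one]) blast
    have "b \<in> U" if b: "b \<in> LV" "ev b \<in> V" for b
    proof -
      have ba: "b - a \<in> LV" by (rule subspace_diff[OF subspace_FV b(1) a])
      have "ev (b - a) = ev b \<otimes>\<^bsub>Mc\<^esub> inv\<^bsub>Mc\<^esub> (ev a)"
        unfolding Mc_diff[OF geo ev_dual[OF b(1)] ev_dual[OF a]]
        by (rule extensionalityI[of _ CK]) (simp_all add: ev_diff, simp add: ev_ext)
      then have "q (b - a) < 1" using dom[OF ba] V(3)[OF b(2)] by simp
      then have "b - a \<in> U'" by (rule q(3)[OF ba])
      then show ?thesis by (simp add: U'_def)
    qed
    then show "\<exists>W. openin Mct W \<and> ev a \<in> W \<and> (\<forall>b\<in>topspace \<tau>. ev b \<in> W \<longrightarrow> b \<in> U)"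
      unfolding top using V by blast
  qed
  then show ?thesis
    using ev_hom by (simp add: topological_group_embedding_def top carrier_FL Mc_topspace Mc_simps FV_simps)
qed

lemma embedded_group_unitarily_representable:
  assumes emb: "topological_group_embedding G \<tau> Mc Mct h" and G: "topological_abelian_group G \<tau>"
  shows "unitarily_representable G \<tau>"
proof (rule pd_separated_imp_unitarily_representable)
  show "comm_group G" "topspace \<tau> = carrier G" "Hausdorff_space \<tau>"
    using G by (auto simp: topological_abelian_group_def)
  then show "pd_separated G \<tau>"
    using pd_separated_embedding[OF emb _ Mc_comm_group Mc_pd_separated] by blast
qed

theorem Mc_unitarily_representable: "unitarily_representable Mc Mct"
  using pd_separated_imp_unitarily_representable[OF Mc_comm_group _ _ Mc_pd_separated] Mc_topological_abelian_group
  by (simp add: topological_abelian_group_def)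

end

section \<open>Pseudonorms on topological Abelian groups\<close>

text \<open>The combinatorial core of the Birkhoff-Kakutani theorem.  Cut the list after the longest proper
  prefix of weight less than half the bound \<open>2\<^sup>-\<^sup>n\<close>: the prefix, the next entry and the remainder each have
  their sum in \<open>U (Suc n)\<close>.\<close>
lemma weighted_chain_mem:
  fixes U :: "nat \<Rightarrow> 'e::ab_group_add set"
  assumes U0: "\<And>n. 0 \<in> U n"
    and trip: "\<And>n a b c. a \<in> U (Suc n) \<Longrightarrow> b \<in> U (Suc n) \<Longrightarrow> c \<in> U (Suc n) \<Longrightarrow> a + b + c \<in> U n"
  shows "\<forall>p\<in>set l. snd p \<in> U (fst p) \<Longrightarrow> (\<Sum>p\<leftarrow>l. (1 / 2 :: real) ^ fst p) < (1 / 2) ^ n \<Longrightarrow>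
    sum_list (map snd l) \<in> U n"
proof (induction "length l" arbitrary: l n rule: less_induct)
  case less
  have antimono: "U (n + k) \<subseteq> U n" for n k
  proof (induction k)
    case (Suc k)
    have "U (Suc (n + k)) \<subseteq> U (n + k)" using trip[of _ "n + k" 0 0] U0 by force
    then show ?case using Suc by simp
  qed simp
  define w where "w l = (\<Sum>p\<leftarrow>l. (1 / 2 :: real) ^ fst p)" for l :: "(nat \<times> 'e) list"
  have w_append: "w (l1 @ l2) = w l1 + w l2" for l1 l2 by (simp add: w_def)
  have w_nonneg: "0 \<le> w l" for l unfolding w_def by (rule sum_list_nonneg) auto
  show ?case
  proof (cases "l = []")
    case True
    then show ?thesis using U0 by simp
  next
    case False
    \<comment> \<open>the index 0 belongs to this set, as the empty prefix has weight 0\<close>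
    let ?I = "{i. i < length l \<and> w (take i l) < (1 / 2) ^ Suc n}"
    have fin: "finite ?I" by simp
    have "0 \<in> ?I" using False by (simp add: w_def)
    then have ne: "?I \<noteq> {}" by blast
    define i where "i = Max ?I"
    have i: "i < length l" "w (take i l) < (1 / 2) ^ Suc n"
      using Max_in[OF fin ne] by (auto simp: i_def)
    have split: "l = take i l @ l ! i # drop (Suc i) l" using i(1) by (rule id_take_nth_drop)
    have wl: "w l < (1 / 2) ^ n" using less.prems by (simp add: w_def)
    have split_w: "w l = w (take i l) + (1 / 2) ^ fst (l ! i) + w (drop (Suc i) l)"
      by (subst split, subst w_append) (simp add: w_def)
    have tail: "w (drop (Suc i) l) < (1 / 2) ^ Suc n"
    proof (cases "Suc i < length l")
      case True
      have "Suc i \<notin> ?I"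
      proof
        assume "Suc i \<in> ?I"
        then have "Suc i \<le> i" unfolding i_def by (rule Max_ge[OF fin])
        then show False by simp
      qed
      then have "w (take (Suc i) l) \<ge> (1 / 2) ^ Suc n" using True by simp
      moreover have "w l = w (take (Suc i) l) + w (drop (Suc i) l)"
        using w_append[of "take (Suc i) l" "drop (Suc i) l"] by simp
      ultimately show ?thesis using wl by simp
    next
      case False
      then show ?thesis by (simp add: w_def)
    qed
    have "(1 / 2 :: real) ^ fst (l ! i) < (1 / 2) ^ n"
      using split_w wl w_nonneg[of "take i l"] w_nonneg[of "drop (Suc i) l"] by linarith
    then have "n < fst (l ! i)" by (subst (asm) power_strict_decreasing_iff) auto
    then obtain j where "fst (l ! i) = Suc n + j" using less_iff_Suc_add by auto
    moreover have "snd (l ! i) \<in> U (fst (l ! i))" using less.prems(1) i(1) by simp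
    ultimately have mid: "snd (l ! i) \<in> U (Suc n)" using antimono[of "Suc n" j] by auto
    have l1: "sum_list (map snd (take i l)) \<in> U (Suc n)"
      using i less.prems(1) by (intro less.hyps) (auto simp: w_def dest: in_set_takeD)
    have l2: "sum_list (map snd (drop (Suc i) l)) \<in> U (Suc n)"
      using i tail less.prems(1) by (intro less.hyps) (auto simp: w_def dest: in_set_dropD)
    have "sum_list (map snd l) = sum_list (map snd (take i l)) + snd (l ! i) + sum_list (map snd (drop (Suc i) l))"
      by (subst split) (simp add: add.assoc)
    then show ?thesis using trip[OF l1 mid l2] by simp
  qed
qed

text \<open>The largest subadditive function with \<open>q a \<le> 2\<^sup>-\<^sup>n\<close> on \<open>U n\<close>, truncated at 1.\<close>
lemma pseudonorm_exists:
  fixes U :: "nat \<Rightarrow> 'e::ab_group_add set"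
  assumes U0: "\<And>n. 0 \<in> U n"
    and trip: "\<And>n a b c. a \<in> U (Suc n) \<Longrightarrow> b \<in> U (Suc n) \<Longrightarrow> c \<in> U (Suc n) \<Longrightarrow> a + b + c \<in> U n"
    and sym: "\<And>n a. a \<in> U n \<Longrightarrow> - a \<in> U n"
  obtains q :: "'e \<Rightarrow> real" where "\<And>a b. q (a + b) \<le> q a + q b" "\<And>a. q (- a) = q a"
    "\<And>a. 0 \<le> q a" "\<And>a. q a \<le> 1" "q 0 = 0" "\<And>a. q a < 1 \<Longrightarrow> a \<in> U 0" "\<And>a n. a \<in> U n \<Longrightarrow> q a \<le> (1 / 2) ^ n"
proof -
  define w where "w l = (\<Sum>p\<leftarrow>l. (1 / 2 :: real) ^ fst p)" for l :: "(nat \<times> 'e) list"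
  define good where "good l \<longleftrightarrow> (\<forall>p\<in>set l. snd p \<in> U (fst p))" for l :: "(nat \<times> 'e) list"
  define L where "L a = insert 1 {w l | l. good l \<and> sum_list (map snd l) = a}" for a
  define q where "q a = Inf (L a)" for a
  have w_nonneg: "0 \<le> w l" for l unfolding w_def by (rule sum_list_nonneg) auto
  have bdd: "bdd_below (L a)" for a by (rule bdd_belowI[of _ 0]) (auto simp: L_def w_nonneg)
  have ne: "L a \<noteq> {}" for a by (simp add: L_def)
  have q_le: "q a \<le> r" if "r \<in> L a" for a r unfolding q_def by (rule cInf_lower[OF that bdd])
  have le_q: "r \<le> q a" if "\<And>t. t \<in> L a \<Longrightarrow> r \<le> t" for a r
    unfolding q_def by (rule cInf_greatest[OF ne that])
  have q_less: "\<exists>t\<in>L a. t < r" if "q a < r" for a r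
    using that cInf_less_iff[OF ne bdd] by (simp add: q_def)
  have q0: "0 \<le> q a" for a by (rule le_q) (auto simp: L_def w_nonneg)
  have q1: "q a \<le> 1" for a by (rule q_le) (simp add: L_def)
  have L_word: "w l \<in> L a" if "good l" "sum_list (map snd l) = a" for l a using that by (auto simp: L_def)
  show ?thesis
  proof (rule that[of q])
    show "q (a + b) \<le> q a + q b" for a b
    proof (rule field_le_epsilon)
      fix e :: real assume e: "e > 0"
      obtain s where s: "s \<in> L a" "s < q a + e / 2" using q_less[of a "q a + e / 2"] e by auto
      obtain t where t: "t \<in> L b" "t < q b + e / 2" using q_less[of b "q b + e / 2"] e by auto
      have nn: "0 \<le> s" "0 \<le> t" using s(1) t(1) w_nonneg by (auto simp: L_def)
      have "q (a + b) \<le> s + t"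
      proof (cases "s = 1 \<or> t = 1")
        case True
        then show ?thesis using q1[of "a + b"] nn by auto
      next
        case False
        then obtain k l where "s = w k" "good k" "sum_list (map snd k) = a"
          "t = w l" "good l" "sum_list (map snd l) = b" using s(1) t(1) by (auto simp: L_def)
        then show ?thesis
          using q_le[OF L_word[of "k @ l" "a + b"]] by (simp add: good_def w_def ball_Un)
      qed
      then show "q (a + b) \<le> q a + q b + e" using s t by linarith
    qed
    have neg_le: "q (- a) \<le> q a" for a
    proof (rule le_q)
      fix t assume "t \<in> L a"
      then consider "t = 1" | l where "t = w l" "good l" "sum_list (map snd l) = a" by (auto simp: L_def)
      then show "q (- a) \<le> t"
      proof cases
        case 2
        let ?k = "map (\<lambda>p. (fst p, - snd p)) l"
        have "good ?k" using 2(2) sym by (auto simp: good_def)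
        moreover have "sum_list (map snd ?k) = - a"
          using uminus_sum_list_map[of snd l] 2(3) by (simp add: comp_def)
        moreover have "w ?k = w l" by (simp add: w_def comp_def)
        ultimately show ?thesis using q_le[OF L_word[of ?k "- a"]] 2(1) by simp
      qed (simp add: q1)
    qed
    show "q (- a) = q a" for a using neg_le[of a] neg_le[of "- a"] by simp
    have "w [] \<in> L 0" by (rule L_word) (auto simp: good_def)
    then have "q 0 \<le> 0" using q_le by (force simp: w_def)
    then show "q 0 = 0" using q0[of 0] by simp
    show "a \<in> U 0" if small: "q a < 1" for a
    proof -
      obtain t where t: "t \<in> L a" "t < 1" using q_less[OF small] by blast
      then obtain l where l: "t = w l" "good l" "sum_list (map snd l) = a" by (auto simp: L_def)
      have "sum_list (map snd l) \<in> U 0"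
        by (rule weighted_chain_mem[of U, OF U0 trip]) (use l t in \<open>auto simp: good_def w_def\<close>)
      then show ?thesis using l by simp
    qed
    show "q a \<le> (1 / 2) ^ n" if "a \<in> U n" for a n
      using q_le[OF L_word[of "[(n, a)]" a]] that by (simp add: good_def w_def)
  qed (rule q0 q1)+
qed

section \<open>The assignment problem\<close>

text \<open>The cost of an alternating walk in the residual graph of the matching \<open>x i \<mapsto> y i\<close>: from \<open>z\<close> move to
  \<open>y i\<close> at cost \<open>d z (y i)\<close>, return from \<open>y i\<close> to \<open>x i\<close> with gain \<open>d (x i) (y i)\<close>, and continue.\<close>
primrec walk_cost :: "('k \<Rightarrow> 'k \<Rightarrow> real) \<Rightarrow> (nat \<Rightarrow> 'k) \<Rightarrow> (nat \<Rightarrow> 'k) \<Rightarrow> nat list \<Rightarrow> 'k \<Rightarrow> real" where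
  "walk_cost d x y [] z = 0"
| "walk_cost d x y (i # l) z = d z (y i) - d (x i) (y i) + walk_cost d x y l (x i)"

primrec path_sum :: "('i \<Rightarrow> 'i \<Rightarrow> real) \<Rightarrow> 'i \<Rightarrow> 'i list \<Rightarrow> real" where
  "path_sum w i [] = 0"
| "path_sum w i (j # l) = w i j + path_sum w j l"

lemma path_sum_append: "path_sum w i (p @ j # r) = path_sum w i (p @ [j]) + path_sum w j r"
  by (induction p arbitrary: i) auto

lemma path_sum_snoc: "path_sum w i (l @ [j]) = path_sum w i l + w (last (i # l)) j"
  by (induction l arbitrary: i) auto

lemma walk_cost_path_sum:
  "walk_cost d x y (i # l) z = d z (y i) + path_sum (\<lambda>i j. d (x i) (y j) - d (x i) (y i)) i l
     - d (x (last (i # l))) (y (last (i # l)))"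
  by (induction l arbitrary: i z) auto

lemma path_sum_zip: "path_sum w i (l @ [h]) = sum_list (map2 w (i # l) (l @ [h]))"
  by (induction l arbitrary: i) auto

text \<open>A closed path without repetition is a cyclic permutation.  A repetition cuts a closed path into two
  shorter closed paths.\<close>
lemma closed_path_sum_nonneg:
  assumes fin: "finite S" and diag: "\<And>i. w i i = 0"
    and perm: "\<And>\<sigma>. \<sigma> permutes S \<Longrightarrow> 0 \<le> (\<Sum>i\<in>S. w i (\<sigma> i))"
  shows "set (i # l) \<subseteq> S \<Longrightarrow> 0 \<le> path_sum w i (l @ [i])"
proof (induction "length l" arbitrary: i l rule: less_induct)
  case less
  show ?case
  proof (cases "distinct (i # l)")
    case True
    let ?\<sigma> = "cycle_of_list (i # l)"
    have "map ?\<sigma> (i # l) = l @ [i]" using cyclic_rotation[OF True, of 1] by simp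
    then have "path_sum w i (l @ [i]) = sum_list (map2 w (i # l) (map ?\<sigma> (i # l)))"
      by (simp only: path_sum_zip)
    also have "\<dots> = sum_list (map (\<lambda>j. w j (?\<sigma> j)) (i # l))"
    proof -
      have "map2 w k (map f k) = map (\<lambda>j. w j (f j)) k" for f and k :: "'a list" by (induction k) auto
      then show ?thesis by (simp only:)
    qed
    also have "\<dots> = (\<Sum>j\<in>set (i # l). w j (?\<sigma> j))" by (rule sum_list_distinct_conv_sum_set[OF True])
    also have "\<dots> = (\<Sum>j\<in>S. w j (?\<sigma> j))"
      by (rule sum.mono_neutral_left[OF fin less.prems]) (use id_outside_supp[of _ "i # l"] diag in auto)
    also have "0 \<le> \<dots>"
      by (rule perm, rule permutes_subset[OF cycle_permutes less.prems])
    finally show ?thesis .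
  next
    case False
    then obtain xs j ys zs where dec: "i # l = xs @ [j] @ ys @ [j] @ zs" using not_distinct_decomp by blast
    have jS: "j \<in> S" "set ys \<subseteq> S" "set zs \<subseteq> S" "set xs \<subseteq> S" using less.prems dec by auto
    have loop: "0 \<le> path_sum w j (ys @ [j])"
    proof (rule less.hyps)
      have "length (i # l) = length (xs @ [j] @ ys @ [j] @ zs)" by (simp only: dec)
      then show "length ys < length l" by simp
    qed (use jS in auto)
    show ?thesis
    proof (cases xs)
      case Nil
      then have eq: "i = j" "l = ys @ [j] @ zs" using dec by auto
      have "0 \<le> path_sum w j (zs @ [j])"
        by (rule less.hyps) (use eq jS in auto)
      moreover have "path_sum w i (l @ [i]) = path_sum w j (ys @ [j]) + path_sum w j (zs @ [j])"
        using path_sum_append[of w j ys j "zs @ [j]"] eq by simp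
      ultimately show ?thesis using loop by simp
    next
      case (Cons i' xs')
      then have eq: "i' = i" "l = xs' @ [j] @ ys @ [j] @ zs" using dec by auto
      have "0 \<le> path_sum w i ((xs' @ [j] @ zs) @ [i])"
        by (rule less.hyps) (use eq jS Cons less.prems in auto)
      moreover have "path_sum w i (l @ [i]) = path_sum w i (xs' @ [j]) + path_sum w j (ys @ [j]) + path_sum w j (zs @ [i])"
        using path_sum_append[of w i xs' j "ys @ [j] @ zs @ [i]"] path_sum_append[of w j ys j "zs @ [i]"] eq by simp
      moreover have "path_sum w i ((xs' @ [j] @ zs) @ [i]) = path_sum w i (xs' @ [j]) + path_sum w j (zs @ [i])"
        using path_sum_append[of w i xs' j "zs @ [i]"] by simp
      ultimately show ?thesis using loop by simp
    qed
  qed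
qed

text \<open>A cheapest matching admits no closed alternating walk of negative cost.  Therefore the infimum \<open>f z\<close> of
  the costs of all walks from \<open>z\<close> is finite.  It is 1-Lipschitz, and since a walk from \<open>x i\<close> can be preceded
  by the step from \<open>y i\<close> to \<open>x i\<close>, it drops by at least \<open>d (x i) (y i)\<close> from \<open>x i\<close> to \<open>y i\<close>.\<close>
lemma assignment_duality:
  fixes d :: "'k \<Rightarrow> 'k \<Rightarrow> real" and x y :: "nat \<Rightarrow> 'k"
  assumes d0: "\<And>u. u \<in> S \<Longrightarrow> d u u = 0"
    and sym: "\<And>u v. u \<in> S \<Longrightarrow> v \<in> S \<Longrightarrow> d u v = d v u"
    and tri: "\<And>u v z. u \<in> S \<Longrightarrow> v \<in> S \<Longrightarrow> z \<in> S \<Longrightarrow> d u z \<le> d u v + d v z"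
    and nn: "\<And>u v. 0 \<le> d u v" and le: "\<And>u v. d u v \<le> M"
    and xS: "\<And>i. i < n \<Longrightarrow> x i \<in> S" and yS: "\<And>i. i < n \<Longrightarrow> y i \<in> S"
  obtains \<sigma> f where "\<sigma> permutes {..<n}" "\<And>u v. u \<in> S \<Longrightarrow> v \<in> S \<Longrightarrow> \<bar>f u - f v\<bar> \<le> d u v"
    "\<And>u. u \<in> S \<Longrightarrow> \<bar>f u\<bar> \<le> M" "(\<Sum>i<n. d (x i) (y (\<sigma> i))) \<le> (\<Sum>i<n. f (x i)) - (\<Sum>i<n. f (y i))"
proof -
  let ?P = "{\<sigma>. \<sigma> permutes {..<n}}" and ?F = "\<lambda>\<sigma>. \<Sum>i<n. d (x i) (y (\<sigma> i))"
  have fin: "finite (?F ` ?P)" by (intro finite_imageI finite_permutations) simp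
  moreover have "?F ` ?P \<noteq> {}" using permutes_id[of "{..<n}"] by blast
  ultimately have "Min (?F ` ?P) \<in> ?F ` ?P" using fin by (intro Min_in)
  then obtain \<sigma> where \<sigma>: "\<sigma> permutes {..<n}" and \<sigma>_Min: "Min (?F ` ?P) = ?F \<sigma>"
    by (elim imageE) simp
  have min: "?F \<sigma> \<le> ?F \<rho>" if "\<rho> permutes {..<n}" for \<rho>
    unfolding \<sigma>_Min[symmetric] by (rule Min_le[OF fin]) (use that in blast)
  define y' where "y' i = y (\<sigma> i)" for i
  have y'S: "y' i \<in> S" if "i < n" for i
    using yS[of "\<sigma> i"] permutes_in_image[OF \<sigma>, of i] that by (simp add: y'_def)
  define w where "w i j = d (x i) (y' j) - d (x i) (y' i)" for i j
  have closed: "0 \<le> path_sum w i (l @ [i])" if "set (i # l) \<subseteq> {..<n}" for i l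
  proof (rule closed_path_sum_nonneg[OF _ _ _ that])
    show "w i i = 0" for i by (simp add: w_def)
    show "0 \<le> (\<Sum>i\<in>{..<n}. w i (\<rho> i))" if \<rho>: "\<rho> permutes {..<n}" for \<rho>
      using min[OF permutes_compose[OF \<rho> \<sigma>]] by (simp add: w_def y'_def sum_subtractf)
  qed simp
  define walks where "walks = {l :: nat list. set l \<subseteq> {..<n}}"
  have M: "0 \<le> M" using nn le order_trans by blast
  have lower: "- M \<le> walk_cost d x y' l z" if l: "l \<in> walks" for l z
  proof (cases l)
    case Nil
    then show ?thesis using M by simp
  next
    case (Cons i k)
    have "0 \<le> path_sum w i (k @ [i])" using l Cons by (intro closed) (simp add: walks_def)
    also have "\<dots> = path_sum w i k + w (last (i # k)) i" by (rule path_sum_snoc)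
    also have "\<dots> = walk_cost d x y' l z - d z (y' i) + d (x (last (i # k))) (y' i)"
      unfolding Cons walk_cost_path_sum w_def[abs_def] by simp
    finally show ?thesis using nn[of z "y' i"] le[of "x (last (i # k))" "y' i"] by linarith
  qed
  define f where "f z = (INF l\<in>walks. walk_cost d x y' l z)" for z
  have ne: "walks \<noteq> {}" "[] \<in> walks" by (auto simp: walks_def intro: exI[of _ "[]"])
  have bdd: "bdd_below ((\<lambda>l. walk_cost d x y' l z) ` walks)" for z
    by (rule bdd_belowI2[where m = "- M"]) (rule lower)
  have f_le: "f z \<le> walk_cost d x y' l z" if "l \<in> walks" for l z
    unfolding f_def by (rule cINF_lower[OF bdd that])
  have le_f: "r \<le> f z" if "\<And>l. l \<in> walks \<Longrightarrow> r \<le> walk_cost d x y' l z" for r z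
    unfolding f_def by (rule cINF_greatest[OF ne(1) that])
  have one_side: "f u - d u v \<le> f v" if uv: "u \<in> S" "v \<in> S" for u v
  proof (rule le_f)
    fix l assume l: "l \<in> walks"
    have "walk_cost d x y' l u \<le> d u v + walk_cost d x y' l v"
    proof (cases l)
      case Nil
      then show ?thesis using nn by simp
    next
      case (Cons i k)
      then have "y' i \<in> S" using l by (intro y'S) (simp add: walks_def)
      from tri[OF uv this] show ?thesis using Cons by simp
    qed
    then show "f u - d u v \<le> walk_cost d x y' l v" using f_le[OF l, of u] by linarith
  qed
  have gain: "d (x i) (y' i) \<le> f (x i) - f (y' i)" if i: "i < n" for i
  proof -
    have "f (y' i) + d (x i) (y' i) \<le> f (x i)"
    proof (rule le_f)
      fix l assume l: "l \<in> walks"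
      then have "i # l \<in> walks" using i by (simp add: walks_def)
      from f_le[OF this, of "y' i"] show "f (y' i) + d (x i) (y' i) \<le> walk_cost d x y' l (x i)"
        using d0[OF y'S[OF i]] by simp
    qed
    then show ?thesis by simp
  qed
  show ?thesis
  proof (rule that[OF \<sigma>])
    show "\<bar>f u - f v\<bar> \<le> d u v" if "u \<in> S" "v \<in> S" for u v
      using one_side[OF that] one_side[OF that(2,1)] sym[OF that] by linarith
    show "\<bar>f u\<bar> \<le> M" for u
      using f_le[OF ne(2), of u] le_f[of "- M" u] lower M by fastforce
    have "(\<Sum>i<n. d (x i) (y (\<sigma> i))) \<le> (\<Sum>i<n. f (x i) - f (y' i))"
      using gain by (intro sum_mono) (simp add: y'_def)
    also have "\<dots> = (\<Sum>i<n. f (x i)) - (\<Sum>i<n. f (y i))"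
      using sum.permute[OF \<sigma>, of "\<lambda>i. f (y i)"] by (simp add: sum_subtractf y'_def comp_def)
    finally show "(\<Sum>i<n. d (x i) (y (\<sigma> i))) \<le> \<dots>" .
  qed
qed

text \<open>Split off a point of positive and a point of negative coefficient.\<close>
lemma balanced_decomposition:
  fixes a :: "'k \<Rightarrow>\<^sub>0 int"
  assumes "finite T" "Poly_Mapping.keys a \<subseteq> T" "(\<Sum>u\<in>T. Poly_Mapping.lookup a u) = 0"
  shows "\<exists>n x y. (\<forall>i<(n::nat). x i \<in> T \<and> y i \<in> T) \<and> a = (\<Sum>i<n. frag_of (x i) - frag_of (y i))"
  using assms(2,3)
proof (induction "\<Sum>u\<in>T. nat \<bar>Poly_Mapping.lookup a u\<bar>" arbitrary: a rule: less_induct)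
  case less
  let ?l = "Poly_Mapping.lookup"
  show ?case
  proof (cases "a = 0")
    case True
    then show ?thesis by (intro exI[of _ 0]) simp
  next
    case False
    have zero_outside: "?l a u = 0" if "u \<notin> T" for u using that less.prems(1) by (auto simp: in_keys_iff)
    have "\<exists>u\<in>T. ?l a u > 0"
    proof (rule ccontr)
      assume "\<not> ?thesis"
      then have np: "\<And>u. u \<in> T \<Longrightarrow> ?l a u \<le> 0" by force
      then have "(\<Sum>u\<in>T. - ?l a u) = 0" using less.prems(2) by (simp add: sum_negf)
      then have "\<forall>u\<in>T. - ?l a u = 0" using np by (subst (asm) sum_nonneg_eq_0_iff[OF assms(1)]) auto
      then have "a = 0" using zero_outside by (intro poly_mapping_eqI) (metis lookup_zero neg_equal_0_iff_equal)
      then show False using False by simp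
    qed
    then obtain u where u: "u \<in> T" "?l a u > 0" by blast
    have "\<exists>v\<in>T. ?l a v < 0"
    proof (rule ccontr)
      assume "\<not> ?thesis"
      then have np: "\<And>v. v \<in> T \<Longrightarrow> 0 \<le> ?l a v" by force
      then have "\<forall>v\<in>T. ?l a v = 0" using less.prems(2) by (subst (asm) sum_nonneg_eq_0_iff[OF assms(1)]) auto
      then show False using u by auto
    qed
    then obtain v where v: "v \<in> T" "?l a v < 0" by blast
    have uv: "u \<noteq> v" using u v by auto
    define b where "b = a - (frag_of u - frag_of v)"
    have lb: "?l b t = ?l a t - (if t = u then 1 else 0) + (if t = v then 1 else 0)" for t
      by (simp add: b_def lookup_minus)
    have "(\<Sum>t\<in>T. nat \<bar>?l b t\<bar>) < (\<Sum>t\<in>T. nat \<bar>?l a t\<bar>)"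
    proof (rule sum_strict_mono_ex1[OF assms(1)])
      show "\<forall>t\<in>T. nat \<bar>?l b t\<bar> \<le> nat \<bar>?l a t\<bar>" using u v by (auto simp: lb)
      show "\<exists>t\<in>T. nat \<bar>?l b t\<bar> < nat \<bar>?l a t\<bar>" using u uv by (intro bexI[of _ u]) (auto simp: lb)
    qed
    moreover have "Poly_Mapping.keys b \<subseteq> T"
    proof
      fix t assume "t \<in> Poly_Mapping.keys b"
      then have "?l b t \<noteq> 0" by (simp add: in_keys_iff)
      then show "t \<in> T" using u v zero_outside[of t] by (auto simp: lb split: if_splits)
    qed
    moreover have "(\<Sum>t\<in>T. ?l b t) = 0"
    proof -
      have "(\<Sum>t\<in>T. ?l b t) = (\<Sum>t\<in>T. ?l a t) - (\<Sum>t\<in>T. if t = u then 1 else 0) + (\<Sum>t\<in>T. if t = v then 1 else 0)"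
        unfolding lb by (simp only: sum.distrib sum_subtractf)
      then show ?thesis using u v assms(1) less.prems(2) by (simp add: sum.delta)
    qed
    ultimately obtain n x y where nxy: "\<forall>i<(n::nat). x i \<in> T \<and> y i \<in> T" "b = (\<Sum>i<n. frag_of (x i) - frag_of (y i))"
      using less.hyps by blast
    have "a = (\<Sum>i<Suc n. frag_of ((x(n := u)) i) - frag_of ((y(n := v)) i))"
      using nxy(2) by (simp add: b_def algebra_simps)
    moreover have "\<forall>i<Suc n. (x(n := u)) i \<in> T \<and> (y(n := v)) i \<in> T"
      using nxy(1) u v by (auto simp: less_Suc_eq)
    ultimately show ?thesis by blast
  qed
qed

section \<open>The free Abelian topological group\<close>

lemma symmetric_triple_nbhd:
  fixes T :: "('k \<Rightarrow>\<^sub>0 int) topology"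
  assumes G: "topological_abelian_group (free_Abelian_group S) T" and U: "openin T U" "0 \<in> U"
  obtains V where "openin T V" "0 \<in> V" "\<And>a. a \<in> V \<Longrightarrow> - a \<in> V"
    "\<And>a b c. a \<in> V \<Longrightarrow> b \<in> V \<Longrightarrow> c \<in> V \<Longrightarrow> a + b + c \<in> U"
proof -
  have top: "topspace T = carrier (free_Abelian_group S)"
    and add: "continuous_map (prod_topology T T) T (\<lambda>(x, y). x + y)"
    and inv: "continuous_map T T (\<lambda>x. inv\<^bsub>free_Abelian_group S\<^esub> x)"
    using G by (auto simp: topological_abelian_group_def)
  have zero: "0 \<in> topspace T" by (simp add: top)
  have half: "\<exists>V. openin T V \<and> 0 \<in> V \<and> (\<forall>a\<in>V. \<forall>b\<in>V. a + b \<in> U)" if U: "openin T U" "0 \<in> U" for U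
  proof -
    let ?P = "{p \<in> topspace (prod_topology T T). (case p of (x, y) \<Rightarrow> x + y) \<in> U}"
    have "openin (prod_topology T T) ?P" by (rule openin_continuous_map_preimage[OF add U(1)])
    moreover have "(0, 0) \<in> ?P" using U zero by simp
    ultimately have "\<exists>V W. openin T V \<and> openin T W \<and> 0 \<in> V \<and> 0 \<in> W \<and> V \<times> W \<subseteq> ?P"
      unfolding openin_prod_topology_alt by blast
    then obtain V W where VW: "openin T V" "openin T W" "0 \<in> V" "0 \<in> W" "V \<times> W \<subseteq> ?P" by blast
    have "a + b \<in> U" if "a \<in> V \<inter> W" "b \<in> V \<inter> W" for a b
    proof -
      have "(a, b) \<in> ?P" by (rule subsetD[OF VW(5)]) (use that in simp)
      then show ?thesis by simp
    qed
    then show ?thesis using VW by (intro exI[of _ "V \<inter> W"]) auto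
  qed
  obtain V where V: "openin T V" "0 \<in> V" "\<And>a b. a \<in> V \<Longrightarrow> b \<in> V \<Longrightarrow> a + b \<in> U" using half[OF U] by blast
  obtain W where W: "openin T W" "0 \<in> W" "\<And>a b. a \<in> W \<Longrightarrow> b \<in> W \<Longrightarrow> a + b \<in> V" using half[OF V(1,2)] by blast
  define X where "X = W \<inter> {a \<in> topspace T. inv\<^bsub>free_Abelian_group S\<^esub> a \<in> W}"
  have X_iff: "a \<in> X \<longleftrightarrow> Poly_Mapping.keys a \<subseteq> S \<and> a \<in> W \<and> - a \<in> W" for a
    by (auto simp: X_def top)
  show ?thesis
  proof (rule that[of X])
    show "openin T X" unfolding X_def by (intro openin_Int W openin_continuous_map_preimage[OF inv])
    show "0 \<in> X" using W(2) by (simp add: X_iff)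
    show "- a \<in> X" if "a \<in> X" for a using that by (simp add: X_iff)
    show "a + b + c \<in> U" if "a \<in> X" "b \<in> X" "c \<in> X" for a b c
    proof -
      have "a + b \<in> V" "c + 0 \<in> V" using that W(2) by (intro W(3); simp add: X_iff)+
      then show ?thesis using V(3)[of "a + b" c] by simp
    qed
  qed
qed

lemma free_Abelian_group_pseudonorm:
  fixes T :: "('k \<Rightarrow>\<^sub>0 int) topology"
  assumes G: "topological_abelian_group (free_Abelian_group S) T" and U: "openin T U" "0 \<in> U"
  obtains q where "\<And>a b. q (a + b) \<le> q a + q b" "\<And>a. q (- a) = q a"
    "\<And>a. 0 \<le> q a" "\<And>a. q a \<le> (1 :: real)" "q 0 = 0" "\<And>a. q a < 1 \<Longrightarrow> a \<in> U"
    "\<And>e. e > 0 \<Longrightarrow> \<exists>B. openin T B \<and> 0 \<in> B \<and> (\<forall>a\<in>B. q a < e)"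
proof -
  let ?ok = "\<lambda>V. openin T V \<and> 0 \<in> V"
  let ?R = "\<lambda>U V. ?ok V \<and> (\<forall>a\<in>V. - a \<in> V) \<and> (\<forall>a\<in>V. \<forall>b\<in>V. \<forall>c\<in>V. a + b + c \<in> U)"
  have ex: "\<exists>V. ?R U V" if okU: "?ok U" for U
  proof -
    obtain V where "openin T V" "0 \<in> V" "\<And>a. a \<in> V \<Longrightarrow> - a \<in> V"
      "\<And>a b c. a \<in> V \<Longrightarrow> b \<in> V \<Longrightarrow> c \<in> V \<Longrightarrow> a + b + c \<in> U"
      by (rule symmetric_triple_nbhd[OF G conjunct1[OF okU] conjunct2[OF okU]]) (rule that)
    then show ?thesis by (intro exI[of _ V]) simp
  qed
  define step where "step U = (SOME V. ?R U V)" for U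
  have step: "?R U (step U)" if "?ok U" for U
    unfolding step_def by (rule someI_ex[OF ex[OF that]])
  define V where "V n = (step ^^ Suc n) U" for n
  have ok: "?ok ((step ^^ n) U)" for n
  proof (induction n)
    case (Suc n)
    then show ?case using step[OF Suc.IH] by simp
  qed (use U in simp)
  have V: "?R ((step ^^ n) U) (V n)" for n using step[OF ok[of n]] by (simp add: V_def)
  have V_Suc: "?R (V n) (V (Suc n))" for n using V[of "Suc n"] by (simp add: V_def)
  obtain q where q: "\<And>a b. q (a + b) \<le> q a + q b" "\<And>a. q (- a) = q a"
    "\<And>a. 0 \<le> q a" "\<And>a. q a \<le> (1 :: real)" "q 0 = 0" "\<And>a. q a < 1 \<Longrightarrow> a \<in> V 0" "\<And>a n. a \<in> V n \<Longrightarrow> q a \<le> (1 / 2) ^ n"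
  proof (rule pseudonorm_exists[of V])
    show "0 \<in> V n" for n using V[of n] by blast
    show "- a \<in> V n" if "a \<in> V n" for n a using V[of n] that by blast
    show "a + b + c \<in> V n" if "a \<in> V (Suc n)" "b \<in> V (Suc n)" "c \<in> V (Suc n)" for n a b c
      using V_Suc[of n] that by blast
  qed (rule that)
  show ?thesis
  proof (rule that[of q, OF q(1-5)])
    show "a \<in> U" if "q a < 1" for a
    proof -
      have "a \<in> V 0" "0 \<in> V 0" using q(6)[OF that] V[of 0] by auto
      then have "a + 0 + 0 \<in> U" using V[of 0] by (simp only: funpow_0)
      then show ?thesis by simp
    qed
    fix e :: real assume e: "e > 0"
    obtain n where n: "(1 / 2 :: real) ^ n < e" using real_arch_pow_inv[OF e, of "1 / 2"] by auto
    have "\<forall>a\<in>V n. q a < e" using q(7) n by (meson le_less_trans)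
    then show "\<exists>B. openin T B \<and> 0 \<in> B \<and> (\<forall>a\<in>B. q a < e)" using V[of n] by blast
  qed
qed

abbreviation ri :: "('k \<Rightarrow>\<^sub>0 int) \<Rightarrow> 'k \<Rightarrow>\<^sub>0 real" where "ri a \<equiv> Poly_Mapping.map real_of_int a"

lemma lookup_ri: "Poly_Mapping.lookup (ri a) x = real_of_int (Poly_Mapping.lookup a x)"
  by (simp add: lookup_map_zero)

lemma ri_add: "ri (a + b) = ri a + ri b"
  by (intro poly_mapping_eqI) (simp add: lookup_ri lookup_add)

lemma ri_diff: "ri (a - b) = ri a - ri b"
  by (intro poly_mapping_eqI) (simp add: lookup_ri lookup_minus)

lemma ri_frag_of: "ri (frag_of x) = delta x"
  by (intro poly_mapping_eqI) (simp add: lookup_ri lookup_single when_def)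

lemma keys_ri: "Poly_Mapping.keys (ri a) = Poly_Mapping.keys a"
  by (auto simp: in_keys_iff lookup_ri)

lemma inj_ri: "ri a = ri b \<Longrightarrow> a = b"
  by (intro poly_mapping_eqI) (metis lookup_ri of_int_eq_iff)

context compact_Hausdorff_K
begin

abbreviation "FA \<equiv> free_Abelian_group (topspace K)"
abbreviation "evA \<equiv> \<lambda>a. ev (ri a)"

lemma evA_dual: "Poly_Mapping.keys a \<subseteq> topspace K \<Longrightarrow> evA a \<in> dualK"
  by (intro ev_dual) (simp add: keys_ri)

lemma evA_hom: "evA \<in> hom FA Mc"
proof (rule homI)
  fix a b assume "a \<in> carrier FA" "b \<in> carrier FA"
  have "ev (ri a + ri b) = (\<lambda>f\<in>CK. evA a f + evA b f)"
    by (rule extensionalityI[of _ CK]) (simp_all add: ev_add, simp add: ev_ext)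
  then show "evA (a \<otimes>\<^bsub>FA\<^esub> b) = evA a \<otimes>\<^bsub>Mc\<^esub> evA b" by (simp add: ri_add Mc_simps)
qed (simp add: Mc_simps evA_dual)

lemma evA_inj: "inj_on evA (carrier FA)"
proof (rule inj_onI)
  fix a b assume "a \<in> carrier FA" "b \<in> carrier FA" "evA a = evA b"
  then have "ri a = ri b" by (intro inj_onD[OF ev_inj]) (auto simp: keys_ri)
  then show "a = b" by (rule inj_ri)
qed

lemma evA_sum:
  assumes f: "f \<in> CK"
  shows "evA (\<Sum>i<n. frag_of (x i) - frag_of (y i)) f = (\<Sum>i<(n::nat). f (x i)) - (\<Sum>i<n. f (y i))"
proof (induction n)
  case 0
  have "ri 0 = (0 :: 'a \<Rightarrow>\<^sub>0 real)" by (intro poly_mapping_eqI) (simp add: lookup_ri)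
  then show ?case using f by (simp add: ev_ext)
next
  case (Suc n)
  then show ?case by (simp add: ri_add ri_diff ri_frag_of ev_add[OF f] ev_diff[OF f] ev_delta[OF f])
qed

text \<open>As for \<open>L(K)\<close>: the universal property is applied to the topology induced from \<open>M\<^sub>c(K)\<close>.\<close>
lemma free_Abelian_evA_continuous:
  assumes \<tau>: "free_abelian_group_topology K \<tau>"
  shows "continuous_map \<tau> Mct evA"
proof -
  let ?P = "pullback_topology (carrier FA) evA Mct"
  have top: "topspace \<tau> = carrier FA"
    using \<tau> by (simp add: free_abelian_group_topology_def topological_abelian_group_def)
  have P: "topological_abelian_group FA ?P"
    by (rule topological_abelian_group_pullback[OF abelian_free_Abelian_group evA_hom evA_inj Mc_topological_abelian_group])
  have "continuous_map K ?P frag_of"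
    by (rule continuous_map_pullback') (use continuous_delta_Mc in \<open>auto simp: comp_def ri_frag_of\<close>)
  then obtain h where h: "h \<in> hom FA FA" "continuous_map \<tau> ?P h" "\<And>x. x \<in> topspace K \<Longrightarrow> h (frag_of x) = frag_of x"
    using \<tau> P unfolding free_abelian_group_topology_def by blast
  interpret group_hom FA FA h using h(1) by (simp add: group_hom_def group_hom_axioms_def)
  have "h a = a" if "Poly_Mapping.keys a \<subseteq> topspace K" for a
  proof (rule free_Abelian_group_induct[OF that])
    show "h 0 = 0" using hom_one by simp
    show "h (frag_of x) = frag_of x" if "x \<in> topspace K" for x by (rule h(3)[OF that])
    fix a b :: "'a \<Rightarrow>\<^sub>0 int"
    assume ab: "Poly_Mapping.keys a \<subseteq> topspace K" "Poly_Mapping.keys b \<subseteq> topspace K" "h a = a" "h b = b"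
    have "h (a \<otimes>\<^bsub>FA\<^esub> inv\<^bsub>FA\<^esub> b) = h a \<otimes>\<^bsub>FA\<^esub> inv\<^bsub>FA\<^esub> (h b)"
      using ab(1,2) G.inv_closed[of b] hom_mult[of a "inv\<^bsub>FA\<^esub> b"] hom_inv[of b]
      by (simp only: carrier_free_Abelian_group_iff)
    then show "h (a - b) = a - b" using ab by simp
  qed
  moreover have "continuous_map ?P Mct evA"
    using continuous_map_pullback[OF continuous_map_id, of "carrier FA" evA] by simp
  ultimately show ?thesis
    by (intro continuous_map_eq[OF continuous_map_compose[OF h(2)]]) (auto simp: top)
qed

text \<open>Close to a point \<open>a\<close> of \<open>A(K)\<close> in the induced topology, differences \<open>b - a\<close> have coefficient sum 0, since it is
  an integer and the value of \<open>b - a\<close> at the constant function 1.  Such a difference is a sum of \<open>n\<close>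
  differences of points, and its pseudonorm is at most the cost of a cheapest matching, which duality
  expresses by the value of \<open>b - a\<close> at a 1-Lipschitz function.\<close>
theorem free_abelian_group_embedding:
  assumes \<tau>: "free_abelian_group_topology K \<tau>"
  shows "topological_group_embedding FA \<tau> Mc Mct evA"
proof -
  have G: "topological_abelian_group FA \<tau>" and emb: "embedding_map K \<tau> frag_of"
    using \<tau> by (auto simp: free_abelian_group_topology_def)
  have top: "topspace \<tau> = carrier FA" using G by (simp add: topological_abelian_group_def)
  have frag_cont: "continuous_map K \<tau> frag_of"
    using homeomorphic_imp_continuous_map[OF emb[unfolded embedding_map_def]]
    by (simp add: continuous_map_in_subtopology)
  have "embedding_map \<tau> Mct evA"
  proof (rule embedding_map_pointwiseI)
    show "continuous_map \<tau> Mct evA" by (rule free_Abelian_evA_continuous[OF \<tau>])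
    show "inj_on evA (topspace \<tau>)" unfolding top by (rule evA_inj)
    fix U a assume U: "openin \<tau> U" "a \<in> U"
    then have a: "Poly_Mapping.keys a \<subseteq> topspace K" using openin_subset top by fastforce
    have "continuous_map \<tau> \<tau> (\<lambda>b. a \<otimes>\<^bsub>FA\<^esub> b)"
      using a by (intro topological_abelian_group_continuous_mult[OF G]) (auto simp: top)
    then have shift: "continuous_map \<tau> \<tau> (\<lambda>b. a + b)" by simp
    define U' where "U' = {b \<in> topspace \<tau>. a + b \<in> U}"
    have U': "openin \<tau> U'" unfolding U'_def by (rule openin_continuous_map_preimage[OF shift U(1)])
    have U'0: "0 \<in> U'" using U by (simp add: U'_def top)
    obtain q where q: "\<And>a b. q (a + b) \<le> q a + q b" "\<And>a. q (- a) = q a"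
      "\<And>a. 0 \<le> q a" "\<And>a. q a \<le> (1 :: real)" "q 0 = 0" "\<And>a. q a < 1 \<Longrightarrow> a \<in> U'"
      "\<And>e. e > 0 \<Longrightarrow> \<exists>B. openin \<tau> B \<and> 0 \<in> B \<and> (\<forall>a\<in>B. q a < e)"
      by (rule free_Abelian_group_pseudonorm[OF G U' U'0]) (rule that)
    define d where "d u v = q (frag_of u - frag_of v)" for u v
    have d0: "d u u = 0" for u by (simp add: d_def q)
    have dsym: "d u v = d v u" for u v using q(2)[of "frag_of u - frag_of v"] by (simp add: d_def)
    have dtri: "d u z \<le> d u v + d v z" for u v z
      using q(1)[of "frag_of u - frag_of v" "frag_of v - frag_of z"] by (simp add: d_def)
    have pm: "continuous_pseudometric d"
      unfolding continuous_pseudometric_def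
    proof (intro conjI ballI allI impI)
      fix x and e :: real assume x: "x \<in> topspace K" and e: "e > 0"
      obtain B where B: "openin \<tau> B" "0 \<in> B" "\<forall>a\<in>B. q a < e" using q(7)[OF e] by blast
      have "continuous_map K \<tau> (\<lambda>y. frag_of x \<otimes>\<^bsub>FA\<^esub> inv\<^bsub>FA\<^esub> (frag_of y))"
        using x by (intro topological_abelian_group_continuous_mult[OF G] topological_abelian_group_continuous_inv[OF G] frag_cont)
          (simp add: top)
      then have cont: "continuous_map K \<tau> (\<lambda>y. frag_of x - frag_of y)"
        by (rule continuous_map_eq) simp
      have "openin K {y \<in> topspace K. frag_of x - frag_of y \<in> B}"
        by (rule openin_continuous_map_preimage[OF cont B(1)])
      then show "\<exists>V. openin K V \<and> x \<in> V \<and> (\<forall>y\<in>V. d x y < e)"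
        using x B(2,3) by (intro exI[of _ "{y \<in> topspace K. frag_of x - frag_of y \<in> B}"]) (auto simp: d_def)
    qed (rule d0 dsym dtri)+
    interpret P: pseudometric_K K d 1 by unfold_locales (use pm in auto)
    have q_sum: "q (\<Sum>i<n. w i) \<le> (\<Sum>i<n. q (w i))" for w and n :: nat
    proof (induction n)
      case (Suc n)
      then show ?case using q(1)[of "\<Sum>i<n. w i" "w n"] by simp
    qed (simp add: q)
    have dominated: "q b \<le> P.N (evA b)"
      if b: "Poly_Mapping.keys b \<subseteq> topspace K" and balanced: "(\<Sum>u\<in>Poly_Mapping.keys b. Poly_Mapping.lookup b u) = 0" for b
    proof -
      obtain n x y where xy: "\<forall>i<(n::nat). x i \<in> Poly_Mapping.keys b \<and> y i \<in> Poly_Mapping.keys b"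
        and beq: "b = (\<Sum>i<n. frag_of (x i) - frag_of (y i))"
        using balanced_decomposition[OF finite_keys order_refl balanced] by blast
      have xyK: "x i \<in> topspace K" "y i \<in> topspace K" if "i < n" for i using xy that b by auto
      obtain \<sigma> f where \<sigma>: "\<sigma> permutes {..<n}"
        and Lip: "\<And>u v. u \<in> topspace K \<Longrightarrow> v \<in> topspace K \<Longrightarrow> \<bar>f u - f v\<bar> \<le> d u v"
        and bd: "\<And>u. u \<in> topspace K \<Longrightarrow> \<bar>f u\<bar> \<le> 1"
        and opt: "(\<Sum>i<n. d (x i) (y (\<sigma> i))) \<le> (\<Sum>i<n. f (x i)) - (\<Sum>i<n. f (y i))"
      proof (rule assignment_duality[where S = "topspace K" and d = d and M = 1 and n = n and x = x and y = y])
        show "0 \<le> d u v" "d u v \<le> 1" for u v using q(3,4) by (auto simp: d_def)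
      qed (rule d0 dsym dtri xyK that | assumption)+
      let ?f = "restrict f (topspace K)"
      have "continuous_map K Met_TC.mtopology f"
        unfolding Met_TC.continuous_map_to_metric
      proof (intro ballI allI impI)
        fix u and e :: real assume u: "u \<in> topspace K" and e: "e > 0"
        obtain V where V: "openin K V" "u \<in> V" "\<forall>v\<in>V. d u v < e"
          using pm u e unfolding continuous_pseudometric_def by meson
        have "f v \<in> Met_TC.mball (f u) e" if v: "v \<in> V" for v
        proof -
          have "v \<in> topspace K" using v openin_subset[OF V(1)] by blast
          then have "\<bar>f u - f v\<bar> < e" using Lip[OF u] V(3) v by (meson le_less_trans)
          then show ?thesis by (simp add: dist_real_def)
        qed
        with V show "\<exists>V. openin K V \<and> u \<in> V \<and> (\<forall>v\<in>V. f v \<in> Met_TC.mball (f u) e)" by blast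
      qed
      then have fC: "?f \<in> CK" by (intro CK_restrict) simp
      have "b = (\<Sum>i<n. frag_of (x i)) - (\<Sum>i<n. frag_of (y i))" by (simp add: beq sum_subtractf)
      also have "(\<Sum>i<n. frag_of (y i)) = (\<Sum>i<n. frag_of (y (\<sigma> i)))"
        using sum.permute[OF \<sigma>, of "\<lambda>i. frag_of (y i)"] by (simp add: comp_def)
      finally have "b = (\<Sum>i<n. frag_of (x i) - frag_of (y (\<sigma> i)))" by (simp add: sum_subtractf)
      then have "q b \<le> (\<Sum>i<n. d (x i) (y (\<sigma> i)))" using q_sum by (simp add: d_def)
      also have "\<dots> \<le> (\<Sum>i<n. ?f (x i)) - (\<Sum>i<n. ?f (y i))"
        using opt xyK by simp
      also have "\<dots> = evA b ?f" unfolding beq by (rule evA_sum[OF fC, symmetric])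
      also have "\<dots> \<le> \<bar>evA b ?f\<bar>" by (rule abs_ge_self)
      also have "\<dots> \<le> P.N (evA b)"
        by (rule P.Lipschitz_dominated[OF evA_dual[OF b] fC]) (use Lip bd in auto)
      finally show ?thesis .
    qed
    obtain V where V: "openin Mct V" "evA a \<in> V"
      "\<And>\<psi>. \<psi> \<in> V \<Longrightarrow> P.N (\<psi> \<otimes>\<^bsub>Mc\<^esub> inv\<^bsub>Mc\<^esub> (evA a)) < 1"
      by (rule family_norm_nbhd[OF P.geometric_J_h evA_dual[OF a] zero_less_one]) blast
    define one where "one = (\<lambda>x\<in>topspace K. 1 :: real)"
    have one: "one \<in> CK" unfolding one_def by (rule CK_const)
    let ?W = "V \<inter> nbhd (evA a) {one} 1"
    have "openin Mct ?W"
      using one by (intro openin_Int V(1) openin_nbhd evA_dual a) auto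
    moreover have "evA a \<in> ?W" using V(2) nbhd_self[OF evA_dual[OF a]] by simp
    moreover have "b \<in> U" if "b \<in> topspace \<tau>" and bW: "evA b \<in> ?W" for b
    proof -
      have b: "Poly_Mapping.keys b \<subseteq> topspace K" using that by (simp add: top)
      have ba: "Poly_Mapping.keys (b - a) \<subseteq> topspace K" using a b keys_diff[of b a] by blast
      have "evA (b - a) one = real_of_int (\<Sum>u\<in>Poly_Mapping.keys (b - a). Poly_Mapping.lookup (b - a) u)"
        using ba one by (simp add: ev_ext keys_ri lookup_ri one_def subset_iff cong: sum.cong)
      moreover have "\<bar>evA (b - a) one\<bar> < 1" using bW one by (simp add: nbhd_def ri_diff ev_diff)
      ultimately have bal: "(\<Sum>u\<in>Poly_Mapping.keys (b - a). Poly_Mapping.lookup (b - a) u) = 0" by linarith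
      have "evA (b - a) = evA b \<otimes>\<^bsub>Mc\<^esub> inv\<^bsub>Mc\<^esub> (evA a)"
        unfolding Mc_diff[OF P.geometric_J_h evA_dual[OF b] evA_dual[OF a]] ri_diff
        by (rule extensionalityI[of _ CK]) (simp_all add: ev_diff, simp add: ev_ext)
      then have "q (b - a) \<le> P.N (evA b \<otimes>\<^bsub>Mc\<^esub> inv\<^bsub>Mc\<^esub> (evA a))"
        using dominated[OF ba bal] by (simp only:)
      also have "\<dots> < 1" by (rule V(3)) (use bW in blast)
      finally have "q (b - a) < 1" .
      then have "b - a \<in> U'" by (rule q(6))
      then show ?thesis by (simp add: U'_def)
    qed
    ultimately show "\<exists>W. openin Mct W \<and> evA a \<in> W \<and> (\<forall>b\<in>topspace \<tau>. evA b \<in> W \<longrightarrow> b \<in> U)"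
      by blast
  qed
  then show ?thesis
    using evA_hom by (simp add: topological_group_embedding_def top Mc_topspace Mc_simps)
qed

end

theorem corollary3p6:
  fixes K :: "'k topology"
  assumes "compact_space K" and "Hausdorff_space K"
  shows "unitarily_representable (Mc_group K) (Mc_topology K) \<and>
    (\<forall>\<tau>. free_lcs_topology K \<tau> \<longrightarrow>
       topological_group_embedding (add_monoid (free_vector_space (topspace K))) \<tau>
         (Mc_group K) (Mc_topology K) (evaluation K) \<and>
       unitarily_representable (add_monoid (free_vector_space (topspace K))) \<tau>) \<and>
    (\<forall>\<tau>. free_abelian_group_topology K \<tau> \<longrightarrow>
       topological_group_embedding (free_Abelian_group (topspace K)) \<tau>
         (Mc_group K) (Mc_topology K) (\<lambda>a. evaluation K (Poly_Mapping.map real_of_int a)) \<and>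
       unitarily_representable (free_Abelian_group (topspace K)) \<tau>)"
proof -
  interpret compact_Hausdorff_K K by unfold_locales (rule assms)+
  have "topological_group_embedding (add_monoid FL) \<tau> Mc Mct ev \<and> unitarily_representable (add_monoid FL) \<tau>"
    if \<tau>: "free_lcs_topology K \<tau>" for \<tau>
    using free_lcs_embedding[OF \<tau>] embedded_group_unitarily_representable[OF free_lcs_embedding[OF \<tau>]] \<tau>
    by (simp add: free_lcs_topology_def locally_convex_space_def)
  moreover have "topological_group_embedding FA \<tau> Mc Mct evA \<and> unitarily_representable FA \<tau>"
    if \<tau>: "free_abelian_group_topology K \<tau>" for \<tau>
    using free_abelian_group_embedding[OF \<tau>]
      embedded_group_unitarily_representable[OF free_abelian_group_embedding[OF \<tau>]] \<tau>
    by (simp add: free_abelian_group_topology_def)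
  ultimately show ?thesis using Mc_unitarily_representable by blast
qed

end
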